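(* Let $\mathcal{M}$ be a compact connected $d$-dimensional Riemannian manifold, regarded as a metric measure space with its geodesic distance $\theta$ and Riemannian measure $\mu$, rescaled so that $\operatorname{diam}\mathcal{M}=1$ and $\mu(\mathcal{M})=1$. Then there are positive constants $c_1,c_2$ depending only on $\mathcal{M}$ such that (Condition A) $c_1^{-1}r^d\le v(y,r)\le c_1r^d$ for all $y\in\mathcal{M}$ and $r\in[0,1]$, and (Condition B) $|v(y,r_1)-v(y,r_2)|\le c_2|r_1-r_2|$ for all $y\in\mathcal{M}$ and $r_1,r_2\in[0,1]$.
   Context: Riemannian manifolds are without boundary. $B(y,r)=\{x\in\mathcal{M}:\theta(x,y)<r\}$ is the metric ball and $v(y,r)=\mu(B(y,r))$, with the convention that $B(y,r)=\emptyset$, $v(y,r)=0$ if $r\le0$, and $B(y,r)=\mathcal{M}$, $v(y,r)=1$ if $r\ge1$. The rescaling means dividing the geodesic distance by the diameter of the manifold and the Riemannian volume measure by the total volume. *)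

theory Defs
  imports "HOL-Analysis.Analysis"
begin

section \<open>Smooth maps on open subsets of normed spaces\<close>

primrec Ck_on ::
  "nat \<Rightarrow> 'a::real_normed_vector set \<Rightarrow> ('a \<Rightarrow> 'b::real_normed_vector) \<Rightarrow> bool" where
  "Ck_on 0 S f \<longleftrightarrow> continuous_on S f"
| "Ck_on (Suc k) S f \<longleftrightarrow>
     (\<forall>x\<in>S. f differentiable (at x)) \<and> (\<forall>v. Ck_on k S (\<lambda>x. frechet_derivative f (at x) v))"

definition smooth_on ::
  "'a::real_normed_vector set \<Rightarrow> ('a \<Rightarrow> 'b::real_normed_vector) \<Rightarrow> bool" where
  "smooth_on S f \<longleftrightarrow> (\<forall>k. Ck_on k S f)"

section \<open>Smooth manifolds\<close>

text \<open>A chart is a pair \<open>(U, \<phi>)\<close>; only the values of \<open>\<phi>\<close> on \<open>U\<close> are relevant.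
  The dimension of the manifold is \<open>CARD('n)\<close>.\<close>

type_synonym ('a, 'n) chart = "'a set \<times> ('a \<Rightarrow> real^'n)"

definition is_chart :: "'a topology \<Rightarrow> ('a, 'n::finite) chart \<Rightarrow> bool" where
  "is_chart X c \<longleftrightarrow> (case c of (U, \<phi>) \<Rightarrow>
     openin X U \<and> open (\<phi> ` U) \<and>
     homeomorphic_map (subtopology X U) (top_of_set (\<phi> ` U)) \<phi>)"

definition transition ::
  "('a, 'n::finite) chart \<Rightarrow> ('a, 'n) chart \<Rightarrow> real^'n \<Rightarrow> real^'n" where
  "transition c c' = snd c' \<circ> inv_into (fst c) (snd c)"

definition smooth_atlas :: "'a topology \<Rightarrow> ('a, 'n::finite) chart set \<Rightarrow> bool" where
  "smooth_atlas X A \<longleftrightarrow>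
     (\<forall>c\<in>A. is_chart X c) \<and>
     (\<Union>c\<in>A. fst c) = topspace X \<and>
     (\<forall>c\<in>A. \<forall>c'\<in>A. smooth_on (snd c ` (fst c \<inter> fst c')) (transition c c'))"

definition smooth_manifold :: "'a topology \<Rightarrow> ('a, 'n::finite) chart set \<Rightarrow> bool" where
  "smooth_manifold X A \<longleftrightarrow> Hausdorff_space X \<and> second_countable X \<and> smooth_atlas X A"

section \<open>Riemannian metrics\<close>

text \<open>The metric is a smooth symmetric positive definite \<open>(0,2)\<close>-tensor field, given by its
  component matrices \<open>g c x = (g\<^sub>i\<^sub>j(x))\<close> at the points \<open>x\<close> of the image of each chart \<open>c\<close>.
  The last clause is the transformation law of such tensors under a change of charts.\<close>

type_synonym ('a, 'n) metric_components = "('a, 'n) chart \<Rightarrow> real^'n \<Rightarrow> real^'n^'n"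

definition riemannian_metric ::
  "('a, 'n::finite) chart set \<Rightarrow> ('a, 'n) metric_components \<Rightarrow> bool" where
  "riemannian_metric A g \<longleftrightarrow>
     (\<forall>c\<in>A. smooth_on (snd c ` fst c) (g c)) \<and>
     (\<forall>c\<in>A. \<forall>x \<in> snd c ` fst c.
        transpose (g c x) = g c x \<and> (\<forall>v. v \<noteq> 0 \<longrightarrow> v \<bullet> (g c x *v v) > 0)) \<and>
     (\<forall>c\<in>A. \<forall>c'\<in>A. \<forall>p \<in> fst c \<inter> fst c'. \<forall>v w.
        (let D = frechet_derivative (transition c c') (at (snd c p))
         in v \<bullet> (g c (snd c p) *v w) = D v \<bullet> (g c' (snd c' p) *v D w)))"

definition riemannian_manifold ::
  "'a topology \<Rightarrow> ('a, 'n::finite) chart set \<Rightarrow> ('a, 'n) metric_components \<Rightarrow> bool" where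
  "riemannian_manifold X A g \<longleftrightarrow> smooth_manifold X A \<and> riemannian_metric A g"

section \<open>Geodesic distance\<close>

definition C1_curve_on ::
  "'a topology \<Rightarrow> ('a, 'n::finite) chart set \<Rightarrow> real \<Rightarrow> real \<Rightarrow> (real \<Rightarrow> 'a) \<Rightarrow> bool" where
  "C1_curve_on X A a b \<gamma> \<longleftrightarrow>
     continuous_map (top_of_set {a..b}) X \<gamma> \<and>
     (\<forall>c\<in>A. \<exists>D. continuous_on {t\<in>{a..b}. \<gamma> t \<in> fst c} D \<and>
        (\<forall>t\<in>{a..b}. \<gamma> t \<in> fst c \<longrightarrow>
           ((snd c \<circ> \<gamma>) has_vector_derivative D t) (at t within {a..b})))"

text \<open>\<open>S\<close> is the finite set of break points. Between two break points the curve is \<open>C\<^sup>1\<close> up to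
  and including the end points, so that its speed is bounded and integrable. (The library's
  \<^const>\<open>piecewise_C1_differentiable_on\<close> allows the derivative to blow up at a break point.)\<close>

definition piecewise_C1_curve ::
  "'a topology \<Rightarrow> ('a, 'n::finite) chart set \<Rightarrow> (real \<Rightarrow> 'a) \<Rightarrow> bool" where
  "piecewise_C1_curve X A \<gamma> \<longleftrightarrow>
     continuous_map (top_of_set {0..1}) X \<gamma> \<and>
     (\<exists>S. finite S \<and> (\<forall>a b. 0 \<le> a \<and> a < b \<and> b \<le> 1 \<and> {a<..<b} \<inter> S = {} \<longrightarrow>
        C1_curve_on X A a b \<gamma>))"

text \<open>By the transformation law of \<open>g\<close> the speed does not depend on the chart that is chosen
  around \<open>\<gamma> t\<close>.\<close>

definition curve_speed ::
  "('a, 'n::finite) chart set \<Rightarrow> ('a, 'n) metric_components \<Rightarrow> (real \<Rightarrow> 'a) \<Rightarrow> real \<Rightarrow> real" where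
  "curve_speed A g \<gamma> t =
     (let c = (SOME c. c \<in> A \<and> \<gamma> t \<in> fst c);
          v = vector_derivative (snd c \<circ> \<gamma>) (at t within {0..1})
      in sqrt (v \<bullet> (g c (snd c (\<gamma> t)) *v v)))"

definition curve_length ::
  "('a, 'n::finite) chart set \<Rightarrow> ('a, 'n) metric_components \<Rightarrow> (real \<Rightarrow> 'a) \<Rightarrow> real" where
  "curve_length A g \<gamma> = integral {0..1} (curve_speed A g \<gamma>)"

definition geodesic_dist ::
  "'a topology \<Rightarrow> ('a, 'n::finite) chart set \<Rightarrow> ('a, 'n) metric_components \<Rightarrow> 'a \<Rightarrow> 'a \<Rightarrow> real" where
  "geodesic_dist X A g x y =
     Inf {curve_length A g \<gamma> |\<gamma>. piecewise_C1_curve X A \<gamma> \<and> \<gamma> 0 = x \<and> \<gamma> 1 = y}"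

definition geodesic_diam ::
  "'a topology \<Rightarrow> ('a, 'n::finite) chart set \<Rightarrow> ('a, 'n) metric_components \<Rightarrow> real" where
  "geodesic_diam X A g =
     Sup {geodesic_dist X A g x y |x y. x \<in> topspace X \<and> y \<in> topspace X}"

section \<open>Riemannian measure\<close>

text \<open>The Riemannian measure is the unique Borel measure with density
  \<open>sqrt (det (g\<^sub>i\<^sub>j))\<close> with respect to Lebesgue measure in every chart.\<close>

definition is_riemannian_measure ::
  "'a topology \<Rightarrow> ('a, 'n::finite) chart set \<Rightarrow> ('a, 'n) metric_components \<Rightarrow> 'a measure \<Rightarrow> bool"
  where
  "is_riemannian_measure X A g \<mu> \<longleftrightarrow>
     space \<mu> = topspace X \<and>
     sets \<mu> = sigma_sets (topspace X) {U. openin X U} \<and>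
     (\<forall>c\<in>A. \<forall>E \<in> sets \<mu>. E \<subseteq> fst c \<longrightarrow>
        emeasure \<mu> E = (\<integral>\<^sup>+x \<in> snd c ` E. ennreal (sqrt (det (g c x))) \<partial>lborel))"

section \<open>The rescaled metric measure space\<close>

definition rescaled_dist ::
  "'a topology \<Rightarrow> ('a, 'n::finite) chart set \<Rightarrow> ('a, 'n) metric_components \<Rightarrow> 'a \<Rightarrow> 'a \<Rightarrow> real" where
  "rescaled_dist X A g x y = geodesic_dist X A g x y / geodesic_diam X A g"

definition rescaled_measure :: "'a measure \<Rightarrow> 'a measure" where
  "rescaled_measure \<mu> = scale_measure (1 / emeasure \<mu> (space \<mu>)) \<mu>"

text \<open>For a metric measure space with diameter \<open>1\<close>. By convention balls of radius at least \<open>1\<close>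
  are the whole space, also when there are points at distance exactly \<open>1\<close> from the centre.\<close>

definition metric_ball :: "'a set \<Rightarrow> ('a \<Rightarrow> 'a \<Rightarrow> real) \<Rightarrow> 'a \<Rightarrow> real \<Rightarrow> 'a set" where
  "metric_ball M \<theta> y r =
     (if r \<le> 0 then {} else if r \<ge> 1 then M else {x \<in> M. \<theta> x y < r})"

definition ball_volume :: "('a \<Rightarrow> 'a \<Rightarrow> real) \<Rightarrow> 'a measure \<Rightarrow> 'a \<Rightarrow> real \<Rightarrow> real" where
  "ball_volume \<theta> \<mu> y r = measure \<mu> (metric_ball (space \<mu>) \<theta> y r)"

end

theory Submission
  imports Defs
begin

text \<open>In a chart the distance \<open>d\<close> is bi-Lipschitz to the Euclidean one and the volume is comparable
  to Lebesgue measure, which gives Condition A.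

  Condition B needs neither geodesics nor the exponential map. On a ball of radius \<open>\<rho>\<close> around a
  point \<open>q\<close> of a chart, \<open>d\<close> is the norm of \<open>g(q)\<close> up to a factor \<open>1 + O(\<rho>)\<close>. By Stewart's identity a
  point that lies between \<open>x\<close> and \<open>x\<^sub>0\<close> in the sense of \<open>d\<close>, where \<open>d(x, x\<^sub>0) = \<rho>\<close>, therefore has
  distance \<open>O(\<rho>\<^bsup>3/2\<^esup>)\<close> from the corresponding point of the segment. Summing over dyadic scales, the
  points between \<open>x\<close> and \<open>y\<close> at distance \<open>s \<le> s\<^sub>0\<close> from \<open>x\<close> are within \<open>O(s \<surd>s\<^sub>0)\<close> of a single ray, so
  \<open>u = d(y, \<cdot>)\<close> decreases along that ray with slope at least \<open>1/2\<close> up to the length \<open>s\<^sub>0\<close>. Finitely many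
  directions \<open>w\<close> suffice for all \<open>x\<close>. On the part of \<open>{a \<le> u \<le> b}\<close> that belongs to \<open>w\<close>, the translates
  by multiples of \<open>4(b - a)w\<close> are disjoint; about \<open>s\<^sub>0 / (b - a)\<close> of them fit into a bounded region, so
  that part has volume \<open>O(b - a)\<close>.\<close>

section \<open>Annuli in an almost Euclidean chart\<close>

text \<open>The function \<open>d y\<close> need not be differentiable and its level sets need not
  be hypersurfaces, for instance at the cut locus, so areas of level sets are not estimated; descent
  along rays of definite length takes that place. Stewart's identity is linear in the squared
  distances. Each of them is known up to a relative error O(\<rho>), thus up to O(\<rho>^3), and the
  exact Euclidean values cancel; so the squared deviation is O(\<rho>^3). Relative to \<rho> the
  deviation is O(\<rho>^(1/2)), and this positive power is what makes the dyadic sum converge.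

  A ray cannot descend further than the value of \<open>d y\<close> at its start, so
  \<open>s0 \<le> a\<close> is required. Away from \<open>y\<close> a constant \<open>s0\<close>
  will do. Near \<open>y\<close> the choice \<open>s0 = a\<close> loses a factor 1/a; it is regained
  because an annulus with b \<le> 2a lies in a ball of volume O(a^n) with n at least 1. Annuli with
  b > 2a satisfy b \<le> 2(b - a) and are handled by Condition A.\<close>

definition qnorm :: "real^'n^'n \<Rightarrow> real^'n \<Rightarrow> real" where
  "qnorm H v = sqrt (v \<bullet> (H *v v))"

text \<open>Stewart's theorem for the triangle 0, \<open>p\<close>, \<open>q\<close> and the point
  \<open>t q\<close> of the side opposite to \<open>p\<close>. The mixed terms enter both sides only
  through the sum \<open>p \<bullet> (H *v q) + q \<bullet> (H *v p)\<close>.\<close>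

lemma quadratic_form_stewart:
  fixes H :: "real^'n^'n" and p q :: "real^'n" and t :: real
  shows "(p - t *\<^sub>R q) \<bullet> (H *v (p - t *\<^sub>R q)) =
    (1 - t) * (p \<bullet> (H *v p)) + t * ((q - p) \<bullet> (H *v (q - p))) - t * (1 - t) * (q \<bullet> (H *v q))"
  by (simp add: matrix_vector_mult_diff_distrib matrix_vector_mult_scaleR inner_diff_left inner_diff_right algebra_simps)

lemma qnorm_commute: "qnorm H (a - b) = qnorm H (b - a)"
proof -
  have "(a - b) \<bullet> (H *v (a - b)) = (b - a) \<bullet> (H *v (b - a))"
    by (simp add: matrix_vector_mult_diff_distrib inner_diff_left inner_diff_right)
  thus ?thesis by (simp add: qnorm_def)
qed

section \<open>Intermediate points and descent directions in one chart\<close>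

locale geodesic_space =
  fixes M :: "'a set" and d :: "'a \<Rightarrow> 'a \<Rightarrow> real"
  assumes d_nonneg: "\<And>x y. x \<in> M \<Longrightarrow> y \<in> M \<Longrightarrow> 0 \<le> d x y"
    and d_commute: "\<And>x y. x \<in> M \<Longrightarrow> y \<in> M \<Longrightarrow> d x y = d y x"
    and d_refl: "\<And>x. x \<in> M \<Longrightarrow> d x x = 0"
    and d_triangle: "\<And>x y z. x \<in> M \<Longrightarrow> y \<in> M \<Longrightarrow> z \<in> M \<Longrightarrow> d x z \<le> d x y + d y z"
    and d_between: "\<And>x y s. x \<in> M \<Longrightarrow> y \<in> M \<Longrightarrow> 0 \<le> s \<Longrightarrow> s \<le> d x y \<Longrightarrow>
      \<exists>z\<in>M. d x z = s \<and> d z y = d x y - s"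
begin

abbreviation "dball y r \<equiv> {x\<in>M. d y x < r}"

abbreviation "annulus y a b \<equiv> {x\<in>M. d y x \<in> {a..b}}"

end

text \<open>Two comparisons of different quality: \<open>L\<close> relates \<open>d\<close> to the
  Euclidean distance up to a bounded factor, which is too coarse to control directions;
  \<open>K\<close> relates it to the form frozen at a nearby point, with a factor that tends to 1 as
  \<rho> tends to 0. \<open>stays_in_chart\<close> allows the points supplied by
  \<open>d_between\<close> to be written in coordinates.\<close>

locale almost_euclidean_chart = geodesic_space M d
  for M :: "'a set" and d :: "'a \<Rightarrow> 'a \<Rightarrow> real" +
  fixes \<psi> :: "real^'n::finite \<Rightarrow> 'a" and G :: "real^'n \<Rightarrow> real^'n^'n" and c :: "real^'n"
    and R L K :: real
  assumes R_pos: "0 < R" and L_ge1: "1 \<le> L" and K_nonneg: "0 \<le> K"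
    and chart_in: "\<And>x. x \<in> ball c R \<Longrightarrow> \<psi> x \<in> M"
    and pos_form: "\<And>x v. x \<in> ball c R \<Longrightarrow> 0 \<le> v \<bullet> (G x *v v)"
    and norm_le_qnorm: "\<And>x v. x \<in> ball c R \<Longrightarrow> norm v \<le> L * qnorm (G x) v"
    and dist_le: "\<And>a b. a \<in> ball c R \<Longrightarrow> b \<in> ball c R \<Longrightarrow> d (\<psi> a) (\<psi> b) \<le> L * norm (a - b)"
    and norm_le: "\<And>a b. a \<in> ball c R \<Longrightarrow> b \<in> ball c R \<Longrightarrow> norm (a - b) \<le> L * d (\<psi> a) (\<psi> b)"
    and qnorm_le_dist: "\<And>q a b \<rho>. q \<in> ball c R \<Longrightarrow> a \<in> ball c R \<Longrightarrow> b \<in> ball c R \<Longrightarrow>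
      norm (a - q) \<le> \<rho> \<Longrightarrow> norm (b - q) \<le> \<rho> \<Longrightarrow> (1 - K * \<rho>) * qnorm (G q) (a - b) \<le> d (\<psi> a) (\<psi> b)"
    and dist_le_qnorm: "\<And>q a b \<rho>. q \<in> ball c R \<Longrightarrow> a \<in> ball c R \<Longrightarrow> b \<in> ball c R \<Longrightarrow>
      norm (a - q) \<le> \<rho> \<Longrightarrow> norm (b - q) \<le> \<rho> \<Longrightarrow> d (\<psi> a) (\<psi> b) \<le> (1 + K * \<rho>) * qnorm (G q) (a - b)"
    and stays_in_chart: "\<And>a z. a \<in> ball c R \<Longrightarrow> z \<in> M \<Longrightarrow> L * d (\<psi> a) z < R - dist c a \<Longrightarrow>
      z \<in> \<psi> ` ball c R"
begin

text \<open>If \<epsilon> = \<open>K * L * \<rho>\<close> were 0, the right-hand side of Stewart's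
  identity would be \<rho>^2 times (1-t)t^2 + t(1-t)^2 - t(1-t) = 0. What is left in general is
  t(1-t)\<rho>^2 times a term O(\<epsilon>). The form is frozen at \<open>x\<close>, and all three
  points are within \<open>L * \<rho>\<close> of it.\<close>

lemma intermediate_point_deviation:
  assumes x: "x \<in> ball c R" "x0 \<in> ball c R" "z \<in> ball c R"
    and dist: "d (\<psi> x) (\<psi> x0) = \<rho>" "d (\<psi> x) (\<psi> z) = t * \<rho>" "d (\<psi> z) (\<psi> x0) = (1 - t) * \<rho>"
    and t: "0 \<le> t" "t \<le> 1" and small: "K * L * \<rho> \<le> 1/2"
  shows "norm (z - x - t *\<^sub>R (x0 - x)) \<le> 2 * L * sqrt (K * L) * \<rho> * sqrt \<rho>"
proof -
  define \<epsilon> where "\<epsilon> = K * L * \<rho>"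
  have \<rho>0: "0 \<le> \<rho>" using d_nonneg[OF chart_in chart_in, of x x0] x dist(1) by simp
  have \<epsilon>: "0 \<le> \<epsilon>" "\<epsilon> \<le> 1/2" using \<rho>0 K_nonneg L_ge1 small by (auto simp: \<epsilon>_def)
  have nz: "norm (z - x) \<le> L * \<rho>"
  proof -
    have "norm (z - x) \<le> L * (t * \<rho>)" using norm_le[of x z] x dist(2) by (simp add: norm_minus_commute)
    also have "\<dots> \<le> L * \<rho>" using L_ge1 \<rho>0 t by (simp add: mult_left_le_one_le)
    finally show ?thesis .
  qed
  have nx0: "norm (x0 - x) \<le> L * \<rho>" using norm_le[of x x0] x dist(1) by (simp add: norm_minus_commute)
  have KLr: "K * (L * \<rho>) = \<epsilon>" by (simp add: \<epsilon>_def)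
  define N where "N v = qnorm (G x) v" for v
  have N2: "v \<bullet> (G x *v v) = (N v)\<^sup>2" for v
    using pos_form[OF x(1), of v] by (simp add: N_def qnorm_def)
  have N0: "0 \<le> N v" for v using pos_form[OF x(1), of v] by (simp add: N_def qnorm_def)
  let ?p = "z - x" and ?q = "x0 - x"
  have LR: "0 \<le> L * \<rho>" using L_ge1 \<rho>0 by simp
  have Np: "(1 - \<epsilon>) * N ?p \<le> t * \<rho>"
    using qnorm_le_dist[of x x z "L * \<rho>"] x nz dist(2) LR KLr qnorm_commute[of "G x" x z]
    by (simp add: N_def)
  have Nqp: "(1 - \<epsilon>) * N (?q - ?p) \<le> (1 - t) * \<rho>"
    using qnorm_le_dist[of x z x0 "L * \<rho>"] x nz nx0 dist(3) KLr qnorm_commute[of "G x" x0 z]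
    by (simp add: N_def)
  have Nq: "\<rho> \<le> (1 + \<epsilon>) * N ?q"
    using dist_le_qnorm[of x x0 x "L * \<rho>"] x nx0 dist(1) LR KLr d_commute[OF chart_in chart_in, of x x0]
    by (simp add: N_def)
  define \<beta> where "\<beta> = 1 / (1 - \<epsilon>)"
  \<comment> \<open>The right-hand side is the chord over [0, 1/2] of the convex function
    1/(1-\<epsilon>)^2, which is 4 at \<epsilon> = 1/2; hence the constant 6 and the factor
    \<open>1 - 2 * \<epsilon>\<close> below.\<close>
  have \<beta>: "\<beta>\<^sup>2 \<le> 1 + 6 * \<epsilon>"
  proof -
    have "(1 + 6 * \<epsilon>) * (1 - \<epsilon>)\<^sup>2 - 1 = \<epsilon> * ((1 - 2 * \<epsilon>) * (4 - 3 * \<epsilon>))"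
      by (simp add: power2_eq_square algebra_simps)
    also have "\<dots> \<ge> 0" using \<epsilon> by simp
    finally have "1 \<le> (1 + 6 * \<epsilon>) * (1 - \<epsilon>)\<^sup>2" by simp
    moreover have "0 < (1 - \<epsilon>)\<^sup>2" using \<epsilon> by simp
    ultimately show ?thesis unfolding \<beta>_def power_divide by (simp only: pos_divide_le_eq power_one)
  qed
  have bp: "N ?p \<le> \<beta> * (t * \<rho>)" using Np \<epsilon> by (simp add: \<beta>_def pos_le_divide_eq mult.commute)
  have bqp: "N (?q - ?p) \<le> \<beta> * ((1 - t) * \<rho>)" using Nqp \<epsilon> by (simp add: \<beta>_def pos_le_divide_eq mult.commute)
  have p2: "(N ?p)\<^sup>2 \<le> \<beta>\<^sup>2 * (t\<^sup>2 * \<rho>\<^sup>2)" using power_mono[OF bp N0, of 2] by (simp add: power_mult_distrib)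
  have qp2: "(N (?q - ?p))\<^sup>2 \<le> \<beta>\<^sup>2 * ((1 - t)\<^sup>2 * \<rho>\<^sup>2)" using power_mono[OF bqp N0, of 2] by (simp add: power_mult_distrib)
  have q2: "(1 - 2 * \<epsilon>) * \<rho>\<^sup>2 \<le> (N ?q)\<^sup>2"
  proof -
    have "\<rho>\<^sup>2 \<le> (1 + \<epsilon>)\<^sup>2 * (N ?q)\<^sup>2" using power_mono[OF Nq \<rho>0, of 2] by (simp add: power_mult_distrib)
    hence "(1 - 2 * \<epsilon>) * \<rho>\<^sup>2 \<le> (1 - 2 * \<epsilon>) * ((1 + \<epsilon>)\<^sup>2 * (N ?q)\<^sup>2)" using \<epsilon> by (intro mult_left_mono) auto
    also have "\<dots> = ((1 - 2 * \<epsilon>) * (1 + \<epsilon>)\<^sup>2) * (N ?q)\<^sup>2" by simp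
    also have "\<dots> \<le> 1 * (N ?q)\<^sup>2"
    proof (intro mult_right_mono)
      have "1 - (1 - 2 * \<epsilon>) * (1 + \<epsilon>)\<^sup>2 = \<epsilon>\<^sup>2 * (3 + 2 * \<epsilon>)" by (simp add: power2_eq_square algebra_simps)
      also have "\<dots> \<ge> 0" using \<epsilon> by simp
      finally show "(1 - 2 * \<epsilon>) * (1 + \<epsilon>)\<^sup>2 \<le> 1" by simp
    qed simp
    finally show ?thesis by simp
  qed
  have "(N (?p - t *\<^sub>R ?q))\<^sup>2 = (1 - t) * (N ?p)\<^sup>2 + t * (N (?q - ?p))\<^sup>2 - t * (1 - t) * (N ?q)\<^sup>2"
    using quadratic_form_stewart[of ?p t ?q "G x"] unfolding N2 .
  also have "\<dots> \<le> (1 - t) * (\<beta>\<^sup>2 * (t\<^sup>2 * \<rho>\<^sup>2)) + t * (\<beta>\<^sup>2 * ((1 - t)\<^sup>2 * \<rho>\<^sup>2)) - t * (1 - t) * ((1 - 2 * \<epsilon>) * \<rho>\<^sup>2)"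
    using t by (intro diff_mono add_mono mult_left_mono p2 qp2 q2) auto
  also have "\<dots> = (t * (1 - t) * \<rho>\<^sup>2) * (\<beta>\<^sup>2 - (1 - 2 * \<epsilon>))"
    by (simp add: power2_eq_square algebra_simps)
  also have "\<dots> \<le> (1/4 * \<rho>\<^sup>2) * (8 * \<epsilon>)"
  proof (intro mult_mono)
    have "0 \<le> (t - 1/2)\<^sup>2" by simp
    thus "t * (1 - t) \<le> 1/4" by (simp add: power2_eq_square algebra_simps)
    show "\<beta>\<^sup>2 - (1 - 2 * \<epsilon>) \<le> 8 * \<epsilon>" using \<beta> by simp
    have "1 \<le> \<beta>" using \<epsilon> by (simp add: \<beta>_def field_simps)
    hence "1 \<le> \<beta>\<^sup>2" by simp
    thus "0 \<le> \<beta>\<^sup>2 - (1 - 2 * \<epsilon>)" using \<epsilon> by simp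
  qed (use t \<rho>0 \<epsilon> in auto)
  also have "\<dots> = 2 * (\<epsilon> * \<rho>\<^sup>2)" by simp
  \<comment> \<open>Rounded up from 2 to 4 so that the bound is the square of an expression without
    sqrt 2.\<close>
  also have "\<dots> \<le> 4 * (\<epsilon> * \<rho>\<^sup>2)" using \<epsilon> by simp
  also have "\<dots> = (2 * sqrt (K * L) * \<rho> * sqrt \<rho>)\<^sup>2"
  proof -
    have "(sqrt (K * L))\<^sup>2 = K * L" "(sqrt \<rho>)\<^sup>2 = \<rho>" using \<rho>0 K_nonneg L_ge1 by auto
    thus ?thesis unfolding \<epsilon>_def power_mult_distrib by (simp only:) simp
  qed
  finally have "N (?p - t *\<^sub>R ?q) \<le> 2 * sqrt (K * L) * \<rho> * sqrt \<rho>"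
    by (rule power2_le_imp_le) (use \<rho>0 K_nonneg L_ge1 in simp)
  hence "L * N (?p - t *\<^sub>R ?q) \<le> L * (2 * sqrt (K * L) * \<rho> * sqrt \<rho>)" using L_ge1 by (intro mult_left_mono) auto
  with norm_le_qnorm[OF x(1), of "?p - t *\<^sub>R ?q"] show ?thesis by (simp add: N_def mult.assoc mult.left_commute)
qed

text \<open>Halving \<open>\<rho>\<close> repeatedly, the deviations of the directions form a geometric series.\<close>

lemma bounded_bending:
  assumes x: "x \<in> ball c (R/2)"
  defines "C \<equiv> 2 * L * sqrt (K * L)"
  shows "\<lbrakk>x0 \<in> ball c R; d (\<psi> x) (\<psi> x0) = \<rho>; 2 * L * \<rho> < R; K * L * \<rho> \<le> 1/2; 0 < s; \<rho> \<le> s * 2 ^ n; s \<le> \<rho>\<rbrakk>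
    \<Longrightarrow> \<exists>z\<in>ball c R. d (\<psi> x) (\<psi> z) = s \<and> d (\<psi> z) (\<psi> x0) = \<rho> - s \<and>
      norm (z - x - (s / \<rho>) *\<^sub>R (x0 - x)) \<le> 8 * C * s * sqrt \<rho>"
\<comment> \<open>\<open>n\<close> only bounds the number of halvings until
  \<open>\<rho> \<le> 2 * s\<close>, where one application of \<open>between\<close> is enough. For
  n = 0 the hypotheses force \<open>s = \<rho>\<close>.\<close>
proof (induction n arbitrary: \<rho> x0)
  have xR: "x \<in> ball c R" using x R_pos by auto
  have C0: "0 \<le> C" using L_ge1 K_nonneg by (simp add: C_def)
  have between: "\<exists>z\<in>ball c R. d (\<psi> x) (\<psi> z) = s' \<and> d (\<psi> z) (\<psi> x0) = \<rho> - s' \<and>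
      norm (z - x - (s' / \<rho>) *\<^sub>R (x0 - x)) \<le> C * \<rho> * sqrt \<rho>"
    if a: "x0 \<in> ball c R" "d (\<psi> x) (\<psi> x0) = \<rho>" "2 * L * \<rho> < R" "K * L * \<rho> \<le> 1/2" "0 < s'" "s' \<le> \<rho>" for \<rho> x0 s'
  proof -
    obtain Z where Z: "Z \<in> M" "d (\<psi> x) Z = s'" "d Z (\<psi> x0) = \<rho> - s'"
      using d_between[of "\<psi> x" "\<psi> x0" s'] chart_in xR a by auto
    have "L * d (\<psi> x) Z \<le> L * \<rho>" using Z a L_ge1 by auto
    also have "\<dots> < R - dist c x" using a x by (simp add: mem_ball)
    finally obtain z where z: "z \<in> ball c R" "Z = \<psi> z" using stays_in_chart[OF xR Z(1)] by auto
    have "norm (z - x - (s' / \<rho>) *\<^sub>R (x0 - x)) \<le> C * \<rho> * sqrt \<rho>"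
      unfolding C_def
      by (rule intermediate_point_deviation) (use xR a z Z in \<open>auto simp: left_diff_distrib\<close>)
    thus ?thesis using z Z by blast
  qed
  {
    case 0
    hence s: "s = \<rho>" by simp
    have "norm (x0 - x - (s / \<rho>) *\<^sub>R (x0 - x)) = 0" using 0 s by simp
    moreover have "0 \<le> 8 * C * s * sqrt \<rho>" using 0 C0 by simp
    moreover have "d (\<psi> x0) (\<psi> x0) = 0" using d_refl chart_in 0 by simp
    ultimately show ?case using 0 s by (intro bexI[of _ x0]) auto
  next
    case (Suc n)
    have \<rho>: "0 < \<rho>" using Suc.prems by linarith
    show ?case
    proof (cases "\<rho> \<le> 2 * s")
      case True
      obtain z where z: "z \<in> ball c R" "d (\<psi> x) (\<psi> z) = s" "d (\<psi> z) (\<psi> x0) = \<rho> - s"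
        "norm (z - x - (s / \<rho>) *\<^sub>R (x0 - x)) \<le> C * \<rho> * sqrt \<rho>"
        using between[OF Suc.prems(1-4), of s] Suc.prems by auto
      have "C * \<rho> * sqrt \<rho> \<le> C * (8 * s) * sqrt \<rho>"
        using C0 True Suc.prems by (intro mult_right_mono mult_left_mono) auto
      thus ?thesis using z by (intro bexI[of _ z]) auto
    next
      case False
      obtain m where m: "m \<in> ball c R" "d (\<psi> x) (\<psi> m) = \<rho>/2" "d (\<psi> m) (\<psi> x0) = \<rho> - \<rho>/2"
        "norm (m - x - ((\<rho>/2) / \<rho>) *\<^sub>R (x0 - x)) \<le> C * \<rho> * sqrt \<rho>"
        using between[OF Suc.prems(1-4), of "\<rho>/2"] \<rho> by auto
      have a1: "2 * L * (\<rho>/2) < R" 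
      proof -
        have "0 \<le> L * \<rho>" using \<rho> L_ge1 by simp
        thus ?thesis using Suc.prems(3) by simp
      qed
      have a2: "K * L * (\<rho>/2) \<le> 1/2"
      proof -
        have "K * L * (\<rho>/2) \<le> K * L * \<rho>" using \<rho> K_nonneg L_ge1 by (intro mult_left_mono) auto
        thus ?thesis using Suc.prems(4) by linarith
      qed
      obtain z where z: "z \<in> ball c R" "d (\<psi> x) (\<psi> z) = s" "d (\<psi> z) (\<psi> m) = \<rho>/2 - s"
        "norm (z - x - (s / (\<rho>/2)) *\<^sub>R (m - x)) \<le> 8 * C * s * sqrt (\<rho>/2)"
        using Suc.IH[OF m(1,2) a1 a2 Suc.prems(5)] Suc.prems False by auto
      have tri: "d (\<psi> z) (\<psi> x0) \<le> \<rho> - s"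
        using d_triangle[of "\<psi> z" "\<psi> m" "\<psi> x0"] chart_in z m Suc.prems by auto
      have tri2: "\<rho> \<le> s + d (\<psi> z) (\<psi> x0)"
        using d_triangle[of "\<psi> x" "\<psi> z" "\<psi> x0"] chart_in z xR Suc.prems by auto
      \<comment> \<open>The deviation from the ray towards \<open>x0\<close> is the deviation from
        the ray towards the midpoint \<open>m\<close>, plus the deviation of \<open>m\<close> itself
        scaled by \<open>2 * s / \<rho>\<close>.\<close>
      have eq: "z - x - (s / \<rho>) *\<^sub>R (x0 - x) = (z - x - (s / (\<rho>/2)) *\<^sub>R (m - x)) +
         (2 * s / \<rho>) *\<^sub>R (m - x - ((\<rho>/2) / \<rho>) *\<^sub>R (x0 - x))"
        using \<rho> by (simp add: scaleR_diff_right mult.commute)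
      have "norm (z - x - (s / \<rho>) *\<^sub>R (x0 - x)) \<le> 8 * C * s * sqrt (\<rho>/2) + (2 * s / \<rho>) * (C * \<rho> * sqrt \<rho>)"
        unfolding eq
        by (rule norm_triangle_mono[OF z(4)])
          (use mult_left_mono[OF m(4), of "2 * s / \<rho>"] \<rho> Suc.prems(5) in simp)
      also have "\<dots> = C * s * sqrt \<rho> * (8 / sqrt 2 + 2)" using \<rho>
        by (simp add: real_sqrt_divide algebra_simps)
      \<comment> \<open>A constant k survives the induction as soon as k / sqrt 2 + 2 \<le> k. The
        least one is the sum 2 / (1 - 1 / sqrt 2) of the geometric series, about 6.83; 8 leaves
        room.\<close>
      also have "\<dots> \<le> C * s * sqrt \<rho> * 8"
      proof (intro mult_left_mono)
        have "4/3 \<le> sqrt 2" by (rule real_le_rsqrt) (simp add: power2_eq_square)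
        hence "8 / sqrt 2 \<le> 8 / (4/3)" by (intro divide_left_mono) auto
        thus "8 / sqrt 2 + 2 \<le> 8" by simp
      qed (use C0 Suc.prems \<rho> in auto)
      finally show ?thesis using z tri tri2 by (intro bexI[of _ z]) auto
    qed
  }
qed

text \<open>The three bounds keep the rays inside the chart, make the relative error at most 1/2 in
  \<open>intermediate_point_deviation\<close>, and limit the loss of slope by bending to 1/4. The
  summands 1 in the denominators allow \<open>K = 0\<close>.\<close>

definition scale :: real where
  "scale = Min {R / (4 * L), 1 / (2 * K * L + 1), (1 / (64 * L * L * sqrt (K * L) + 1))\<^sup>2}"

lemma scale_pos: "0 < scale"
proof -
  have "0 < 64 * L * L * sqrt (K * L) + 1" "0 < 2 * K * L + 1"
    using L_ge1 K_nonneg by (auto intro!: add_nonneg_pos)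
  thus ?thesis using R_pos L_ge1 by (simp add: scale_def)
qed

lemma scale_bounds:
  assumes "0 \<le> s" "s \<le> scale"
  shows "2 * L * s < R" "K * L * s \<le> 1/2" "64 * L * L * sqrt (K * L) * sqrt s \<le> 1"
proof -
  have "s \<le> R / (4 * L)" using assms by (simp add: scale_def)
  hence "2 * L * s \<le> R / 2" using L_ge1 by (simp add: field_simps)
  thus "2 * L * s < R" using R_pos by simp
  have KL: "0 \<le> K * L" using K_nonneg L_ge1 by simp
  have "s \<le> 1 / (2 * K * L + 1)" using assms by (simp add: scale_def)
  hence "s * (2 * K * L + 1) \<le> 1" using KL by (simp add: field_simps)
  thus "K * L * s \<le> 1/2" using assms by (simp add: field_simps)
  let ?a = "64 * L * L * sqrt (K * L)"
  have a: "0 \<le> ?a" using KL L_ge1 by simp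
  have "s \<le> (1 / (?a + 1))\<^sup>2" using assms by (simp add: scale_def)
  hence "sqrt s \<le> 1 / (?a + 1)" using a by (intro real_le_lsqrt) (auto simp: assms)
  hence "sqrt s * (?a + 1) \<le> 1" using a by (simp add: field_simps)
  moreover have "0 \<le> sqrt s" using assms by simp
  ultimately show "?a * sqrt s \<le> 1" by (simp only: distrib_left mult.commute[of _ "sqrt s"])
qed

text \<open>One point \<open>X0\<close> at distance \<open>s0\<close> on the way from
  \<open>\<psi> x\<close> to \<open>y\<close> is fixed and gives a direction that serves every s.
  For each s, \<open>bounded_bending\<close> provides a \<open>z\<close> where the distance to
  \<open>y\<close> has dropped by s, and the point of the ray is within s/4 of it with respect to
  \<open>d\<close>. The slope 3/4 instead of 1/2 leaves room for moving \<open>w\<close> to a finite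
  net.\<close>

lemma descent_direction:
  assumes x: "x \<in> ball c (R/2)" and y: "y \<in> M" and s0: "0 < s0" "s0 \<le> d y (\<psi> x)" "s0 \<le> scale"
  shows "\<exists>w. norm w \<le> L \<and> (\<forall>s. 0 \<le> s \<and> s \<le> s0 \<longrightarrow> d y (\<psi> (x + s *\<^sub>R w)) \<le> d y (\<psi> x) - 3/4 * s)"
proof -
  have xR: "x \<in> ball c R" using x R_pos by auto
  have xM: "\<psi> x \<in> M" using chart_in xR by blast
  have b: "2 * L * s0 < R" "K * L * s0 \<le> 1/2" "64 * L * L * sqrt (K * L) * sqrt s0 \<le> 1"
    using scale_bounds[of s0] s0 by auto
  obtain X0 where X0: "X0 \<in> M" "d (\<psi> x) X0 = s0" "d X0 y = d (\<psi> x) y - s0"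
    using d_between[OF xM y, of s0] s0 d_commute[OF xM y] by auto
  have "L * d (\<psi> x) X0 < R - dist c x" using b X0 x by (simp add: mem_ball)
  then obtain x0 where x0: "x0 \<in> ball c R" "X0 = \<psi> x0" using stays_in_chart[OF xR X0(1)] by auto
  define w where "w = (1 / s0) *\<^sub>R (x0 - x)"
  have nw: "norm w \<le> L" using norm_le[OF x0(1) xR] d_commute[OF xM X0(1)] X0 x0 s0
    by (simp add: w_def divide_le_eq)
  have "d y (\<psi> (x + s *\<^sub>R w)) \<le> d y (\<psi> x) - 3/4 * s" if s: "0 \<le> s" "s \<le> s0" for s
  proof (cases "s = 0")
    case False
    hence sp: "0 < s" using s by simp
    obtain n :: nat where "s0 / s \<le> 2 ^ n" using real_arch_pow[of 2 "s0 / s"] by (auto intro: less_imp_le)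
    hence n: "s0 \<le> s * 2 ^ n" using sp by (simp add: field_simps)
    obtain z where z: "z \<in> ball c R" "d (\<psi> x) (\<psi> z) = s" "d (\<psi> z) (\<psi> x0) = s0 - s"
      "norm (z - x - (s / s0) *\<^sub>R (x0 - x)) \<le> 8 * (2 * L * sqrt (K * L)) * s * sqrt s0"
      using bounded_bending[OF x x0(1) _ b(1,2) sp n s(2)] X0 x0 by auto
    have zw: "norm (z - (x + s *\<^sub>R w)) \<le> 16 * L * sqrt (K * L) * sqrt s0 * s"
      using z(4) s0 by (simp add: w_def algebra_simps)
    have inB: "x + s *\<^sub>R w \<in> ball c R"
    proof -
      have "norm (s *\<^sub>R w) \<le> s0 * L" using s nw L_ge1 by (auto intro!: mult_mono)
      moreover have "dist c (x + s *\<^sub>R w) \<le> dist c x + norm (s *\<^sub>R w)"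
        by (metis diff_diff_add dist_norm norm_triangle_ineq4)
      moreover have "s0 * L < R / 2" using b(1) by (simp add: mult_ac)
      ultimately show ?thesis using x by simp
    qed
    have M: "\<psi> z \<in> M" "\<psi> (x + s *\<^sub>R w) \<in> M" using chart_in z inB by auto
    have "d y (\<psi> (x + s *\<^sub>R w)) \<le> d y X0 + d X0 (\<psi> z) + d (\<psi> z) (\<psi> (x + s *\<^sub>R w))"
      using d_triangle[OF y M(1,2)] d_triangle[OF y X0(1) M(1)] by linarith
    also have "d (\<psi> z) (\<psi> (x + s *\<^sub>R w)) \<le> L * (16 * L * sqrt (K * L) * sqrt s0 * s)"
      by (rule order_trans[OF dist_le[OF z(1) inB] mult_left_mono[OF zw]]) (use L_ge1 in simp)
    also have "\<dots> = (64 * L * L * sqrt (K * L) * sqrt s0) * (s / 4)" by simp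
    also have "\<dots> \<le> 1 * (s/4)" using b s by (intro mult_right_mono) auto
    also have "d y X0 + d X0 (\<psi> z) = d y (\<psi> x) - s"
      using X0 x0 z d_commute[OF y X0(1)] d_commute[OF X0(1) M(1)] d_commute[OF xM y] by simp
    finally show ?thesis by simp
  qed simp
  thus ?thesis using nw by blast
qed

lemma dist_from_continuous_on:
  assumes "y \<in> M" shows "continuous_on (ball c R) (\<lambda>x. d y (\<psi> x))"
proof -
  have "dist (d y (\<psi> a)) (d y (\<psi> b)) \<le> L * dist a b" if "a \<in> ball c R" "b \<in> ball c R" for a b
    using d_triangle[of y "\<psi> a" "\<psi> b"] d_triangle[of y "\<psi> b" "\<psi> a"] d_commute[of "\<psi> a" "\<psi> b"]
      dist_le[OF that] chart_in that assms by (simp add: dist_real_def dist_norm)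
  hence "L-lipschitz_on (ball c R) (\<lambda>x. d y (\<psi> x))" using L_ge1 by (auto intro!: lipschitz_onI)
  thus ?thesis by (rule lipschitz_on_continuous_on)
qed

end

section \<open>Disjoint translates and the volume of annuli in coordinates\<close>

lemma borel_restricted_preimage:
  fixes f :: "'a::topological_space \<Rightarrow> 'b::topological_space"
  assumes "S \<in> sets borel" "continuous_on S f" "T \<in> sets borel"
  shows "{x\<in>S. f x \<in> T} \<in> sets borel"
proof -
  have "f -` T \<inter> space (restrict_space borel S) \<in> sets (restrict_space borel S)"
    using borel_measurable_continuous_on_restrict[OF assms(2)] assms(3) by (rule measurable_sets)
  moreover have "f -` T \<inter> space (restrict_space borel S) = {x\<in>S. f x \<in> T}" by (auto simp: space_restrict_space)
  ultimately show ?thesis using assms(1) by (simp add: sets_restrict_space_iff)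
qed

text \<open>A common point of the translates by \<open>i h\<close> and \<open>j h\<close> with i < j
  would give a point of \<open>E\<close> whose shift by \<open>(j - i) h\<close> is again in
  \<open>E\<close>, against \<open>disj\<close>. So \<open>B\<close> contains N + 1 disjoint copies
  of \<open>E\<close>, all of the same measure.\<close>

lemma emeasure_le_of_disjoint_translates:
  fixes E B :: "'a::euclidean_space set" and h :: 'a
  assumes E: "E \<in> sets borel" and B: "B \<in> sets borel"
    and sub: "\<And>x j. x \<in> E \<Longrightarrow> j \<le> N \<Longrightarrow> x + real j *\<^sub>R h \<in> B"
    and disj: "\<And>x j. x \<in> E \<Longrightarrow> 0 < j \<Longrightarrow> j \<le> N \<Longrightarrow> x + real j *\<^sub>R h \<notin> E"
  shows "of_nat (Suc N) * emeasure lborel E \<le> emeasure lborel B"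
proof -
  define F where "F j = (\<lambda>x. - (real j *\<^sub>R h) + x) -` E" for j
  have FE: "emeasure lborel (F j) = emeasure lborel E" for j
  proof -
    have "emeasure lborel E = emeasure (distr lborel borel ((+) (- (real j *\<^sub>R h)))) E"
      by (simp only: lborel_distr_plus)
    also have "\<dots> = emeasure lborel (F j)" using E by (subst emeasure_distr) (auto simp: F_def simp del: add_uminus_conv_diff uminus_add_conv_diff)
    finally show ?thesis ..
  qed
  have Fs: "F j \<in> sets borel" for j
    unfolding F_def using measurable_sets_borel[of "\<lambda>x. - (real j *\<^sub>R h) + x" borel E] E
    by (simp del: add_uminus_conv_diff uminus_add_conv_diff)
  have "disjoint_family_on F {..N}"
  proof (unfold disjoint_family_on_def, intro ballI impI)
    have *: "F i \<inter> F j = {}" if "i < j" "j \<le> N" for i j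
    proof (rule ccontr)
      assume "F i \<inter> F j \<noteq> {}"
      then obtain x where x: "- (real i *\<^sub>R h) + x \<in> E" "- (real j *\<^sub>R h) + x \<in> E" by (auto simp: F_def)
      have "(- (real j *\<^sub>R h) + x) + real (j - i) *\<^sub>R h = - (real i *\<^sub>R h) + x"
        using that by (simp add: of_nat_diff scaleR_diff_left algebra_simps)
      thus False using disj[OF x(2), of "j - i"] x(1) that by (metis diff_le_self le_trans zero_less_diff)
    qed
    show "F i \<inter> F j = {}" if "i \<in> {..N}" "j \<in> {..N}" "i \<noteq> j" for i j
      using *[of i j] *[of j i] that by (cases "i < j") auto
  qed
  hence "(\<Sum>j\<in>{..N}. emeasure lborel (F j)) = emeasure lborel (\<Union>j\<in>{..N}. F j)"
    using Fs by (intro sum_emeasure) auto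
  also have "\<dots> \<le> emeasure lborel B"
  proof (intro emeasure_mono UN_least subsetI)
    fix j x assume "j \<in> {..N}" "x \<in> F j"
    thus "x \<in> B" using sub[of "- (real j *\<^sub>R h) + x" j] by (simp add: F_def)
  qed (use B in simp)
  finally show ?thesis by (simp add: FE)
qed

context almost_euclidean_chart
begin

text \<open>\<open>descent_direction\<close> chooses \<open>w\<close> for each x without any
  measurability in x. With a finite net of directions the pieces can be cut out by the descent
  inequalities themselves, which are Borel conditions. The radius \<open>r\<close> and the ray
  length \<open>s0\<close> stay free: near the centre both are taken proportional to
  \<open>a\<close>, far from it both are constant.\<close>

lemma annulus_in_ball_volume:
  shows "\<exists>C\<ge>0. \<forall>y q r s0 a b. y \<in> M \<longrightarrow> ball q r \<subseteq> ball c (R/2) \<longrightarrow> 0 < r \<longrightarrow> 0 < s0 \<longrightarrow> s0 \<le> scale \<longrightarrow>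
    s0 \<le> a \<longrightarrow> a < b \<longrightarrow>
    emeasure lborel {x\<in>ball q r. d y (\<psi> x) \<in> {a..b}} \<le>
      ennreal (C * (r + L * s0) ^ CARD('n) * (b - a) / s0)"
proof -
  \<comment> \<open>Since \<open>d\<close> is at most L times the Euclidean distance, replacing
    \<open>w\<close> by a net point within 1/(4L) changes the distance at parameter s by at most
    s/4, which turns the slope 3/4 into 1/2.\<close>
  have "cball (0::real^'n) L \<subseteq> (\<Union>w\<in>cball 0 L. ball w (1 / (4 * L)))" using L_ge1 by force
  from compactE_image[OF compact_cball _ this] obtain W
    where W: "W \<subseteq> cball (0::real^'n) L" "finite W" "cball 0 L \<subseteq> (\<Union>w\<in>W. ball w (1 / (4 * L)))"
    by (metis open_ball)
  define v where "v = unit_ball_vol (real CARD('n))"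
  have v0: "0 \<le> v" by (simp add: v_def)
  have main: "emeasure lborel {x\<in>ball q r. d y (\<psi> x) \<in> {a..b}} \<le>
      ennreal (real (card W) * (4 * v) * (r + L * s0) ^ CARD('n) * (b - a) / s0)"
    if y: "y \<in> M" and q: "ball q r \<subseteq> ball c (R/2)" and r: "0 < r" and s0: "0 < s0" "s0 \<le> scale" "s0 \<le> a" and ab: "a < b"
    for y q r s0 a b
  proof -
    define u where "u x = d y (\<psi> x)" for x
    define \<tau> where "\<tau> = 4 * (b - a)"
    define N where "N = nat \<lfloor>s0 / \<tau>\<rfloor>"
    have \<tau>: "0 < \<tau>" using ab by (simp add: \<tau>_def)
    have N1: "real N * \<tau> \<le> s0"
    proof -
      have "real N \<le> s0 / \<tau>" using \<tau> s0 by (simp add: N_def)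
      thus ?thesis using \<tau> by (simp add: field_simps)
    qed
    \<comment> \<open>The untranslated copy counts as well, so there are N + 1 copies and no
      separate case is needed when \<tau> exceeds \<open>s0\<close> and \<open>N\<close> is
      0.\<close>
    have N2: "s0 / \<tau> \<le> real (Suc N)" using \<tau> s0 by (simp add: N_def) linarith
    have jt: "real j * \<tau> \<le> s0" if "j \<le> N" for j
      using N1 \<tau> that by (smt (verit) mult_right_mono of_nat_le_iff)
    have sL: "s0 * L < R / 2" using scale_bounds(1)[of s0] s0 by (simp add: mult_ac)
    define E where "E = {x\<in>ball q r. u x \<in> {a..b}}"
    \<comment> \<open>Only the multiples of \<tau> are tested, so \<open>T w\<close> is a finite
      intersection. Each condition is written as membership of a real function in
      \<open>{..0}\<close> to fit \<open>borel_restricted_preimage\<close>.\<close>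
    define T where "T w = E \<inter> {x\<in>ball q r. \<forall>j\<in>{..N}. u (x + real j *\<^sub>R (\<tau> *\<^sub>R w)) - u x + real j * \<tau> / 2 \<in> {..0}}" for w
    have shift: "x + s *\<^sub>R w \<in> ball q (r + L * s0)" "x + s *\<^sub>R w \<in> ball c R"
      if "x \<in> ball q r" "norm w \<le> L" "0 \<le> s" "s \<le> s0" for x w s
    proof -
      have n: "norm (s *\<^sub>R w) \<le> s0 * L" using that L_ge1 by (auto intro!: mult_mono)
      have "dist p (x + s *\<^sub>R w) \<le> dist p x + norm (s *\<^sub>R w)" for p
        by (metis diff_diff_add dist_norm norm_triangle_ineq4)
      from this[of q] this[of c] n sL that(1) q show "x + s *\<^sub>R w \<in> ball q (r + L * s0)" "x + s *\<^sub>R w \<in> ball c R"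
        by (auto simp: mult.commute)
    qed
    have cont: "continuous_on (ball c R) u" unfolding u_def by (rule dist_from_continuous_on[OF y])
    have cont_q: "continuous_on (ball q r) u" by (rule continuous_on_subset[OF cont]) (use q R_pos in auto)
    have E_sets: "E \<in> sets borel" unfolding E_def by (rule borel_restricted_preimage[OF _ cont_q]) auto
    have T_sets: "T w \<in> sets borel" if "norm w \<le> L" for w
    proof -
      let ?F = "\<lambda>j. {x\<in>ball q r. u (x + real j *\<^sub>R (\<tau> *\<^sub>R w)) - u x + real j * \<tau> / 2 \<in> {..0}}"
      have "?F j \<in> sets borel" if "j \<in> {..N}" for j
      proof (rule borel_restricted_preimage)
        have "continuous_on (ball q r) (\<lambda>x. u (x + real j *\<^sub>R (\<tau> *\<^sub>R w)))"
          by (rule continuous_on_compose2[OF cont]) (use shift(2)[of _ w "real j * \<tau>"] \<open>norm w \<le> L\<close> that jt \<tau> in \<open>auto intro!: continuous_intros\<close>)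
        thus "continuous_on (ball q r) (\<lambda>x. u (x + real j *\<^sub>R (\<tau> *\<^sub>R w)) - u x + real j * \<tau> / 2)"
          by (intro continuous_intros cont_q)
      qed auto
      hence "(\<Inter>j\<in>{..N}. ?F j) \<in> sets borel"
        by (intro sets.finite_INT) auto
      moreover have "T w = E \<inter> (\<Inter>j\<in>{..N}. ?F j)"
        by (auto simp: T_def)
      ultimately show ?thesis using E_sets by auto
    qed
    have cover: "E \<subseteq> (\<Union>w\<in>W. T w)"
    proof
      fix x assume x: "x \<in> E"
      hence xq: "x \<in> ball q r" by (simp add: E_def)
      have "s0 \<le> d y (\<psi> x)" using x s0 by (simp add: E_def u_def)
      then obtain w where w: "norm w \<le> L" "\<And>s. 0 \<le> s \<Longrightarrow> s \<le> s0 \<Longrightarrow> u (x + s *\<^sub>R w) \<le> u x - 3/4 * s"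
        using descent_direction[of x y s0] xq q y s0 unfolding u_def by blast
      then obtain w' where w': "w' \<in> W" "norm (w - w') < 1 / (4 * L)" using W(3) by (auto simp: dist_norm norm_minus_commute subset_iff)
      have nw': "norm w' \<le> L" using w' W by auto
      have "u (x + s *\<^sub>R w') - u x + s / 2 \<le> 0" if s: "0 \<le> s" "s \<le> s0" for s
      proof -
        have in1: "x + s *\<^sub>R w \<in> ball c R" "x + s *\<^sub>R w' \<in> ball c R" using shift xq w(1) nw' s by auto
        have "u (x + s *\<^sub>R w') \<le> u (x + s *\<^sub>R w) + d (\<psi> (x + s *\<^sub>R w)) (\<psi> (x + s *\<^sub>R w'))"
          unfolding u_def by (intro d_triangle y chart_in in1)
        also have "d (\<psi> (x + s *\<^sub>R w)) (\<psi> (x + s *\<^sub>R w')) \<le> L * norm (s *\<^sub>R (w - w'))"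
          using dist_le[OF in1] by (simp add: algebra_simps)
        also have "\<dots> = s * (L * norm (w - w'))" using s by simp
        also have "\<dots> \<le> s * (1/4)"
          using w'(2) L_ge1 s by (intro mult_left_mono) (simp_all add: pos_less_divide_eq mult.commute[of _ L] mult_ac)
        also have "u (x + s *\<^sub>R w) \<le> u x - 3/4 * s" by (rule w(2)[OF s])
        finally show ?thesis by simp
      qed
      from this[of "real j * \<tau>" for j] have "x \<in> T w'" using x xq jt \<tau> by (auto simp: T_def)
      thus "x \<in> (\<Union>w\<in>W. T w)" using w' by blast
    qed
    have est: "emeasure lborel (T w) \<le> ennreal (4 * v * (r + L * s0) ^ CARD('n) * (b - a) / s0)" if "w \<in> W" for w
    proof -
      have nw: "norm w \<le> L" using that W by auto
      define V where "V = v * (r + L * s0) ^ CARD('n)"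
      have V0: "0 \<le> V" using v0 r L_ge1 s0 by (auto simp: V_def intro!: mult_nonneg_nonneg)
      txt \<open>Along \<open>j\<tau>w\<close> the function \<open>u\<close> drops by more than its oscillation \<open>b - a\<close> on \<open>E\<close>.\<close>
      have "of_nat (Suc N) * emeasure lborel (T w) \<le> emeasure lborel (ball q (r + L * s0))"
      proof (rule emeasure_le_of_disjoint_translates[where h = "\<tau> *\<^sub>R w"])
        fix x j assume xj: "x \<in> T w" "j \<le> N"
        show "x + real j *\<^sub>R \<tau> *\<^sub>R w \<in> ball q (r + L * s0)"
          using shift(1)[of x w "real j * \<tau>"] xj jt \<tau> nw by (auto simp: T_def E_def)
        assume "0 < j"
        hence "\<tau> \<le> real j * \<tau>" using \<tau> by simp
        moreover have "b - a < \<tau> / 2" using ab by (simp add: \<tau>_def)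
        ultimately have "b - a < real j * \<tau> / 2" by linarith
        moreover have "u (x + real j *\<^sub>R \<tau> *\<^sub>R w) - u x + real j * \<tau> / 2 \<in> {..0}" using xj unfolding T_def by blast
        moreover have "u x \<le> b" using xj by (auto simp: T_def E_def)
        ultimately show "x + real j *\<^sub>R \<tau> *\<^sub>R w \<notin> T w" by (auto simp: T_def E_def)
      qed (use T_sets[OF nw] in auto)
      also have "\<dots> = ennreal V" using r L_ge1 s0 by (simp add: emeasure_ball V_def v_def)
      finally have *: "of_nat (Suc N) * emeasure lborel (T w) \<le> ennreal V" .
      have "emeasure lborel (T w) \<le> emeasure lborel (ball q r)" by (intro emeasure_mono) (auto simp: T_def)
      also have "\<dots> < \<infinity>" by (rule emeasure_lborel_ball_finite)
      finally obtain m where m: "0 \<le> m" "emeasure lborel (T w) = ennreal m"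
        by (cases "emeasure lborel (T w)") auto
      have "ennreal (real (Suc N) * m) \<le> ennreal V" using * m by (simp add: ennreal_mult' ennreal_of_nat_eq_real_of_nat del: of_nat_Suc)
      hence "real (Suc N) * m \<le> V" using V0 by simp
      moreover have "s0 / \<tau> * m \<le> real (Suc N) * m" using N2 m by (intro mult_right_mono) auto
      ultimately have "s0 / \<tau> * m \<le> V" by linarith
      hence "m \<le> V * \<tau> / s0" using \<tau> s0 by (simp add: field_simps)
      also have "\<dots> = 4 * v * (r + L * s0) ^ CARD('n) * (b - a) / s0"
        by (simp only: V_def \<tau>_def mult_ac)
      finally show ?thesis using m by (simp add: ennreal_leI)
    qed
    have "emeasure lborel E \<le> emeasure lborel (\<Union>w\<in>W. T w)"
      using cover T_sets W by (intro emeasure_mono) (auto intro!: sets.finite_UN)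
    also have "\<dots> \<le> (\<Sum>w\<in>W. emeasure lborel (T w))"
      using T_sets W by (intro emeasure_subadditive_finite) auto
    also have "\<dots> \<le> (\<Sum>w\<in>W. ennreal (4 * v * (r + L * s0) ^ CARD('n) * (b - a) / s0))"
      by (intro sum_mono est)
    also have "\<dots> = ennreal (real (card W) * (4 * v * (r + L * s0) ^ CARD('n) * (b - a) / s0))"
      by (simp add: ennreal_mult'[symmetric] ennreal_of_nat_eq_real_of_nat)
    finally show ?thesis by (simp add: E_def u_def mult_ac)
  qed
  show ?thesis using v0 by (intro exI[of _ "real (card W) * (4 * v)"] conjI allI impI main) auto
qed

end

section \<open>Balls and annuli seen through one chart\<close>

locale measured_chart = almost_euclidean_chart M d \<psi> G c R L K
  for M :: "'a set" and d :: "'a \<Rightarrow> 'a \<Rightarrow> real" and \<psi> :: "real^'n::finite \<Rightarrow> 'a" and G c R L K +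
  fixes \<mu> :: "'a measure"
  assumes space_eq: "space \<mu> = M"
    and dist_measurable: "\<And>y. y \<in> M \<Longrightarrow> d y \<in> borel_measurable \<mu>"
    and chart_ball_sets: "\<And>r. r \<le> R \<Longrightarrow> \<psi> ` ball c r \<in> sets \<mu>"
    and emeasure_le: "\<And>E. E \<in> sets \<mu> \<Longrightarrow> E \<subseteq> \<psi> ` ball c R \<Longrightarrow> {x\<in>ball c R. \<psi> x \<in> E} \<in> sets borel \<Longrightarrow>
      emeasure \<mu> E \<le> ennreal L * emeasure lborel {x\<in>ball c R. \<psi> x \<in> E}"
    and emeasure_ge: "\<And>E. E \<in> sets \<mu> \<Longrightarrow> E \<subseteq> \<psi> ` ball c R \<Longrightarrow> {x\<in>ball c R. \<psi> x \<in> E} \<in> sets borel \<Longrightarrow>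
      emeasure lborel {x\<in>ball c R. \<psi> x \<in> E} \<le> ennreal L * emeasure \<mu> E"
begin

lemma dist_preimage_sets:
  assumes "y \<in> M" "T \<in> sets borel" shows "{x\<in>M. d y x \<in> T} \<in> sets \<mu>"
  using measurable_sets[OF dist_measurable[OF assms(1)] assms(2)] by (simp add: space_eq vimage_def Int_def conj_commute)

lemma chart_dist_preimage_borel:
  assumes "y \<in> M" "T \<in> sets borel" shows "{x\<in>ball c R. d y (\<psi> x) \<in> T} \<in> sets borel"
  by (rule borel_restricted_preimage[OF _ dist_from_continuous_on[OF assms(1)] assms(2)]) simp

text \<open>Points at distance less than t from \<open>\<psi> q\<close> cannot leave the chart,
  because L t \<le> R/2 < R - dist c q. Hence volume and Lebesgue measure are comparable on the
  whole set. A general set \<open>T\<close> of distances serves balls and annuli alike.\<close>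

lemma small_dist_set:
  assumes q: "q \<in> ball c (R/4)" and T: "T \<in> sets borel" "T \<subseteq> {..<t}" and t: "L * t \<le> R/2"
  defines "B \<equiv> {x\<in>M. d (\<psi> q) x \<in> T}" and "P \<equiv> {x\<in>ball c R. d (\<psi> q) (\<psi> x) \<in> T}"
  shows "P \<in> sets borel" "P \<subseteq> ball q (L * t)"
    and "emeasure \<mu> B \<le> ennreal L * emeasure lborel P" "emeasure lborel P \<le> ennreal L * emeasure \<mu> B"
proof -
  have qR: "q \<in> ball c R" using q R_pos by auto
  have yM: "\<psi> q \<in> M" by (rule chart_in[OF qR])
  have less: "L * d (\<psi> q) z < L * t" if "d (\<psi> q) z \<in> T" for z using that T(2) L_ge1 by auto
  have "z \<in> \<psi> ` ball c R" if z: "z \<in> B" for z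
  proof (rule stays_in_chart[OF qR])
    show "z \<in> M" using z by (simp add: B_def)
    show "L * d (\<psi> q) z < R - dist c q" using less[of z] z t q R_pos by (simp add: B_def)
  qed
  hence BU: "B \<subseteq> \<psi> ` ball c R" by blast
  have P: "P = {x\<in>ball c R. \<psi> x \<in> B}" using chart_in by (auto simp: B_def P_def)
  show P_sets: "P \<in> sets borel" unfolding P_def by (rule chart_dist_preimage_borel[OF yM T(1)])
  have B_sets: "B \<in> sets \<mu>" unfolding B_def by (rule dist_preimage_sets[OF yM T(1)])
  show "P \<subseteq> ball q (L * t)"
  proof
    fix x assume "x \<in> P"
    thus "x \<in> ball q (L * t)" using norm_le[OF qR, of x] less[of "\<psi> x"] by (simp add: P_def dist_norm)
  qed
  show "emeasure \<mu> B \<le> ennreal L * emeasure lborel P" "emeasure lborel P \<le> ennreal L * emeasure \<mu> B"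
    using emeasure_le[OF B_sets BU] emeasure_ge[OF B_sets BU] P_sets unfolding P by auto
qed

text \<open>In coordinates the ball of radius r lies between the Euclidean balls of radii r / L and
  L r. The two summands of \<open>C\<close> belong to the upper and to the lower bound.\<close>

lemma local_ball_volume:
  "\<exists>\<sigma>>0. \<exists>C>0. \<forall>y\<in>\<psi> ` ball c (R/4). \<forall>r. 0 < r \<and> r \<le> \<sigma> \<longrightarrow>
     ennreal (r ^ CARD('n) / C) \<le> emeasure \<mu> (dball y r) \<and>
     emeasure \<mu> (dball y r) \<le> ennreal (C * r ^ CARD('n))"
proof -
  define v where "v = unit_ball_vol (real CARD('n))"
  have v: "0 < v" by (simp add: v_def)
  define C where "C = L * v * L ^ CARD('n) + L * L ^ CARD('n) / v"
  have C0: "0 < C" using v L_ge1 by (auto simp: C_def intro!: add_pos_pos)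
  have main: "ennreal (r ^ CARD('n) / C) \<le> emeasure \<mu> (dball y r) \<and>
     emeasure \<mu> (dball y r) \<le> ennreal (C * r ^ CARD('n))"
    if y: "y \<in> \<psi> ` ball c (R/4)" and r: "0 < r" "r \<le> R / (2 * L)" for y r
  proof -
    obtain q where q: "q \<in> ball c (R/4)" "y = \<psi> q" using y by blast
    have qR: "q \<in> ball c R" using q R_pos by auto
    have Lr: "L * r \<le> R / 2" using r L_ge1 by (simp add: field_simps)
    let ?P = "{x\<in>ball c R. d (\<psi> q) (\<psi> x) \<in> {..<r}}"
    have B: "dball y r = {x\<in>M. d (\<psi> q) x \<in> {..<r}}" by (simp add: q(2))
    have "{..<r} \<in> sets borel" by simp
    note P = small_dist_set[OF q(1) this order_refl Lr, folded B]
    have low: "ball q (r / L) \<subseteq> ?P"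
    proof
      fix x assume x: "x \<in> ball q (r / L)"
      have "r / L \<le> r" using L_ge1 r by (simp add: field_simps)
      moreover have "r \<le> R / 2" using Lr L_ge1 r by (smt (verit) mult_le_cancel_right1)
      moreover have "dist c x \<le> dist c q + dist q x" by (rule dist_triangle)
      ultimately have xR: "x \<in> ball c R" using x q R_pos by simp
      have "d (\<psi> q) (\<psi> x) \<le> L * norm (q - x)" by (rule dist_le[OF qR xR])
      also have "\<dots> < r" using x L_ge1 by (simp add: dist_norm pos_less_divide_eq mult.commute)
      finally show "x \<in> ?P" using xR by simp
    qed
    have "emeasure \<mu> (dball y r) \<le> ennreal L * emeasure lborel (ball q (L * r))"
      by (rule order_trans[OF P(3)], intro mult_left_mono emeasure_mono) (use P in auto)
    also have "\<dots> = ennreal (L * (v * (L * r) ^ CARD('n)))" using L_ge1 r by (simp add: emeasure_ball v_def ennreal_mult')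
    also have "\<dots> \<le> ennreal (C * r ^ CARD('n))"
      using v L_ge1 r by (intro ennreal_leI) (simp add: C_def power_mult_distrib distrib_right mult_ac)
    finally have 1: "emeasure \<mu> (dball y r) \<le> ennreal (C * r ^ CARD('n))" .
    then obtain m where m: "0 \<le> m" "emeasure \<mu> (dball y r) = ennreal m"
      by (cases "emeasure \<mu> (dball y r)") (auto simp: top_unique)
    have "ennreal (v * (r / L) ^ CARD('n)) = emeasure lborel (ball q (r / L))" using L_ge1 r by (simp add: emeasure_ball v_def)
    also have "\<dots> \<le> emeasure lborel ?P" using low P(1) by (intro emeasure_mono) auto
    also have "\<dots> \<le> ennreal (L * m)" using P(4) m L_ge1 by (simp add: ennreal_mult')
    finally have "v * (r / L) ^ CARD('n) \<le> L * m" using m L_ge1 by (subst (asm) ennreal_le_iff) auto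
    hence "r ^ CARD('n) \<le> m * (L * L ^ CARD('n) / v)" using v L_ge1 by (simp add: power_divide field_simps)
    also have "\<dots> \<le> m * C" using m v L_ge1 by (intro mult_left_mono) (auto simp: C_def)
    finally have "r ^ CARD('n) / C \<le> m" using C0 by (simp add: pos_divide_le_eq)
    with 1 m show ?thesis by (simp add: ennreal_leI)
  qed
  show ?thesis
    by (rule exI[of _ "R / (2 * L)"], intro conjI exI[of _ C] ballI allI impI) (use main R_pos L_ge1 C0 in auto)
qed

text \<open>This is \<open>annulus_in_ball_volume\<close> with \<open>s0 = a\<close>. Because b
  \<le> 2a the annulus fits into a coordinate ball of radius 3La, and the resulting bound is a
  multiple of a^n (b - a) / a.\<close>

lemma local_annulus_volume:
  "\<exists>\<sigma>>0. \<exists>C>0. \<forall>y\<in>\<psi> ` ball c (R/4). \<forall>a b. 0 < a \<and> a < b \<and> b \<le> 2 * a \<and> a \<le> \<sigma> \<longrightarrow>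
     emeasure \<mu> (annulus y a b) \<le> ennreal (C * (b - a))"
proof -
  obtain C0 where C0: "0 \<le> C0" and est: "\<And>y q r s0 a b. y \<in> M \<Longrightarrow> ball q r \<subseteq> ball c (R/2) \<Longrightarrow> 0 < r \<Longrightarrow> 0 < s0 \<Longrightarrow>
      s0 \<le> scale \<Longrightarrow> s0 \<le> a \<Longrightarrow> a < b \<Longrightarrow>
    emeasure lborel {x\<in>ball q r. d y (\<psi> x) \<in> {a..b}} \<le> ennreal (C0 * (r + L * s0) ^ CARD('n) * (b - a) / s0)"
    using annulus_in_ball_volume by blast
  \<comment> \<open>The entry 1 bounds the surplus powers of \<open>a\<close>, \<open>scale\<close>
    admits the ray length \<open>a\<close>, and \<open>R / (16 * L)\<close> puts the ball of radius
    3La inside \<open>ball c (R/2)\<close>.\<close>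
  define \<sigma> where "\<sigma> = Min {1, scale, R / (16 * L)}"
  have \<sigma>0: "0 < \<sigma>" using scale_pos R_pos L_ge1 by (simp add: \<sigma>_def)
  have \<sigma>: "a \<le> 1" "a \<le> scale" "a \<le> R / (16 * L)" if "a \<le> \<sigma>" for a using that by (auto simp: \<sigma>_def)
  define C where "C = L * (C0 * (4 * L) ^ CARD('n)) + 1"
  have "emeasure \<mu> (annulus y a b) \<le> ennreal (C * (b - a))"
    if y: "y \<in> \<psi> ` ball c (R/4)" and a: "0 < a" "a < b" "b \<le> 2 * a" "a \<le> \<sigma>" for y a b
  proof -
    obtain q where q: "q \<in> ball c (R/4)" "y = \<psi> q" using y by blast
    have qR: "q \<in> ball c R" using q R_pos by auto
    have yM: "y \<in> M" using chart_in[OF qR] q by simp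
    have La: "16 * (L * a) \<le> R" using \<sigma>(3)[OF a(4)] L_ge1 by (simp add: field_simps)
    have La0: "0 < L * a" using L_ge1 a by simp
    have sub: "ball q (3 * (L * a)) \<subseteq> ball c (R/2)"
    proof
      fix x assume "x \<in> ball q (3 * (L * a))"
      moreover have "dist c x \<le> dist c q + dist q x" by (rule dist_triangle)
      ultimately show "x \<in> ball c (R/2)" using q La La0 by simp
    qed
    have T: "{a..b} \<in> sets borel" "{a..b} \<subseteq> {..<3 * a}" "L * (3 * a) \<le> R/2" using a La La0 by auto
    note P = small_dist_set[OF q(1) T, folded q(2)]
    have Q_sets: "{x\<in>ball q (3 * (L * a)). d y (\<psi> x) \<in> {a..b}} \<in> sets borel"
      by (rule borel_restricted_preimage)
        (use sub R_pos in \<open>auto intro!: continuous_on_subset[OF dist_from_continuous_on[OF yM]]\<close>)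
    have "{x\<in>ball c R. d y (\<psi> x) \<in> {a..b}} \<subseteq> {x\<in>ball q (3 * (L * a)). d y (\<psi> x) \<in> {a..b}}"
      using P(2) by (auto simp: mult.left_commute)
    hence "emeasure \<mu> (annulus y a b) \<le> ennreal L * emeasure lborel {x\<in>ball q (3 * (L * a)). d y (\<psi> x) \<in> {a..b}}"
      by (intro order_trans[OF P(3)] mult_left_mono emeasure_mono) (use Q_sets in auto)
    also have "\<dots> \<le> ennreal L * ennreal (C0 * (3 * (L * a) + L * a) ^ CARD('n) * (b - a) / a)"
      by (intro mult_left_mono est yM sub) (use \<sigma>[OF a(4)] a La0 in auto)
    also have "\<dots> = ennreal (L * (C0 * (3 * (L * a) + L * a) ^ CARD('n) * (b - a) / a))"
      by (rule ennreal_mult'[symmetric]) (use L_ge1 in simp)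
    also have "\<dots> \<le> ennreal (C * (b - a))"
    proof (rule ennreal_leI)
      \<comment> \<open>Index types are non-empty, so the dimension is positive and one power of
        \<open>a\<close> cancels the denominator.\<close>
      obtain k where k: "CARD('n) = Suc k" using zero_less_card_finite[where 'a='n] by (cases "CARD('n)") auto
      have "(3 * (L * a) + L * a) ^ CARD('n) / a = (4 * L) ^ CARD('n) * a ^ k"
      proof -
        have e: "3 * (L * a) + L * a = (4 * L) * a" by simp
        show ?thesis using a unfolding e power_mult_distrib[of "4 * L" a] k by simp
      qed
      also have "\<dots> \<le> (4 * L) ^ CARD('n) * 1" using a \<sigma>(1)[OF a(4)] L_ge1 by (intro mult_left_mono power_le_one) auto
      finally have *: "(3 * (L * a) + L * a) ^ CARD('n) / a \<le> (4 * L) ^ CARD('n)" by simp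
      have "L * (C0 * (3 * (L * a) + L * a) ^ CARD('n) * (b - a) / a) = L * C0 * (b - a) * ((3 * (L * a) + L * a) ^ CARD('n) / a)" by simp
      also have "\<dots> \<le> L * C0 * (b - a) * (4 * L) ^ CARD('n)" using * L_ge1 C0 a by (intro mult_left_mono) auto
      also have "\<dots> \<le> C * (b - a)" using a by (simp add: C_def distrib_right mult_ac)
      finally show "L * (C0 * (3 * (L * a) + L * a) ^ CARD('n) * (b - a) / a) \<le> C * (b - a)" .
    qed
    finally show ?thesis .
  qed
  moreover have "0 < C" using C0 L_ge1 by (auto simp: C_def intro!: add_nonneg_pos)
  ultimately show ?thesis using \<sigma>0 by blast
qed

text \<open>Here the centre \<open>y\<close> is an arbitrary point of the space and only the points
  of the annulus lie in the chart. The ray length is a constant, so its inverse is absorbed by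
  \<open>C\<close>.\<close>

lemma far_annulus_volume:
  assumes "0 < s0"
  shows "\<exists>C>0. \<forall>y\<in>M. \<forall>a b. s0 \<le> a \<and> a < b \<longrightarrow>
     emeasure \<mu> (annulus y a b \<inter> \<psi> ` ball c (R/4)) \<le> ennreal (C * (b - a))"
proof -
  obtain C0 where C0: "0 \<le> C0" and est: "\<And>y q r s0 a b. y \<in> M \<Longrightarrow> ball q r \<subseteq> ball c (R/2) \<Longrightarrow> 0 < r \<Longrightarrow> 0 < s0 \<Longrightarrow>
      s0 \<le> scale \<Longrightarrow> s0 \<le> a \<Longrightarrow> a < b \<Longrightarrow>
    emeasure lborel {x\<in>ball q r. d y (\<psi> x) \<in> {a..b}} \<le> ennreal (C0 * (r + L * s0) ^ CARD('n) * (b - a) / s0)"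
    using annulus_in_ball_volume by blast
  define s where "s = min s0 scale"
  have s: "0 < s" "s \<le> s0" "s \<le> scale" using assms scale_pos by (auto simp: s_def)
  define C where "C = L * (C0 * (R/4 + L * s) ^ CARD('n) / s) + 1"
  have "emeasure \<mu> (annulus y a b \<inter> \<psi> ` ball c (R/4)) \<le> ennreal (C * (b - a))"
    if yM: "y \<in> M" and a: "s0 \<le> a" "a < b" for y a b
  proof -
    define B where "B = annulus y a b \<inter> \<psi> ` ball c (R/4)"
    have B_sets: "B \<in> sets \<mu>" unfolding B_def
      by (intro sets.Int dist_preimage_sets[OF yM] chart_ball_sets) (use R_pos in auto)
    have BU: "B \<subseteq> \<psi> ` ball c R" using R_pos by (auto simp: B_def)
    have inj: "x = x'" if "x \<in> ball c R" "x' \<in> ball c R" "\<psi> x = \<psi> x'" for x x'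
      using norm_le[OF that(1,2)] d_refl[OF chart_in[OF that(1)]] that by simp
    have pre: "{x\<in>ball c R. \<psi> x \<in> B} = {x\<in>ball c (R/4). d y (\<psi> x) \<in> {a..b}}"
    proof (intro equalityI subsetI)
      fix x assume "x \<in> {x\<in>ball c R. \<psi> x \<in> B}"
      then obtain x' where x: "x \<in> ball c R" "d y (\<psi> x) \<in> {a..b}" "x' \<in> ball c (R/4)" "\<psi> x = \<psi> x'" by (auto simp: B_def)
      have "x = x'" by (rule inj) (use x R_pos in auto)
      thus "x \<in> {x\<in>ball c (R/4). d y (\<psi> x) \<in> {a..b}}" using x by simp
    next
      fix x assume x: "x \<in> {x\<in>ball c (R/4). d y (\<psi> x) \<in> {a..b}}"
      hence xR: "x \<in> ball c R" using R_pos by auto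
      show "x \<in> {x\<in>ball c R. \<psi> x \<in> B}" using x xR chart_in[OF xR] by (auto simp: B_def)
    qed
    have P_sets: "{x\<in>ball c R. \<psi> x \<in> B} \<in> sets borel" unfolding pre
      by (rule borel_restricted_preimage)
        (use R_pos in \<open>auto intro!: continuous_on_subset[OF dist_from_continuous_on[OF yM]]\<close>)
    have "emeasure \<mu> B \<le> ennreal L * emeasure lborel {x\<in>ball c R. \<psi> x \<in> B}" by (rule emeasure_le[OF B_sets BU P_sets])
    also have "\<dots> \<le> ennreal L * ennreal (C0 * (R/4 + L * s) ^ CARD('n) * (b - a) / s)"
      unfolding pre by (intro mult_left_mono est yM) (use s a R_pos in auto)
    also have "\<dots> = ennreal (L * (C0 * (R/4 + L * s) ^ CARD('n) * (b - a) / s))"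
      by (rule ennreal_mult'[symmetric]) (use L_ge1 in simp)
    also have "L * (C0 * (R/4 + L * s) ^ CARD('n) * (b - a) / s) = L * (C0 * (R/4 + L * s) ^ CARD('n) / s) * (b - a)"
      by simp
    also have "ennreal \<dots> \<le> ennreal (C * (b - a))" using a by (intro ennreal_leI mult_right_mono) (auto simp: C_def)
    finally show ?thesis by (simp add: B_def)
  qed
  moreover have "0 < C" using C0 L_ge1 s R_pos by (auto simp: C_def intro!: add_nonneg_pos mult_nonneg_nonneg divide_nonneg_nonneg)
  ultimately show ?thesis by blast
qed

end

section \<open>Speed and length of curves\<close>

lemma qnorm_scaleR: "qnorm H (m *\<^sub>R v) = \<bar>m\<bar> * qnorm H v"
proof -
  have "(m *\<^sub>R v) \<bullet> (H *v (m *\<^sub>R v)) = m\<^sup>2 * (v \<bullet> (H *v v))"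
    by (simp add: matrix_vector_mult_scaleR power2_eq_square)
  thus ?thesis by (simp add: qnorm_def real_sqrt_mult)
qed

lemma continuous_on_matrix_vector_mult:
  fixes H :: "'a::topological_space \<Rightarrow> real^'n^'m"
  assumes "continuous_on S H" "continuous_on S v"
  shows "continuous_on S (\<lambda>x. H x *v v x)"
  unfolding matrix_vector_mult_def
  by (intro continuous_on_vec_lambda continuous_on_sum continuous_on_mult continuous_on_component assms)

lemma continuous_on_qnorm:
  fixes H :: "'a::topological_space \<Rightarrow> real^'n^'n"
  assumes "continuous_on S H" "continuous_on S v"
  shows "continuous_on S (\<lambda>x. qnorm (H x) (v x))"
  unfolding qnorm_def
  by (intro continuous_on_real_sqrt continuous_on_inner continuous_on_matrix_vector_mult assms)

lemma smooth_on_differentiable: "smooth_on S f \<Longrightarrow> x \<in> S \<Longrightarrow> f differentiable (at x)"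
  unfolding smooth_on_def by (metis Ck_on.simps(2))

lemma smooth_on_continuous_derivative:
  "smooth_on S f \<Longrightarrow> continuous_on S (\<lambda>x. frechet_derivative f (at x) v)"
  unfolding smooth_on_def by (metis Ck_on.simps)

lemma smooth_on_continuous: "smooth_on S f \<Longrightarrow> continuous_on S f"
  unfolding smooth_on_def by (metis Ck_on.simps(1))

section \<open>Charts of a Riemannian manifold and the speed of curves\<close>

locale riemannian =
  fixes X :: "'a topology" and A :: "('a, 'n::finite) chart set" and g :: "('a, 'n) metric_components"
  assumes riemannian_manifold: "riemannian_manifold X A g"
begin

abbreviation M where "M \<equiv> topspace X"

abbreviation C1_on where "C1_on \<equiv> C1_curve_on X A"

abbreviation pw_C1 where "pw_C1 \<equiv> piecewise_C1_curve X A"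

abbreviation length_of where "length_of \<equiv> curve_length A g"

lemma Hausdorff: "Hausdorff_space X"
  using riemannian_manifold unfolding riemannian_manifold_def smooth_manifold_def by simp

lemma atlas: "smooth_atlas X A"
  using riemannian_manifold unfolding riemannian_manifold_def smooth_manifold_def by simp

lemma metric: "riemannian_metric A g"
  using riemannian_manifold unfolding riemannian_manifold_def by simp

lemma cover: "(\<Union>c\<in>A. fst c) = M"
  using atlas unfolding smooth_atlas_def by simp

lemma smooth_transition: "c \<in> A \<Longrightarrow> c' \<in> A \<Longrightarrow> smooth_on (snd c ` (fst c \<inter> fst c')) (transition c c')"
  using atlas unfolding smooth_atlas_def by simp

lemma smooth_metric: "c \<in> A \<Longrightarrow> smooth_on (snd c ` fst c) (g c)"
  using metric unfolding riemannian_metric_def by simp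

lemma metric_symmetric: "c \<in> A \<Longrightarrow> x \<in> snd c ` fst c \<Longrightarrow> transpose (g c x) = g c x"
  using metric unfolding riemannian_metric_def by blast

lemma metric_pos: "c \<in> A \<Longrightarrow> x \<in> snd c ` fst c \<Longrightarrow> v \<noteq> 0 \<Longrightarrow> 0 < v \<bullet> (g c x *v v)"
  using metric unfolding riemannian_metric_def by blast

lemma metric_transform:
  assumes "c \<in> A" "c' \<in> A" "p \<in> fst c \<inter> fst c'"
  shows "v \<bullet> (g c (snd c p) *v w) =
      frechet_derivative (transition c c') (at (snd c p)) v \<bullet>
        (g c' (snd c' p) *v frechet_derivative (transition c c') (at (snd c p)) w)"
proof -
  have "\<forall>c\<in>A. \<forall>c'\<in>A. \<forall>p \<in> fst c \<inter> fst c'. \<forall>v w.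
      v \<bullet> (g c (snd c p) *v w) =
      frechet_derivative (transition c c') (at (snd c p)) v \<bullet>
        (g c' (snd c' p) *v frechet_derivative (transition c c') (at (snd c p)) w)"
    using metric unfolding riemannian_metric_def Let_def by (elim conjE)
  thus ?thesis using assms by blast
qed

lemma chart_homeo: "c \<in> A \<Longrightarrow> homeomorphic_map (subtopology X (fst c)) (top_of_set (snd c ` fst c)) (snd c)"
  and openin_chart: "c \<in> A \<Longrightarrow> openin X (fst c)"
  and open_chart_image: "c \<in> A \<Longrightarrow> open (snd c ` fst c)"
  using riemannian_manifold
  unfolding riemannian_manifold_def smooth_manifold_def smooth_atlas_def is_chart_def
  by (auto simp: case_prod_beta)

lemma chart_sub: "c \<in> A \<Longrightarrow> fst c \<subseteq> M"
  using openin_chart openin_subset by blast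

lemma chart_inj: "c \<in> A \<Longrightarrow> inj_on (snd c) (fst c)"
  using homeomorphic_imp_injective_map[OF chart_homeo] chart_sub
  by (metis inf.absorb_iff2 topspace_subtopology)

lemma chart_continuous: "c \<in> A \<Longrightarrow> continuous_map (subtopology X (fst c)) euclidean (snd c)"
  using homeomorphic_imp_continuous_map[OF chart_homeo] continuous_map_into_fulltopology by blast

abbreviation param :: "('a, 'n) chart \<Rightarrow> real^'n \<Rightarrow> 'a" where
  "param c \<equiv> inv_into (fst c) (snd c)"

lemma param_chart: "c \<in> A \<Longrightarrow> p \<in> fst c \<Longrightarrow> param c (snd c p) = p"
  using chart_inj by simp

lemma chart_param: "x \<in> snd c ` fst c \<Longrightarrow> snd c (param c x) = x"
  by (simp add: f_inv_into_f)

lemma param_in: "x \<in> snd c ` fst c \<Longrightarrow> param c x \<in> fst c"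
  by (simp add: inv_into_into)

lemma param_image_eq:
  assumes c: "c \<in> A" and S: "S \<subseteq> snd c ` fst c"
  shows "param c ` S = {p\<in>fst c. snd c p \<in> S}"
proof (intro equalityI subsetI)
  fix p assume "p \<in> param c ` S"
  then obtain x where "x \<in> S" "p = param c x" by blast
  thus "p \<in> {p\<in>fst c. snd c p \<in> S}" using S chart_param[of x c] param_in[of x c] by auto
next
  fix p assume "p \<in> {p\<in>fst c. snd c p \<in> S}"
  thus "p \<in> param c ` S" using param_chart[OF c, of p] by (metis (mono_tags, lifting) imageI mem_Collect_eq)
qed

lemma openin_param_image:
  assumes c: "c \<in> A" and S: "S \<subseteq> snd c ` fst c" "open S"
  shows "openin X (param c ` S)"
proof -
  have "openin (subtopology X (fst c)) {p \<in> topspace (subtopology X (fst c)). snd c p \<in> S}"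
    by (rule openin_continuous_map_preimage[OF chart_continuous[OF c]]) (use S in simp)
  moreover have "{p \<in> topspace (subtopology X (fst c)). snd c p \<in> S} = param c ` S"
    using param_image_eq[OF c S(1)] chart_sub[OF c] by auto
  ultimately show ?thesis using openin_chart[OF c] openin_trans_full by metis
qed

lemma param_continuous:
  assumes c: "c \<in> A" shows "continuous_map (top_of_set (snd c ` fst c)) X (param c)"
  unfolding continuous_map_openin_preimage_eq
proof (intro conjI allI impI)
  show "param c \<in> topspace (top_of_set (snd c ` fst c)) \<rightarrow> M"
    using param_in chart_sub[OF c] by fastforce
  fix U assume U: "openin X U"
  obtain V where V: "openin (top_of_set (snd c ` fst c)) V" "V = snd c ` (fst c \<inter> U)"
  proof -
    have "openin (subtopology X (fst c)) (fst c \<inter> U)" using U by (simp add: openin_subtopology_Int2)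
    hence "openin (top_of_set (snd c ` fst c)) (snd c ` (fst c \<inter> U))"
      using homeomorphic_imp_open_map[OF chart_homeo[OF c]] by (simp add: open_map_def)
    thus ?thesis using that by blast
  qed
  have "topspace (top_of_set (snd c ` fst c)) \<inter> param c -` U = V"
    using V(2) param_chart[OF c] param_in by (auto simp: f_inv_into_f intro!: image_eqI)
  thus "openin (top_of_set (snd c ` fst c)) (topspace (top_of_set (snd c ` fst c)) \<inter> param c -` U)"
    using V(1) by simp
qed

lemma metric_qnorm_transform:
  assumes "c \<in> A" "c' \<in> A" "p \<in> fst c" "p \<in> fst c'"
  shows "qnorm (g c (snd c p)) v =
    qnorm (g c' (snd c' p)) (frechet_derivative (transition c c') (at (snd c p)) v)"
  using metric_transform[of c c' p v v] assms by (simp add: qnorm_def)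

text \<open>The values of \<open>snd c\<close> outside \<open>fst c\<close> are arbitrary, so
  differentiability of \<open>snd c \<circ> \<gamma>\<close> alone does not keep the curve in the
  chart near t. The eventual membership does, and this is what the chain rule for a change of chart
  needs.\<close>

definition regular :: "real set \<Rightarrow> (real \<Rightarrow> 'a) \<Rightarrow> real \<Rightarrow> bool" where
  "regular I \<gamma> t \<longleftrightarrow> \<gamma> t \<in> M \<and> (\<forall>c\<in>A. \<gamma> t \<in> fst c \<longrightarrow>
     (\<forall>\<^sub>F s in at t within I. \<gamma> s \<in> fst c) \<and> (snd c \<circ> \<gamma>) differentiable (at t within I))"

text \<open>With \<open>I = UNIV\<close> the derivative does not refer to the parameter interval, which makes the
  speed local; it differs from \<^const>\<open>curve_speed\<close> at finitely many points only.\<close>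

definition speed :: "real set \<Rightarrow> (real \<Rightarrow> 'a) \<Rightarrow> real \<Rightarrow> real" where
  "speed I \<gamma> t =
     (let c = (SOME c. c \<in> A \<and> \<gamma> t \<in> fst c)
      in qnorm (g c (snd c (\<gamma> t))) (vector_derivative (snd c \<circ> \<gamma>) (at t within I)))"

lemma curve_speed_eq: "curve_speed A g \<gamma> t = speed {0..1} \<gamma> t"
  by (simp add: curve_speed_def speed_def qnorm_def Let_def)

lemma some_chart:
  assumes "p \<in> M"
  defines "c \<equiv> SOME c. c \<in> A \<and> p \<in> fst c"
  shows "c \<in> A" "p \<in> fst c"
proof -
  have "\<exists>c. c \<in> A \<and> p \<in> fst c" using assms(1) cover by blast
  from someI_ex[OF this] show "c \<in> A" "p \<in> fst c" unfolding c_def by auto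
qed

lemma chart_change_derivative:
  assumes c: "c \<in> A" "c' \<in> A" "\<gamma> t \<in> fst c" "\<gamma> t \<in> fst c'"
    and ev: "\<forall>\<^sub>F s in at t within I. \<gamma> s \<in> fst c"
    and D: "((snd c \<circ> \<gamma>) has_vector_derivative D) (at t within I)"
  shows "((snd c' \<circ> \<gamma>) has_vector_derivative
     frechet_derivative (transition c c') (at (snd c (\<gamma> t))) D) (at t within I)"
proof -
  let ?T = "transition c c'"
  have "?T differentiable (at (snd c (\<gamma> t)))"
    by (rule smooth_on_differentiable[OF smooth_transition[OF c(1,2)]]) (use c in auto)
  hence "(?T has_derivative frechet_derivative ?T (at (snd c (\<gamma> t)))) (at ((snd c \<circ> \<gamma>) t))"
    by (simp add: frechet_derivative_works[symmetric])
  hence "((?T \<circ> (snd c \<circ> \<gamma>)) has_vector_derivative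
     frechet_derivative ?T (at (snd c (\<gamma> t))) D) (at t within I)"
    by (intro vector_derivative_diff_chain_within[OF D]) (rule has_derivative_at_withinI)
  moreover
  have "?T (snd c (\<gamma> s)) = snd c' (\<gamma> s)" if "\<gamma> s \<in> fst c" for s
    using param_chart[OF c(1) that] by (simp add: transition_def)
  note T_eq = this
  have "\<forall>\<^sub>F s in nhds t. s \<noteq> t \<longrightarrow> s \<in> I \<longrightarrow> \<gamma> s \<in> fst c" using ev by (simp add: eventually_at_filter)
  hence "\<forall>\<^sub>F s in nhds t. s \<in> I \<longrightarrow> (?T \<circ> (snd c \<circ> \<gamma>)) s = (snd c' \<circ> \<gamma>) s"
  proof (rule eventually_mono)
    fix s assume *: "s \<noteq> t \<longrightarrow> s \<in> I \<longrightarrow> \<gamma> s \<in> fst c"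
    show "s \<in> I \<longrightarrow> (?T \<circ> (snd c \<circ> \<gamma>)) s = (snd c' \<circ> \<gamma>) s"
      using * c(3) T_eq[of s] by (cases "s = t") auto
  qed
  moreover have "(?T \<circ> (snd c \<circ> \<gamma>)) t = (snd c' \<circ> \<gamma>) t"
    using param_chart[OF c(1,3)] by (simp add: transition_def)
  ultimately show ?thesis by (subst (asm) has_vector_derivative_cong_ev) auto
qed

text \<open>The chain rule and the transformation law of \<open>g\<close> compensate each other, so
  the chart picked by \<open>SOME\<close> in \<open>speed\<close> can be exchanged for any chart
  around \<open>\<gamma> t\<close>.\<close>

lemma speed_in_chart:
  assumes reg: "regular I \<gamma> t" and c: "c \<in> A" "\<gamma> t \<in> fst c" and nb: "at t within I \<noteq> bot"
    and D: "((snd c \<circ> \<gamma>) has_vector_derivative D) (at t within I)"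
  shows "speed I \<gamma> t = qnorm (g c (snd c (\<gamma> t))) D"
proof -
  define c0 where "c0 = (SOME c. c \<in> A \<and> \<gamma> t \<in> fst c)"
  have c0: "c0 \<in> A" "\<gamma> t \<in> fst c0" using some_chart[of "\<gamma> t"] reg by (auto simp: c0_def regular_def)
  have "\<forall>\<^sub>F s in at t within I. \<gamma> s \<in> fst c" using reg c by (auto simp: regular_def)
  from chart_change_derivative[OF c(1) c0(1) c(2) c0(2) this D]
  have "vector_derivative (snd c0 \<circ> \<gamma>) (at t within I) = frechet_derivative (transition c c0) (at (snd c (\<gamma> t))) D"
    by (rule vector_derivative_within[OF nb])
  thus ?thesis using metric_qnorm_transform[OF c(1) c0(1) c(2) c0(2), of D] by (simp add: speed_def c0_def[symmetric])
qed

lemma speed_nonneg: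
  assumes "\<gamma> t \<in> M" shows "0 \<le> speed I \<gamma> t"
proof -
  define c0 where "c0 = (SOME c. c \<in> A \<and> \<gamma> t \<in> fst c)"
  have c0: "c0 \<in> A" "\<gamma> t \<in> fst c0" using some_chart[OF assms] by (auto simp: c0_def)
  let ?v = "vector_derivative (snd c0 \<circ> \<gamma>) (at t within I)"
  have "0 \<le> ?v \<bullet> (g c0 (snd c0 (\<gamma> t)) *v ?v)"
    using metric_pos[OF c0(1), of "snd c0 (\<gamma> t)" ?v] c0(2) by (cases "?v = 0") auto
  thus ?thesis by (simp add: speed_def c0_def[symmetric] qnorm_def)
qed

lemma eventually_in_chart:
  assumes "continuous_map (top_of_set I) X \<gamma>" "t \<in> I" "openin X U" "\<gamma> t \<in> U"
  shows "\<forall>\<^sub>F s in at t within I. \<gamma> s \<in> U"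
proof -
  have "openin (top_of_set I) {s \<in> topspace (top_of_set I). \<gamma> s \<in> U}"
    by (rule openin_continuous_map_preimage[OF assms(1,3)])
  then obtain T where T: "open T" "{s\<in>I. \<gamma> s \<in> U} = I \<inter> T" by (auto simp: openin_open)
  show ?thesis unfolding eventually_at_topological
    by (rule exI[of _ T]) (use T assms in auto)
qed

lemma C1_regular_within:
  assumes C1: "C1_on a b \<gamma>" and t: "t \<in> {a..b}"
  shows "regular {a..b} \<gamma> t"
proof -
  have cont: "continuous_map (top_of_set {a..b}) X \<gamma>" using C1 by (simp add: C1_curve_on_def)
  have "\<gamma> t \<in> M" using continuous_map_image_subset_topspace[OF cont] t by auto
  moreover have "(snd c \<circ> \<gamma>) differentiable (at t within {a..b})" if cc: "c \<in> A" "\<gamma> t \<in> fst c" for c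
  proof -
    obtain D where "((snd c \<circ> \<gamma>) has_vector_derivative D t) (at t within {a..b})"
      using C1 cc t unfolding C1_curve_on_def by blast
    thus ?thesis by (rule differentiableI_vector)
  qed
  ultimately show ?thesis
    using eventually_in_chart[OF cont t openin_chart] by (auto simp: regular_def)
qed

lemma C1_regular:
  assumes "C1_on a b \<gamma>" "t \<in> {a<..<b}"
  shows "regular UNIV \<gamma> t" "speed {a..b} \<gamma> t = speed UNIV \<gamma> t"
proof -
  have "at t within {a..b} = at t" using assms(2) by (simp add: at_within_Icc_at)
  thus "regular UNIV \<gamma> t" "speed {a..b} \<gamma> t = speed UNIV \<gamma> t"
    using C1_regular_within[OF assms(1), of t] assms(2) by (auto simp: regular_def speed_def)
qed

text \<open>The chart behind \<open>speed\<close> may change abruptly with t. Near \<open>t0\<close>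
  it is replaced by one fixed chart, in which the speed is a continuous expression in position and
  velocity; \<open>J\<close> is a relative neighbourhood of \<open>t0\<close>.\<close>

lemma C1_speed_continuous:
  assumes C1: "C1_on a b \<gamma>" and ab: "a < b"
  shows "continuous_on {a..b} (speed {a..b} \<gamma>)"
proof (rule continuous_on_eq_continuous_within[THEN iffD2], rule ballI)
  fix t0 assume t0: "t0 \<in> {a..b}"
  have cont: "continuous_map (top_of_set {a..b}) X \<gamma>" using C1 by (simp add: C1_curve_on_def)
  have "\<gamma> t0 \<in> M" using continuous_map_image_subset_topspace[OF cont] t0 by auto
  then obtain c where c: "c \<in> A" "\<gamma> t0 \<in> fst c" using cover by blast
  define J where "J = {t\<in>{a..b}. \<gamma> t \<in> fst c}"
  obtain D where D: "continuous_on J D" "\<And>t. t \<in> J \<Longrightarrow> ((snd c \<circ> \<gamma>) has_vector_derivative D t) (at t within {a..b})"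
    using C1 c(1) unfolding C1_curve_on_def J_def by blast
  have contJ: "continuous_on J (snd c \<circ> \<gamma>)"
    unfolding continuous_on_eq_continuous_within
  proof
    fix t assume "t \<in> J"
    from has_vector_derivative_continuous[OF D(2)[OF this]]
    show "continuous (at t within J) (snd c \<circ> \<gamma>)" by (rule continuous_within_subset) (auto simp: J_def)
  qed
  have "continuous_on J (\<lambda>t. g c ((snd c \<circ> \<gamma>) t))"
    by (rule continuous_on_compose2[OF smooth_on_continuous[OF smooth_metric[OF c(1)]] contJ]) (auto simp: J_def)
  hence F: "continuous_on J (\<lambda>t. qnorm (g c ((snd c \<circ> \<gamma>) t)) (D t))"
    by (rule continuous_on_qnorm) (rule D(1))
  have eq: "speed {a..b} \<gamma> t = qnorm (g c ((snd c \<circ> \<gamma>) t)) (D t)" if "t \<in> J" for t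
  proof -
    have t: "t \<in> {a..b}" "\<gamma> t \<in> fst c" using that by (auto simp: J_def)
    have "at t within {a..b} \<noteq> bot" using t ab by (simp add: trivial_limit_within)
    from speed_in_chart[OF C1_regular_within[OF C1 t(1)] c(1) t(2) this D(2)[OF that]] show ?thesis by simp
  qed
  have "continuous (at t0 within J) (\<lambda>t. qnorm (g c ((snd c \<circ> \<gamma>) t)) (D t))"
    using F t0 c by (auto simp: continuous_on_eq_continuous_within J_def)
  moreover have "at t0 within J = at t0 within {a..b}"
  proof -
    have "openin (top_of_set {a..b}) {s \<in> topspace (top_of_set {a..b}). \<gamma> s \<in> fst c}"
      by (rule openin_continuous_map_preimage[OF cont openin_chart[OF c(1)]])
    then obtain T where T: "open T" "J = {a..b} \<inter> T" by (auto simp: openin_open J_def)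
    have "t0 \<in> T" using T(2) t0 c by (auto simp: J_def)
    thus ?thesis using T by (intro at_within_nhd[of t0 T]) auto
  qed
  ultimately have "continuous (at t0 within {a..b}) (\<lambda>t. qnorm (g c ((snd c \<circ> \<gamma>) t)) (D t))" by simp
  hence lim: "((\<lambda>t. qnorm (g c ((snd c \<circ> \<gamma>) t)) (D t)) \<longlongrightarrow> qnorm (g c ((snd c \<circ> \<gamma>) t0)) (D t0)) (at t0 within {a..b})"
    by (simp add: continuous_within)
  have "\<forall>\<^sub>F t in at t0 within {a..b}. t \<in> {a..b}" by (simp add: eventually_at_filter)
  with eventually_in_chart[OF cont t0 openin_chart[OF c(1)] c(2)]
  have "\<forall>\<^sub>F t in at t0 within {a..b}. qnorm (g c ((snd c \<circ> \<gamma>) t)) (D t) = speed {a..b} \<gamma> t"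
    by eventually_elim (simp add: eq J_def)
  from Lim_transform_eventually[OF lim this]
  show "continuous (at t0 within {a..b}) (speed {a..b} \<gamma>)"
    using eq[of t0] t0 c by (simp add: continuous_within J_def)
qed

lemma C1_speed_integrable:
  assumes "C1_on a b \<gamma>" "a < b"
  shows "speed UNIV \<gamma> integrable_on {a..b}"
proof -
  have eq: "speed UNIV \<gamma> t = speed {a..b} \<gamma> t" if "t \<in> {a..b} - {a,b}" for t
    using C1_regular(2)[OF assms(1), of t] that by auto
  have "speed {a..b} \<gamma> integrable_on {a..b}"
    by (rule integrable_continuous_real[OF C1_speed_continuous[OF assms]])
  thus ?thesis by (rule integrable_spike_finite[where S = "{a,b}" and f = "speed {a..b} \<gamma>", rotated 2]) (simp, rule eq)
qed

end

lemma integrable_on_pieces: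
  fixes f :: "real \<Rightarrow> real"
  assumes "finite S" "a \<le> b"
    and "\<And>p q. a \<le> p \<Longrightarrow> p < q \<Longrightarrow> q \<le> b \<Longrightarrow> {p<..<q} \<inter> S = {} \<Longrightarrow> f integrable_on {p..q}"
  shows "f integrable_on {a..b}"
  using assms
proof (induction S arbitrary: a b rule: finite_induct)
  case empty
  show ?case proof (cases "a = b")
      case True
      show ?thesis unfolding True box_real(2)[symmetric] by (rule integrable_on_refl)
    next
      case False
      thus ?thesis using empty.prems(1) by (intro empty.prems(2)) auto
    qed
next
  case (insert s S)
  show ?case
  proof (cases "s \<in> {a<..<b}")
    case True
    have "f integrable_on {a..s}" by (rule insert.IH) (use True insert.prems in auto)
    moreover have "f integrable_on {s..b}" by (rule insert.IH) (use True insert.prems in auto)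
    ultimately show ?thesis using True by (auto intro: Henstock_Kurzweil_Integration.integrable_combine[of a s b])
  next
    case False
    show ?thesis
    proof (rule insert.IH)
      fix p q assume "a \<le> p" "p < q" "q \<le> b" "{p<..<q} \<inter> S = {}"
      thus "f integrable_on {p..q}" using False by (intro insert.prems) auto
    qed (use insert.prems in auto)
  qed
qed

section \<open>Reparametrised, joined and straight curves\<close>

context riemannian
begin

lemma piecewise_C1_curveE:
  assumes "pw_C1 \<gamma>"
  obtains S where "finite S" "continuous_map (top_of_set {0..1}) X \<gamma>"
    "\<And>a b. 0 \<le> a \<Longrightarrow> a < b \<Longrightarrow> b \<le> 1 \<Longrightarrow> {a<..<b} \<inter> S = {} \<Longrightarrow> C1_on a b \<gamma>"
proof -
  obtain S where "finite S" "\<forall>a b. 0 \<le> a \<and> a < b \<and> b \<le> 1 \<and> {a<..<b} \<inter> S = {} \<longrightarrow> C1_on a b \<gamma>"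
    using assms unfolding piecewise_C1_curve_def by (elim conjE exE)
  with assms that[of S] show thesis by (simp add: piecewise_C1_curve_def)
qed

lemma piecewise_C1_regular:
  assumes "pw_C1 \<gamma>"
  shows "\<exists>S. finite S \<and> (\<forall>t\<in>{0..1} - S. t \<in> {0<..<1} \<and> regular UNIV \<gamma> t)"
    and "speed UNIV \<gamma> integrable_on {0..1}"
    and "length_of \<gamma> = integral {0..1} (speed UNIV \<gamma>)"
proof -
  obtain S where S: "finite S" and "continuous_map (top_of_set {0..1}) X \<gamma>"
    and C1: "\<And>a b. 0 \<le> a \<Longrightarrow> a < b \<Longrightarrow> b \<le> 1 \<Longrightarrow> {a<..<b} \<inter> S = {} \<Longrightarrow> C1_on a b \<gamma>"
    by (rule piecewise_C1_curveE[OF assms], rule that) simp_all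
  have "regular UNIV \<gamma> t" if tS: "t \<in> {0<..<1} - S" for t
  proof -
    have "open ({0<..<1} - S)" using S by (intro open_Diff finite_imp_closed) auto
    from open_contains_cball[THEN iffD1, OF this, rule_format, OF tS]
    obtain e where e: "e > 0" "cball t e \<subseteq> {0<..<1} - S" by auto
    have ei: "{t-e..t+e} \<subseteq> {0<..<1} - S" using e by (auto simp: cball_eq_atLeastAtMost)
    have "t - e \<in> {0<..<1} - S" "t + e \<in> {0<..<1} - S" by (intro subsetD[OF ei], use e in simp)+
    moreover have "{t-e<..<t+e} \<inter> S = {}" using ei greaterThanLessThan_subseteq_atLeastAtMost_iff[of "t-e" "t+e" "t-e" "t+e"] by blast
    ultimately have "C1_on (t-e) (t+e) \<gamma>" using e by (intro C1) auto
    thus ?thesis by (rule C1_regular) (use e in auto)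
  qed
  \<comment> \<open>0 and 1 become exceptional because the two-sided derivative there would depend
    on values of the curve outside the parameter interval.\<close>
  thus "\<exists>S. finite S \<and> (\<forall>t\<in>{0..1} - S. t \<in> {0<..<1} \<and> regular UNIV \<gamma> t)"
    using S by (intro exI[of _ "insert 0 (insert 1 S)"]) auto
  show "speed UNIV \<gamma> integrable_on {0..1}"
    by (rule integrable_on_pieces[OF S]) (auto intro!: C1_speed_integrable C1)
  have "speed {0..1} \<gamma> t = speed UNIV \<gamma> t" if "t \<in> {0..1} - {0,1}" for t
    using that by (simp add: speed_def at_within_Icc_at)
  thus "length_of \<gamma> = integral {0..1} (speed UNIV \<gamma>)"
    unfolding curve_length_def curve_speed_eq[abs_def]
    by (intro integral_spike[of "{0,1}"]) (auto simp: curve_speed_eq)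
qed

lemma continuous_curve_affine:
  fixes S S' :: "real set"
  assumes "continuous_map (top_of_set S') X \<gamma>" "\<And>t. t \<in> S \<Longrightarrow> m * t + k \<in> S'"
  shows "continuous_map (top_of_set S) X (\<lambda>t. \<gamma> (m * t + k))"
proof -
  have "continuous_map (top_of_set S) (top_of_set S') (\<lambda>t. m * t + k)"
    using assms(2) by (auto intro!: continuous_intros)
  from continuous_map_compose[OF this assms(1)] show ?thesis by (simp add: o_def)
qed

lemma C1_curve_affine:
  assumes C1: "C1_on a' b' \<gamma>" and e: "\<And>t. t \<in> {a..b} \<Longrightarrow> m * t + k \<in> {a'..b'}"
  shows "C1_on a b (\<lambda>t. \<gamma> (m * t + k))"
  unfolding C1_curve_on_def
proof (intro conjI ballI)
  show "continuous_map (top_of_set {a..b}) X (\<lambda>t. \<gamma> (m * t + k))"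
    by (rule continuous_curve_affine[of "{a'..b'}"]) (use C1 e in \<open>auto simp: C1_curve_on_def\<close>)
  fix c assume c: "c \<in> A"
  obtain D where D: "continuous_on {t\<in>{a'..b'}. \<gamma> t \<in> fst c} D"
    "\<And>t. t\<in>{a'..b'} \<Longrightarrow> \<gamma> t \<in> fst c \<Longrightarrow> ((snd c \<circ> \<gamma>) has_vector_derivative D t) (at t within {a'..b'})"
    using C1 c unfolding C1_curve_on_def by blast
  show "\<exists>D. continuous_on {t\<in>{a..b}. \<gamma> (m * t + k) \<in> fst c} D \<and>
        (\<forall>t\<in>{a..b}. \<gamma> (m * t + k) \<in> fst c \<longrightarrow>
           ((snd c \<circ> (\<lambda>t. \<gamma> (m * t + k))) has_vector_derivative D t) (at t within {a..b}))"
  proof (intro exI[of _ "\<lambda>t. m *\<^sub>R D (m * t + k)"] conjI ballI impI)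
    show "continuous_on {t\<in>{a..b}. \<gamma> (m * t + k) \<in> fst c} (\<lambda>t. m *\<^sub>R D (m * t + k))"
      by (intro continuous_on_scaleR continuous_on_const continuous_on_compose2[OF D(1)] continuous_intros) (use e in auto)
    fix t assume t: "t \<in> {a..b}" "\<gamma> (m * t + k) \<in> fst c"
    have "((\<lambda>t. m * t + k) has_vector_derivative m) (at t within {a..b})"
      by (auto intro!: derivative_eq_intros simp: has_real_derivative_iff_has_vector_derivative[symmetric])
    moreover have "((snd c \<circ> \<gamma>) has_vector_derivative D (m * t + k)) (at (m * t + k) within (\<lambda>t. m * t + k) ` {a..b})"
      by (rule has_vector_derivative_within_subset[OF D(2)[OF e[OF t(1)] t(2)]]) (use e in auto)
    ultimately have "((snd c \<circ> \<gamma> \<circ> (\<lambda>t. m * t + k)) has_vector_derivative m *\<^sub>R D (m * t + k)) (at t within {a..b})"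
      by (rule vector_diff_chain_within)
    thus "((snd c \<circ> (\<lambda>t. \<gamma> (m * t + k))) has_vector_derivative m *\<^sub>R D (m * t + k)) (at t within {a..b})"
      by (simp add: o_def)
  qed
qed

lemma C1_curve_subinterval:
  assumes "C1_on a' b' \<gamma>" "a' \<le> a" "b \<le> b'"
  shows "C1_on a b \<gamma>"
  using C1_curve_affine[OF assms(1), of a b 1 0] assms(2,3) by simp

lemma C1_curve_cong:
  assumes C1: "C1_on a b \<gamma>" and eq: "\<And>t. t \<in> {a..b} \<Longrightarrow> \<gamma>' t = \<gamma> t"
  shows "C1_on a b \<gamma>'"
  unfolding C1_curve_on_def
proof (intro conjI ballI)
  show "continuous_map (top_of_set {a..b}) X \<gamma>'"
    using C1 unfolding C1_curve_on_def by (elim conjE, elim continuous_map_eq) (simp add: eq)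
  fix c assume c: "c \<in> A"
  obtain D where D: "continuous_on {t\<in>{a..b}. \<gamma> t \<in> fst c} D"
    "\<And>t. t\<in>{a..b} \<Longrightarrow> \<gamma> t \<in> fst c \<Longrightarrow> ((snd c \<circ> \<gamma>) has_vector_derivative D t) (at t within {a..b})"
    using C1 c unfolding C1_curve_on_def by blast
  have "{t\<in>{a..b}. \<gamma>' t \<in> fst c} = {t\<in>{a..b}. \<gamma> t \<in> fst c}" using eq by auto
  moreover have "((snd c \<circ> \<gamma>') has_vector_derivative D t) (at t within {a..b})" if "t\<in>{a..b}" "\<gamma>' t \<in> fst c" for t
    by (rule has_vector_derivative_transform[OF that(1) _ D(2)]) (use that eq in auto)
  ultimately show "\<exists>D. continuous_on {t\<in>{a..b}. \<gamma>' t \<in> fst c} D \<and>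
        (\<forall>t\<in>{a..b}. \<gamma>' t \<in> fst c \<longrightarrow> ((snd c \<circ> \<gamma>') has_vector_derivative D t) (at t within {a..b}))"
    using D(1) by (intro exI[of _ D]) auto
qed

lemma speed_affine:
  assumes reg: "regular UNIV \<gamma> (m * t + k)" and ev: "\<forall>\<^sub>F s in nhds t. \<sigma> s = \<gamma> (m * s + k)"
  shows "speed UNIV \<sigma> t = \<bar>m\<bar> * speed UNIV \<gamma> (m * t + k)"
proof -
  have eq: "\<sigma> t = \<gamma> (m * t + k)" using eventually_nhds_x_imp_x[OF ev] .
  define c where "c = (SOME c. c \<in> A \<and> \<gamma> (m * t + k) \<in> fst c)"
  have c: "c \<in> A" "\<gamma> (m * t + k) \<in> fst c" using some_chart[of "\<gamma> (m * t + k)"] reg by (auto simp: c_def regular_def)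
  define D where "D = vector_derivative (snd c \<circ> \<gamma>) (at (m * t + k))"
  have D: "((snd c \<circ> \<gamma>) has_vector_derivative D) (at (m * t + k))"
    using reg c by (simp add: D_def regular_def vector_derivative_works[symmetric])
  have "((\<lambda>t. m * t + k) has_vector_derivative m) (at t)"
    by (auto intro!: derivative_eq_intros simp: has_real_derivative_iff_has_vector_derivative[symmetric])
  from vector_diff_chain_at[OF this D]
  have "((snd c \<circ> \<gamma> \<circ> (\<lambda>t. m * t + k)) has_vector_derivative m *\<^sub>R D) (at t)" .
  moreover have "\<forall>\<^sub>F s in nhds t. s \<in> UNIV \<longrightarrow> (snd c \<circ> \<gamma> \<circ> (\<lambda>t. m * t + k)) s = (snd c \<circ> \<sigma>) s"
    using ev by eventually_elim simp
  ultimately have "((snd c \<circ> \<sigma>) has_vector_derivative m *\<^sub>R D) (at t)"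
    by (subst (asm) has_vector_derivative_cong_ev[where S = UNIV]) (auto simp: eq)
  hence "vector_derivative (snd c \<circ> \<sigma>) (at t) = m *\<^sub>R D" by (rule vector_derivative_at)
  thus ?thesis by (simp add: speed_def eq c_def[symmetric] D_def[symmetric] qnorm_scaleR)
qed

lemma integral_speed_split:
  assumes pw: "pw_C1 \<gamma>" and "0 \<le> t" "t \<le> 1"
  shows "integral {0..t} (speed UNIV \<gamma>) + integral {t..1} (speed UNIV \<gamma>) = length_of \<gamma>"
  unfolding piecewise_C1_regular(3)[OF pw]
  by (rule Henstock_Kurzweil_Integration.integral_combine[OF assms(2,3) piecewise_C1_regular(2)[OF pw]])

text \<open>\<open>\<sigma>\<close> has to agree with the reparametrised curve on
  \<open>{a..b}\<close> only, and \<open>m\<close> may be negative. One substitution thus covers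
  reversed curves, subcurves and both halves of a joined curve.\<close>

lemma integral_speed_affine:
  assumes pw: "pw_C1 \<gamma>" and ab: "a < b" and m: "m \<noteq> 0"
    and im: "(\<lambda>t. m * t + k) ` {a..b} = {lo..hi}" and sub: "0 \<le> lo" "hi \<le> 1"
    and \<sigma>: "\<And>t. t \<in> {a..b} \<Longrightarrow> \<sigma> t = \<gamma> (m * t + k)"
  shows "integral {a..b} (speed UNIV \<sigma>) = integral {lo..hi} (speed UNIV \<gamma>)"
proof -
  obtain S where S: "finite S" "\<And>t. t \<in> {0..1} - S \<Longrightarrow> t \<in> {0<..<1} \<and> regular UNIV \<gamma> t"
    using piecewise_C1_regular(1)[OF pw] by blast
  define S' where "S' = (\<lambda>t. m * t + k) -` S \<union> {a, b}"
  have fin: "finite S'" unfolding S'_def using S(1) m by (auto intro!: finite_vimageI injI)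
  have sp: "speed UNIV \<sigma> t = \<bar>m\<bar> * speed UNIV \<gamma> (m * t + k)" if t: "t \<in> {a..b} - S'" for t
  proof (rule speed_affine)
    have "m * t + k \<in> {lo..hi}" using im t by blast
    thus "regular UNIV \<gamma> (m * t + k)" using S(2)[of "m * t + k"] sub t by (auto simp: S'_def)
    have "t \<in> {a<..<b}" using t by (auto simp: S'_def)
    hence "\<forall>\<^sub>F s in nhds t. s \<in> {a<..<b}" by (intro eventually_nhds_in_open) auto
    thus "\<forall>\<^sub>F s in nhds t. \<sigma> s = \<gamma> (m * s + k)" by eventually_elim (simp add: \<sigma>)
  qed
  have "speed UNIV \<gamma> integrable_on {lo..hi}"
    by (rule integrable_on_subinterval[OF piecewise_C1_regular(2)[OF pw]]) (use sub in auto)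
  hence hi: "(speed UNIV \<gamma> has_integral integral {lo..hi} (speed UNIV \<gamma>)) (cbox lo hi)"
    by (simp add: has_integral_integral)
  have "((\<lambda>x. speed UNIV \<gamma> (m *\<^sub>R x + k)) has_integral (1 / (\<bar>m\<bar> ^ DIM(real))) *\<^sub>R integral {lo..hi} (speed UNIV \<gamma>))
     ((\<lambda>x. (1 / m) *\<^sub>R x + -((1 / m) *\<^sub>R k)) ` cbox lo hi)"
    by (rule has_integral_affinity[OF hi m])
  moreover have "(\<lambda>x. (1 / m) *\<^sub>R x + -((1 / m) *\<^sub>R k)) ` cbox lo hi = {a..b}"
    using m by (simp add: im[symmetric] image_image field_simps)
  ultimately have "((\<lambda>x. speed UNIV \<gamma> (m * x + k)) has_integral (1 / \<bar>m\<bar>) * integral {lo..hi} (speed UNIV \<gamma>)) {a..b}"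
    by simp
  from has_integral_mult_right[OF this, of "\<bar>m\<bar>"] m
  have hi2: "((\<lambda>x. \<bar>m\<bar> * speed UNIV \<gamma> (m * x + k)) has_integral integral {lo..hi} (speed UNIV \<gamma>)) {a..b}" by simp
  have "(speed UNIV \<sigma> has_integral integral {lo..hi} (speed UNIV \<gamma>)) {a..b}"
    by (rule has_integral_spike_finite[OF fin _ hi2]) (rule sp)
  thus ?thesis by (rule integral_unique)
qed

text \<open>For p > q the curve is run backwards: \<open>p = 1\<close> and \<open>q = 0\<close> give
  the reversed curve, p < q gives the subcurves.\<close>

lemma piecewise_C1_affine:
  assumes pw: "pw_C1 \<gamma>" and p: "p \<in> {0..1}" "q \<in> {0..1}" "p \<noteq> q"
  defines "\<sigma> \<equiv> \<lambda>t. \<gamma> ((q - p) * t + p)"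
  shows "pw_C1 \<sigma>"
    and "length_of \<sigma> = integral {min p q..max p q} (speed UNIV \<gamma>)"
proof -
  have range01: "(q - p) * t + p \<in> {0..1}" if "t \<in> {0..1}" for t
  proof -
    have eq: "(q - p) * t + p = (1 - t) * p + t * q" by (simp add: algebra_simps)
    have "(1 - t) * p + t * q \<le> (1 - t) * 1 + t * 1" using that p by (intro add_mono mult_left_mono) auto
    moreover have "0 \<le> (1 - t) * p + t * q" using that p by (intro add_nonneg_nonneg mult_nonneg_nonneg) auto
    ultimately show ?thesis unfolding eq by simp
  qed
  show pw': "pw_C1 \<sigma>"
    unfolding piecewise_C1_curve_def
  proof (intro conjI)
    obtain S where S: "finite S" and cont: "continuous_map (top_of_set {0..1}) X \<gamma>"
      and C1: "\<And>a b. 0 \<le> a \<Longrightarrow> a < b \<Longrightarrow> b \<le> 1 \<Longrightarrow> {a<..<b} \<inter> S = {} \<Longrightarrow> C1_on a b \<gamma>"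
      by (rule piecewise_C1_curveE[OF pw], rule that) simp_all
    show "continuous_map (top_of_set {0..1}) X \<sigma>"
      unfolding \<sigma>_def by (rule continuous_curve_affine[OF cont range01])
    define e where "e t = (q - p) * t + p" for t
    define S' where "S' = e -` S"
    have "finite S'" unfolding S'_def using S p by (intro finite_vimageI injI) (auto simp: e_def)
    moreover have "C1_on a b \<sigma>" if ab: "0 \<le> a" "a < b" "b \<le> 1" "{a<..<b} \<inter> S' = {}" for a b
    proof -
      have e01: "e a \<in> {0..1}" "e b \<in> {0..1}" using range01[of a] range01[of b] ab by (auto simp: e_def)
      have between: "\<exists>t\<in>{a<..<b}. e t = s" if s: "s \<in> {min (e a) (e b)<..<max (e a) (e b)}" for s
      proof (intro bexI)
        show "e ((s - p) / (q - p)) = s" using p by (simp add: e_def)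
        show "(s - p) / (q - p) \<in> {a<..<b}"
        proof (cases "p < q")
          case True
          hence "e a < e b" using ab by (simp add: e_def)
          thus ?thesis using s True by (simp add: e_def field_simps)
        next
          case False
          hence qp: "q < p" using p by simp
          hence "e b < e a" using ab by (simp add: e_def)
          thus ?thesis using s qp by (simp add: e_def field_simps)
        qed
      qed
      have "C1_on (min (e a) (e b)) (max (e a) (e b)) \<gamma>"
      proof (intro C1)
        show "min (e a) (e b) < max (e a) (e b)" using p ab by (auto simp: e_def min_def max_def)
        show "{min (e a) (e b)<..<max (e a) (e b)} \<inter> S = {}"
        proof (rule ccontr)
          assume "{min (e a) (e b)<..<max (e a) (e b)} \<inter> S \<noteq> {}"
          then obtain s where s: "s \<in> {min (e a) (e b)<..<max (e a) (e b)}" "s \<in> S" by blast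
          obtain t where "t \<in> {a<..<b}" "e t = s" using between[OF s(1)] by blast
          with s(2) ab(4) show False by (auto simp: S'_def)
        qed
      qed (use e01 in auto)
      hence "C1_on a b (\<lambda>t. \<gamma> ((q - p) * t + p))"
      proof (rule C1_curve_affine)
        fix t assume t: "t \<in> {a..b}"
        show "(q - p) * t + p \<in> {min (e a) (e b)..max (e a) (e b)}"
        proof (cases "p < q")
          case True
          hence "(q - p) * a \<le> (q - p) * t" "(q - p) * t \<le> (q - p) * b" using t by (auto intro!: mult_left_mono)
          thus ?thesis by (auto simp: e_def)
        next
          case False
          hence "(q - p) * a \<ge> (q - p) * t" "(q - p) * t \<ge> (q - p) * b" using t by (auto intro!: mult_left_mono_neg)
          thus ?thesis by (auto simp: e_def)
        qed
      qed
      thus ?thesis by (simp add: \<sigma>_def)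
    qed
    ultimately show "\<exists>S. finite S \<and> (\<forall>a b. 0 \<le> a \<and> a < b \<and> b \<le> 1 \<and> {a<..<b} \<inter> S = {} \<longrightarrow> C1_on a b \<sigma>)"
      by (intro exI[of _ S']) blast
  qed
  have "(\<lambda>t. (q - p) * t + p) ` {0..1} = {min p q..max p q}"
    using p by (simp add: image_affinity_atLeastAtMost min_def max_def)
  from integral_speed_affine[OF pw _ _ this, of \<sigma>] p
  show "length_of \<sigma> = integral {min p q..max p q} (speed UNIV \<gamma>)"
    unfolding piecewise_C1_regular(3)[OF pw'] by (simp add: \<sigma>_def)
qed

text \<open>The arguments \<open>2 * t + 0\<close> and \<open>2 * t + - 1\<close> are kept in the
  shape \<open>m * t + k\<close>, so that the affine lemmas apply to both halves.\<close>

lemma piecewise_C1_join: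
  assumes pw: "pw_C1 \<gamma>1" "pw_C1 \<gamma>2" and eq: "\<gamma>1 1 = \<gamma>2 0"
  defines "\<sigma> \<equiv> \<lambda>t. if t \<le> 1/2 then \<gamma>1 (2 * t + 0) else \<gamma>2 (2 * t + - 1)"
  shows "pw_C1 \<sigma>"
    and "length_of \<sigma> = length_of \<gamma>1 + length_of \<gamma>2"
proof -
  have \<sigma>1: "\<sigma> t = \<gamma>1 (2 * t + 0)" if "t \<in> {0..1/2}" for t using that by (simp add: \<sigma>_def)
  have \<sigma>2: "\<sigma> t = \<gamma>2 (2 * t + - 1)" if "t \<in> {1/2..1}" for t
  proof (cases "t = 1/2")
    case True
    show ?thesis unfolding True using eq by (simp add: \<sigma>_def)
  qed (use that in \<open>simp add: \<sigma>_def\<close>)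
  show pw': "pw_C1 \<sigma>"
    unfolding piecewise_C1_curve_def
  proof (intro conjI)
    have top: "subtopology (top_of_set {0..1}) {t \<in> topspace (top_of_set {0..1}). t \<le> 1/2} = top_of_set {0..1/2::real}"
      "subtopology (top_of_set {0..1}) {t \<in> topspace (top_of_set {0..1}). 1/2 \<le> t} = top_of_set {1/2..1::real}"
      unfolding subtopology_subtopology by (rule arg_cong[where f = "subtopology euclidean"], force)+
    obtain S1 where S1: "finite S1" and cont1: "continuous_map (top_of_set {0..1}) X \<gamma>1"
      and C1: "\<And>a b. 0 \<le> a \<Longrightarrow> a < b \<Longrightarrow> b \<le> 1 \<Longrightarrow> {a<..<b} \<inter> S1 = {} \<Longrightarrow> C1_on a b \<gamma>1"
      by (rule piecewise_C1_curveE[OF pw(1)], rule that) simp_all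
    obtain S2 where S2: "finite S2" and cont2: "continuous_map (top_of_set {0..1}) X \<gamma>2"
      and C2: "\<And>a b. 0 \<le> a \<Longrightarrow> a < b \<Longrightarrow> b \<le> 1 \<Longrightarrow> {a<..<b} \<inter> S2 = {} \<Longrightarrow> C1_on a b \<gamma>2"
      by (rule piecewise_C1_curveE[OF pw(2)], rule that) simp_all
    have half: "\<gamma>1 (2 * t + 0) = \<gamma>2 (2 * t + - 1)" if "t = 1/2" for t
      unfolding that using eq by simp
    have "continuous_map (top_of_set {0..1}) X (\<lambda>t. if t \<le> 1/2 then \<gamma>1 (2 * t + 0) else \<gamma>2 (2 * t + - 1))"
    proof (rule continuous_map_cases_le[where p = "\<lambda>t. t" and q = "\<lambda>t. 1/2"])
      show "continuous_map (subtopology (top_of_set {0..1}) {t \<in> topspace (top_of_set {0..1}). t \<le> 1/2}) X (\<lambda>t. \<gamma>1 (2 * t + 0))"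
        unfolding top by (rule continuous_curve_affine[OF cont1]) auto
      show "continuous_map (subtopology (top_of_set {0..1}) {t \<in> topspace (top_of_set {0..1}). 1/2 \<le> t}) X (\<lambda>t. \<gamma>2 (2 * t + - 1))"
        unfolding top by (rule continuous_curve_affine[OF cont2]) auto
      show "\<gamma>1 (2 * t + 0) = \<gamma>2 (2 * t + - 1)" if "t \<in> topspace (top_of_set {0..1})" "t = 1/2" for t
        by (rule half[OF that(2)])
    qed auto
    thus "continuous_map (top_of_set {0..1}) X \<sigma>" by (simp add: \<sigma>_def)
    \<comment> \<open>The velocities of the two curves need not match at the junction, so 1/2
      becomes a break point.\<close>
    define S where "S = insert (1/2) ((\<lambda>t. 2 * t + 0) -` S1 \<union> (\<lambda>t. 2 * t + - 1) -` S2)"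
    have "finite S" unfolding S_def using S1 S2 by (auto intro!: finite_vimageI injI)
    moreover have "C1_on a b \<sigma>" if ab: "0 \<le> a" "a < b" "b \<le> 1" "{a<..<b} \<inter> S = {}" for a b
    proof (cases "b \<le> 1/2")
      case True
      have "{2*a<..<2*b} \<inter> S1 = {}"
      proof (rule ccontr)
        assume "{2*a<..<2*b} \<inter> S1 \<noteq> {}"
        then obtain s where "s \<in> {2*a<..<2*b}" "s \<in> S1" by blast
        hence "s/2 \<in> {a<..<b} \<inter> S" by (simp add: S_def)
        with ab show False by blast
      qed
      hence "C1_on (2*a) (2*b) \<gamma>1" using C1[of "2*a" "2*b"] ab True by simp
      hence "C1_on a b (\<lambda>t. \<gamma>1 (2 * t + 0))" by (rule C1_curve_affine) auto
      thus ?thesis by (rule C1_curve_cong) (use True ab \<sigma>1 in auto)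
    next
      case False
      have "1/2 \<notin> {a<..<b}" using ab by (auto simp: S_def)
      hence a: "1/2 \<le> a" using False by simp
      have "{2*a-1<..<2*b-1} \<inter> S2 = {}"
      proof (rule ccontr)
        assume "{2*a-1<..<2*b-1} \<inter> S2 \<noteq> {}"
        then obtain s where s: "s \<in> {2*a-1<..<2*b-1}" "s \<in> S2" by blast
        have "2 * ((s+1)/2) + - 1 = s" by (simp add: field_simps)
        with s(2) have "(s+1)/2 \<in> (\<lambda>t. 2 * t + - 1) -` S2" by (simp only: vimage_eq)
        hence "(s+1)/2 \<in> S" by (simp only: S_def Un_iff insert_iff simp_thms)
        moreover have "(s+1)/2 \<in> {a<..<b}" using s(1) by simp
        ultimately show False using ab by blast
      qed
      hence "C1_on (2*a-1) (2*b-1) \<gamma>2" using C2[of "2*a-1" "2*b-1"] ab a by simp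
      hence "C1_on a b (\<lambda>t. \<gamma>2 (2 * t + - 1))" by (rule C1_curve_affine) auto
      thus ?thesis by (rule C1_curve_cong) (use a ab \<sigma>2 in auto)
    qed
    ultimately show "\<exists>S. finite S \<and> (\<forall>a b. 0 \<le> a \<and> a < b \<and> b \<le> 1 \<and> {a<..<b} \<inter> S = {} \<longrightarrow> C1_on a b \<sigma>)"
      by (intro exI[of _ S]) blast
  qed
  have im1: "(\<lambda>t::real. 2 * t + 0) ` {0..1/2} = {0..1}"
    using image_affinity_atLeastAtMost[of 2 0 0 "1/2::real"] by simp
  have im2: "(\<lambda>t::real. 2 * t + - 1) ` {1/2..1} = {0..1}"
    using image_affinity_atLeastAtMost[of 2 "-1" "1/2" "1::real"] by simp
  have "integral {0..1/2} (speed UNIV \<sigma>) + integral {1/2..1} (speed UNIV \<sigma>) = length_of \<sigma>"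
    by (rule integral_speed_split[OF pw']) auto
  moreover have "integral {0..1/2} (speed UNIV \<sigma>) = integral {0..1} (speed UNIV \<gamma>1)"
    by (rule integral_speed_affine[OF pw(1) _ _ im1 _ _ \<sigma>1]) auto
  moreover have "integral {1/2..1} (speed UNIV \<sigma>) = integral {0..1} (speed UNIV \<gamma>2)"
    by (rule integral_speed_affine[OF pw(2) _ _ im2 _ _ \<sigma>2]) auto
  ultimately show "length_of \<sigma> = length_of \<gamma>1 + length_of \<gamma>2"
    by (simp add: piecewise_C1_regular(3)[OF pw(1)] piecewise_C1_regular(3)[OF pw(2)])
qed

text \<open>Coordinate segments are the only curves constructed outright; all others arise by
  reversing, restricting and joining. The C1 property has to be checked in every chart
  \<open>c'\<close>, where the velocity is the image of \<open>b - a\<close> under the derivative of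
  the transition map.\<close>

lemma chart_segment:
  assumes c: "c \<in> A" and seg: "closed_segment a b \<subseteq> snd c ` fst c"
  defines "\<sigma> \<equiv> \<lambda>t. param c (a + t *\<^sub>R (b - a))"
  shows "pw_C1 \<sigma>"
    and "length_of \<sigma> = integral {0..1} (\<lambda>t. qnorm (g c (a + t *\<^sub>R (b - a))) (b - a))"
proof -
  have line: "a + t *\<^sub>R (b - a) \<in> snd c ` fst c" if "t \<in> {0..1}" for t
  proof -
    have "a + t *\<^sub>R (b - a) = (1 - t) *\<^sub>R a + t *\<^sub>R b" by (simp add: algebra_simps)
    thus ?thesis using seg that unfolding closed_segment_def by auto
  qed
  have cont: "continuous_map (top_of_set {0..1}) X \<sigma>"
  proof -
    have "continuous_map (top_of_set {0..1}) (top_of_set (snd c ` fst c)) (\<lambda>t. a + t *\<^sub>R (b - a))"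
      using line by (auto intro!: continuous_intros)
    from continuous_map_compose[OF this param_continuous[OF c]] show ?thesis by (simp add: \<sigma>_def o_def)
  qed
  have \<sigma>_in: "\<sigma> t \<in> fst c" "snd c (\<sigma> t) = a + t *\<^sub>R (b - a)" if "t \<in> {0..1}" for t
    using line[OF that] by (simp_all add: \<sigma>_def param_in chart_param)
  have der: "((snd c \<circ> \<sigma>) has_vector_derivative (b - a)) (at t within {0..1})" if t: "t \<in> {0..1}" for t
  proof (rule has_vector_derivative_transform[OF t])
    show "((\<lambda>t. a + t *\<^sub>R (b - a)) has_vector_derivative (b - a)) (at t within {0..1})"
      by (auto intro!: derivative_eq_intros)
  qed (simp add: \<sigma>_in)
  have ev: "\<forall>\<^sub>F s in at t within {0..1}. \<sigma> s \<in> fst c" if "t \<in> {0..1}" for t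
    by (simp add: eventually_at_filter \<sigma>_in)
  have C1: "C1_on 0 1 \<sigma>"
    unfolding C1_curve_on_def
  proof (intro conjI cont ballI)
    fix c' assume c': "c' \<in> A"
    let ?D = "\<lambda>t. frechet_derivative (transition c c') (at (snd c (\<sigma> t))) (b - a)"
    show "\<exists>D. continuous_on {t\<in>{0..1}. \<sigma> t \<in> fst c'} D \<and>
        (\<forall>t\<in>{0..1}. \<sigma> t \<in> fst c' \<longrightarrow> ((snd c' \<circ> \<sigma>) has_vector_derivative D t) (at t within {0..1}))"
    proof (intro exI[of _ ?D] conjI ballI impI)
      have "continuous_on {t\<in>{0..1}. \<sigma> t \<in> fst c'} (\<lambda>t. snd c (\<sigma> t))"
        by (rule continuous_on_eq[of _ "\<lambda>t. a + t *\<^sub>R (b - a)"]) (auto intro!: continuous_intros simp: \<sigma>_in)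
      thus "continuous_on {t\<in>{0..1}. \<sigma> t \<in> fst c'} ?D"
        by (rule continuous_on_compose2[OF smooth_on_continuous_derivative[OF smooth_transition[OF c c']]])
          (use \<sigma>_in(1) in blast)
      fix t assume t: "t \<in> {0..1}" "\<sigma> t \<in> fst c'"
      show "((snd c' \<circ> \<sigma>) has_vector_derivative ?D t) (at t within {0..1})"
        by (rule chart_change_derivative[where \<gamma> = \<sigma>, OF c c' \<sigma>_in(1)[OF t(1)] t(2) ev[OF t(1)] der[OF t(1)]])
    qed
  qed
  show pw: "pw_C1 \<sigma>"
    unfolding piecewise_C1_curve_def
    using cont C1_curve_subinterval[OF C1] by (intro conjI exI[of _ "{}"]) auto
  have sp: "speed UNIV \<sigma> t = qnorm (g c (a + t *\<^sub>R (b - a))) (b - a)" if t: "t \<in> {0..1} - {0,1}" for t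
  proof -
    have t': "t \<in> {0<..<1}" "t \<in> {0..1}" using t by auto
    have at: "at t within {0..1} = at t" using t' by (simp add: at_within_Icc_at)
    from speed_in_chart[OF C1_regular(1)[OF C1 t'(1)] c \<sigma>_in(1)[OF t'(2)] _ der[OF t'(2), unfolded at]]
    show ?thesis by (simp add: \<sigma>_in(2)[OF t'(2)])
  qed
  show "length_of \<sigma> = integral {0..1} (\<lambda>t. qnorm (g c (a + t *\<^sub>R (b - a))) (b - a))"
    unfolding piecewise_C1_regular(3)[OF pw] by (rule integral_spike[of "{0,1}"]) (auto simp: sp)
qed

lemma chart_segment_length_le:
  assumes c: "c \<in> A" and seg: "closed_segment a b \<subseteq> snd c ` fst c"
    and le: "\<And>z. z \<in> closed_segment a b \<Longrightarrow> qnorm (g c z) (b - a) \<le> B"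
  shows "\<exists>\<gamma>. pw_C1 \<gamma> \<and> \<gamma> 0 = param c a \<and> \<gamma> 1 = param c b \<and> length_of \<gamma> \<le> B"
proof -
  have in_seg: "a + t *\<^sub>R (b - a) \<in> closed_segment a b" if "t \<in> {0..1}" for t
  proof -
    have "a + t *\<^sub>R (b - a) = (1 - t) *\<^sub>R a + t *\<^sub>R b" by (simp add: algebra_simps)
    thus ?thesis using that unfolding closed_segment_def by auto
  qed
  have "continuous_on {0..1} (\<lambda>t. g c (a + t *\<^sub>R (b - a)))"
    by (rule continuous_on_compose2[OF smooth_on_continuous[OF smooth_metric[OF c]]])
      (use in_seg seg in \<open>auto intro!: continuous_intros\<close>)
  hence "(\<lambda>t. qnorm (g c (a + t *\<^sub>R (b - a))) (b - a)) integrable_on {0..1}"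
    by (intro integrable_continuous_real continuous_on_qnorm continuous_on_const)
  hence "integral {0..1} (\<lambda>t. qnorm (g c (a + t *\<^sub>R (b - a))) (b - a)) \<le> integral {0..1::real} (\<lambda>t. B)"
    by (rule integral_le) (use in_seg le in auto)
  thus ?thesis using chart_segment[OF c seg]
    by (intro exI[of _ "\<lambda>t. param c (a + t *\<^sub>R (b - a))"]) auto
qed

lemma curve_length_nonneg:
  assumes "pw_C1 \<gamma>" shows "0 \<le> length_of \<gamma>"
    and "\<And>p q. 0 \<le> p \<Longrightarrow> q \<le> 1 \<Longrightarrow> 0 \<le> integral {p..q} (speed UNIV \<gamma>)"
proof -
  have "continuous_map (top_of_set {0..1}) X \<gamma>" using assms by (simp add: piecewise_C1_curve_def)
  hence in_X: "\<gamma> t \<in> M" if "t \<in> {0..1}" for t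
    using continuous_map_image_subset_topspace[of "top_of_set {0..1}" X \<gamma>] that by auto
  show *: "0 \<le> integral {p..q} (speed UNIV \<gamma>)" if "0 \<le> p" "q \<le> 1" for p q
    by (rule integral_nonneg)
      (use that in \<open>auto intro!: speed_nonneg in_X integrable_on_subinterval[OF piecewise_C1_regular(2)[OF assms]]\<close>)
  show "0 \<le> length_of \<gamma>" using *[of 0 1] by (simp add: piecewise_C1_regular(3)[OF assms])
qed

section \<open>The geodesic distance as a finite metric\<close>

abbreviation "gdist \<equiv> geodesic_dist X A g"

definition joins :: "(real \<Rightarrow> 'a) \<Rightarrow> 'a \<Rightarrow> 'a \<Rightarrow> bool" where
  "joins \<gamma> x y \<longleftrightarrow> pw_C1 \<gamma> \<and> \<gamma> 0 = x \<and> \<gamma> 1 = y"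

lemma joins_rev:
  assumes "joins \<gamma> x y" shows "\<exists>\<gamma>'. joins \<gamma>' y x \<and> length_of \<gamma>' = length_of \<gamma>"
proof -
  have pw: "pw_C1 \<gamma>" using assms by (simp add: joins_def)
  from piecewise_C1_affine[OF pw, of 1 0] show ?thesis
    using assms piecewise_C1_regular(3)[OF pw]
    by (intro exI[of _ "\<lambda>t. \<gamma> ((0 - 1) * t + 1)"]) (auto simp: joins_def)
qed

lemma joins_trans:
  assumes "joins \<gamma>1 x y" "joins \<gamma>2 y z"
  shows "\<exists>\<gamma>'. joins \<gamma>' x z \<and> length_of \<gamma>' = length_of \<gamma>1 + length_of \<gamma>2"
proof -
  have pw: "pw_C1 \<gamma>1" "pw_C1 \<gamma>2" "\<gamma>1 1 = \<gamma>2 0" using assms by (auto simp: joins_def)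
  from piecewise_C1_join[OF pw] show ?thesis
    using assms by (intro exI[of _ "\<lambda>t. if t \<le> 1/2 then \<gamma>1 (2 * t + 0) else \<gamma>2 (2 * t + - 1)"]) (auto simp: joins_def)
qed

lemma joins_in_space:
  assumes "joins \<gamma> x y" "t \<in> {0..1}" shows "\<gamma> t \<in> M"
proof -
  have "continuous_map (top_of_set {0..1}) X \<gamma>" using assms by (simp add: joins_def piecewise_C1_curve_def)
  from continuous_map_image_subset_topspace[OF this] assms(2) show ?thesis by auto
qed

lemma geodesic_dist_alt: "gdist x y = Inf {length_of \<gamma> |\<gamma>. joins \<gamma> x y}"
  by (simp add: geodesic_dist_def joins_def)

lemma gdist_le: "joins \<gamma> x y \<Longrightarrow> gdist x y \<le> length_of \<gamma>"
  unfolding geodesic_dist_alt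
  by (rule cInf_lower) (auto intro!: bdd_belowI[of _ 0] curve_length_nonneg(1) simp: joins_def)

lemma chart_ball:
  assumes "p \<in> M"
  obtains c r where "c \<in> A" "p \<in> fst c" "0 < r" "cball (snd c p) r \<subseteq> snd c ` fst c"
proof -
  obtain c where c: "c \<in> A" "p \<in> fst c" using assms cover by blast
  hence "snd c p \<in> snd c ` fst c" by simp
  with open_chart_image[OF c(1)] obtain r where "0 < r" "cball (snd c p) r \<subseteq> snd c ` fst c"
    using open_contains_cball by metis
  thus thesis using that c by blast
qed

lemma segment_joins:
  assumes "c \<in> A" "closed_segment a b \<subseteq> snd c ` fst c"
  shows "\<exists>\<gamma>. joins \<gamma> (param c a) (param c b)"
  using chart_segment(1)[OF assms] by (intro exI) (auto simp: joins_def)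

lemma joins_refl:
  assumes "x \<in> M" shows "\<exists>\<gamma>. joins \<gamma> x x \<and> length_of \<gamma> = 0"
proof -
  obtain c where c: "c \<in> A" "x \<in> fst c" using assms cover by blast
  have seg: "closed_segment (snd c x) (snd c x) \<subseteq> snd c ` fst c" using c by simp
  from chart_segment_length_le[OF c(1) seg, of 0] obtain \<gamma>
    where \<gamma>: "joins \<gamma> x x" "length_of \<gamma> \<le> 0"
    using param_chart[OF c] by (auto simp: joins_def qnorm_def)
  thus ?thesis using curve_length_nonneg(1)[of \<gamma>] by (intro exI[of _ \<gamma>]) (auto simp: joins_def)
qed

end

locale compact_riemannian = riemannian X A g
  for X :: "'a topology" and A :: "('a, 'n::finite) chart set" and g :: "('a, 'n) metric_components" +
  assumes compact: "compact_space X" and connected: "connected_space X"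
begin

text \<open>The set of points joined to x is open because coordinate balls are joined to their
  centres, and its complement is open by reversing such curves. This keeps the infimum in the
  distance from running over the empty set.\<close>

lemma joined:
  assumes x: "x \<in> M" and y: "y \<in> M"
  shows "\<exists>\<gamma>. joins \<gamma> x y"
proof -
  define J where "J = {y \<in> M. \<exists>\<gamma>. joins \<gamma> x y}"
  have nbhd: "\<exists>U. openin X U \<and> z \<in> U \<and> (\<forall>w\<in>U. \<exists>\<gamma>. joins \<gamma> z w)" if z: "z \<in> M" for z
  proof -
    obtain c r where c: "c \<in> A" "z \<in> fst c" "0 < r" "cball (snd c z) r \<subseteq> snd c ` fst c" using chart_ball[OF z] .
    have sub: "ball (snd c z) r \<subseteq> snd c ` fst c" using c(4) ball_subset_cball by blast
    show ?thesis
    proof (intro exI[of _ "param c ` ball (snd c z) r"] conjI ballI)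
      show "openin X (param c ` ball (snd c z) r)" by (rule openin_param_image[OF c(1) sub]) simp
      show "z \<in> param c ` ball (snd c z) r"
        using param_chart[OF c(1,2)] c(3) by (intro image_eqI[of _ _ "snd c z"]) auto
      fix w assume "w \<in> param c ` ball (snd c z) r"
      then obtain b where b: "b \<in> ball (snd c z) r" "w = param c b" by blast
      have "closed_segment (snd c z) b \<subseteq> ball (snd c z) r"
        using b c(3) by (intro closed_segment_subset) auto
      from segment_joins[OF c(1) order_trans[OF this sub]] show "\<exists>\<gamma>. joins \<gamma> z w"
        using param_chart[OF c(1,2)] b(2) by simp
    qed
  qed
  have "openin X J"
  proof (subst openin_subopen, intro ballI)
    fix z assume z: "z \<in> J"
    then obtain U where U: "openin X U" "z \<in> U" "\<forall>w\<in>U. \<exists>\<gamma>. joins \<gamma> z w" using nbhd by (auto simp: J_def)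
    have "U \<subseteq> J"
    proof
      fix w assume w: "w \<in> U"
      obtain \<gamma>1 \<gamma>2 where "joins \<gamma>1 x z" "joins \<gamma>2 z w" using z U(3) w by (auto simp: J_def)
      from joins_trans[OF this] show "w \<in> J" using openin_subset[OF U(1)] w by (auto simp: J_def)
    qed
    thus "\<exists>T. openin X T \<and> z \<in> T \<and> T \<subseteq> J" using U by blast
  qed
  moreover have "closedin X J"
    unfolding closedin_def
  proof (intro conjI)
    show "openin X (M - J)"
    proof (subst openin_subopen, intro ballI)
      fix z assume z: "z \<in> M - J"
      then obtain U where U: "openin X U" "z \<in> U" "\<forall>w\<in>U. \<exists>\<gamma>. joins \<gamma> z w" using nbhd by auto
      have "U \<subseteq> M - J"
      proof
        fix w assume w: "w \<in> U"
        have "w \<notin> J"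
        proof
          assume "w \<in> J"
          then obtain \<gamma>1 where g1: "joins \<gamma>1 x w" by (auto simp: J_def)
          obtain \<gamma>2 where "joins \<gamma>2 z w" using U(3) w by blast
          from joins_rev[OF this] obtain \<gamma>3 where "joins \<gamma>3 w z" by blast
          from joins_trans[OF g1 this] have "z \<in> J" using z by (auto simp: J_def)
          thus False using z by simp
        qed
        thus "w \<in> M - J" using openin_subset[OF U(1)] w by blast
      qed
      thus "\<exists>T. openin X T \<and> z \<in> T \<and> T \<subseteq> M - J" using U by blast
    qed
  qed (auto simp: J_def)
  moreover have "x \<in> J" using joins_refl[OF x] x by (auto simp: J_def)
  ultimately have "J = M" using connected unfolding connected_space_clopen_in by blast
  thus ?thesis using y by (auto simp: J_def)
qed

lemma gdist_nonneg:
  assumes "x \<in> M" "y \<in> M" shows "0 \<le> gdist x y"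
  unfolding geodesic_dist_alt
  by (rule cInf_greatest) (use joined[OF assms] in \<open>auto intro!: curve_length_nonneg(1) simp: joins_def\<close>)

lemma gdist_approx:
  assumes "x \<in> M" "y \<in> M" "gdist x y < e"
  shows "\<exists>\<gamma>. joins \<gamma> x y \<and> length_of \<gamma> < e"
proof -
  have "Inf {length_of \<gamma> |\<gamma>. joins \<gamma> x y} < e" using assms(3) by (simp add: geodesic_dist_alt)
  from cInf_lessD[OF _ this] joined[OF assms(1,2)] show ?thesis by auto
qed

lemma gdist_commute: "gdist x y = gdist y x"
proof -
  have "{length_of \<gamma> |\<gamma>. joins \<gamma> x y} \<subseteq> {length_of \<gamma> |\<gamma>. joins \<gamma> y x}" for x y
  proof
    fix l assume "l \<in> {length_of \<gamma> |\<gamma>. joins \<gamma> x y}"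
    then obtain \<gamma> where "joins \<gamma> x y" "l = length_of \<gamma>" by blast
    with joins_rev[OF this(1)] obtain \<gamma>' where "joins \<gamma>' y x" "l = length_of \<gamma>'" by auto
    thus "l \<in> {length_of \<gamma> |\<gamma>. joins \<gamma> y x}" by blast
  qed
  from this[of x y] this[of y x] show ?thesis by (simp add: geodesic_dist_alt)
qed

lemma gdist_refl: "x \<in> M \<Longrightarrow> gdist x x = 0"
  using joins_refl[of x] gdist_le gdist_nonneg[of x x] by force

lemma gdist_triangle:
  assumes "x \<in> M" "y \<in> M" "z \<in> M"
  shows "gdist x z \<le> gdist x y + gdist y z"
proof (rule field_le_epsilon)
  fix e :: real assume e: "0 < e"
  obtain \<gamma>1 where 1: "joins \<gamma>1 x y" "length_of \<gamma>1 < gdist x y + e/2"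
    using gdist_approx[OF assms(1,2), of "gdist x y + e/2"] e by auto
  obtain \<gamma>2 where 2: "joins \<gamma>2 y z" "length_of \<gamma>2 < gdist y z + e/2"
    using gdist_approx[OF assms(2,3), of "gdist y z + e/2"] e by auto
  obtain \<gamma>3 where "joins \<gamma>3 x z" "length_of \<gamma>3 = length_of \<gamma>1 + length_of \<gamma>2"
    using joins_trans[OF 1(1) 2(1)] by blast
  with gdist_le[OF this(1)] 1 2 show "gdist x z \<le> gdist x y + gdist y z + e" by simp
qed

lemma gdist_subcurve:
  assumes j: "joins \<gamma> x y" and t: "0 \<le> p" "p \<le> q" "q \<le> 1"
  shows "gdist (\<gamma> p) (\<gamma> q) \<le> integral {p..q} (speed UNIV \<gamma>)"
proof (cases "p = q")
  case True
  thus ?thesis using gdist_refl joins_in_space[OF j] t by simp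
next
  case False
  have pw: "pw_C1 \<gamma>" using j by (simp add: joins_def)
  note a = piecewise_C1_affine[OF pw, of p q]
  have "joins (\<lambda>t. \<gamma> ((q - p) * t + p)) (\<gamma> p) (\<gamma> q)" using a(1) t False by (simp add: joins_def)
  from gdist_le[OF this] a(2) t False show ?thesis by simp
qed

end

section \<open>The geodesic distance in a chart\<close>

lemma cauchy_schwarz_form:
  fixes H :: "real^'n^'n"
  assumes sym: "transpose H = H" and pos: "\<And>v. v \<noteq> 0 \<Longrightarrow> 0 < v \<bullet> (H *v v)"
  shows "\<bar>v \<bullet> (H *v w)\<bar> \<le> qnorm H v * qnorm H w"
proof (cases "w = 0")
  case True
  thus ?thesis by (simp add: qnorm_def)
next
  case False
  define Q where "Q u = u \<bullet> (H *v u)" for u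
  define B where "B = v \<bullet> (H *v w)"
  have nonneg: "0 \<le> Q u" for u using pos[of u] by (cases "u = 0") (auto simp: Q_def)
  have symB: "w \<bullet> (H *v v) = B"
  proof -
    have "w \<bullet> (H *v v) = (w v* H) \<bullet> v" by (simp only: dot_lmul_matrix)
    also have "w v* H = H *v w" using transpose_matrix_vector[of H w] sym by simp
    finally show ?thesis by (simp add: B_def inner_commute)
  qed
  have "Q (Q w *\<^sub>R v - B *\<^sub>R w) = Q w * (Q w * Q v - B\<^sup>2)"
    unfolding Q_def
    by (simp add: matrix_vector_mult_diff_distrib matrix_vector_mult_scaleR inner_diff_left inner_diff_right
        symB B_def[symmetric] power2_eq_square algebra_simps)
  hence "0 \<le> Q w * (Q w * Q v - B\<^sup>2)" using nonneg by metis
  moreover have "0 < Q w" using pos[OF False] by (simp add: Q_def)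
  ultimately have "B\<^sup>2 \<le> Q v * Q w" by (simp add: zero_le_mult_iff mult.commute)
  hence "sqrt (B\<^sup>2) \<le> sqrt (Q v * Q w)" by (rule real_sqrt_le_mono)
  thus ?thesis by (simp add: real_sqrt_mult qnorm_def Q_def B_def)
qed

text \<open>Every matrix on the segment from the identity to \<open>H\<close> is positive definite,
  hence invertible. If \<open>det H\<close> were not positive, the determinant would have to vanish
  on the way from its value 1 at the identity.\<close>

lemma det_pos_of_positive_definite:
  fixes H :: "real^'n^'n"
  assumes pos: "\<And>v. v \<noteq> 0 \<Longrightarrow> 0 < v \<bullet> (H *v v)"
  shows "0 < det H"
proof (rule ccontr)
  assume neg: "\<not> 0 < det H"
  define P where "P t = (1 - t) *\<^sub>R mat 1 + t *\<^sub>R H" for t :: real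
  have "continuous_on {0..1} (\<lambda>t. det (P t))"
    unfolding det_def P_def by (intro continuous_intros)
  moreover have "det (P 0) = 1" "det (P 1) = det H" by (simp_all add: P_def)
  ultimately obtain t where t: "0 \<le> t" "t \<le> 1" "det (P t) = 0"
    using IVT2'[of "\<lambda>t. det (P t)" 1 0 0] neg by auto
  hence "\<not> invertible (P t)" by (simp add: invertible_det_nz)
  then obtain v where v: "v \<noteq> 0" "P t *v v = 0"
    by (metis invertible_left_inverse matrix_left_invertible_ker)
  have "v \<bullet> (P t *v v) = (1 - t) * (v \<bullet> v) + t * (v \<bullet> (H *v v))"
    by (simp add: P_def matrix_vector_mult_add_rdistrib scaleR_matrix_vector_assoc[symmetric] inner_add_right)
  moreover have "0 < (1 - t) * (v \<bullet> v) + t * (v \<bullet> (H *v v))"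
  proof (cases "t = 1")
    case False
    thus ?thesis using t v pos[OF v(1)] by (intro add_pos_nonneg) auto
  qed (use pos[OF v(1)] in simp)
  ultimately show False using v by simp
qed

lemma bounded_bilinear_matrix_vector_mult:
  "bounded_bilinear (\<lambda>(H::real^'n^'m) v. H *v v)"
  unfolding bilinear_conv_bounded_bilinear[symmetric] bilinear_def
  by (auto intro!: linearI simp: matrix_vector_right_distrib matrix_vector_mult_add_rdistrib
      matrix_vector_mult_scaleR scaleR_matrix_vector_assoc)

text \<open>\<open>Ck_on\<close> gives continuity of the derivative only in each fixed direction.
  Bounds along the finitely many basis vectors add up to a bound for the operator norm, and the mean
  value inequality applies on the convex ball.\<close>

lemma smooth_on_lipschitz_cball:
  fixes f :: "'a::euclidean_space \<Rightarrow> 'b::real_normed_vector"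
  assumes f: "smooth_on S f" and S: "open S" "cball p r \<subseteq> S"
  shows "\<exists>B\<ge>0. \<forall>x\<in>cball p r. \<forall>y\<in>cball p r. norm (f x - f y) \<le> B * norm (x - y)"
proof -
  let ?D = "\<lambda>x. frechet_derivative f (at x)"
  have "\<exists>B\<ge>0. \<forall>x\<in>cball p r. norm (?D x b) \<le> B" for b
  proof -
    have "continuous_on (cball p r) (\<lambda>x. ?D x b)"
      by (rule continuous_on_subset[OF smooth_on_continuous_derivative[OF f] S(2)])
    hence "bounded ((\<lambda>x. ?D x b) ` cball p r)" by (intro compact_imp_bounded compact_continuous_image) auto
    then obtain B where "\<forall>x\<in>cball p r. norm (?D x b) \<le> B" unfolding bounded_iff by auto
    thus ?thesis by (intro exI[of _ "max B 0"]) auto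
  qed
  then obtain B where B: "\<And>b. 0 \<le> B b" "\<And>b x. x \<in> cball p r \<Longrightarrow> norm (?D x b) \<le> B b" by metis
  have der: "(f has_derivative ?D x) (at x)" if "x \<in> cball p r" for x
    using smooth_on_differentiable[OF f] S(2) that by (auto simp: frechet_derivative_works[symmetric])
  have "norm (f x - f y) \<le> (\<Sum>b\<in>Basis. B b) * norm (x - y)" if "x \<in> cball p r" "y \<in> cball p r" for x y
  proof (rule differentiable_bound[OF convex_cball _ _ that])
    fix z assume z: "z \<in> cball p r"
    show "(f has_derivative ?D z) (at z within cball p r)" by (rule has_derivative_at_withinI[OF der[OF z]])
    have lin: "linear (?D z)" using has_derivative_linear[OF der[OF z]] .
    show "onorm (?D z) \<le> (\<Sum>b\<in>Basis. B b)"
    proof (rule onorm_le)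
      fix v :: 'a
      have "?D z v = ?D z (\<Sum>b\<in>Basis. (v \<bullet> b) *\<^sub>R b)" by (simp only: euclidean_representation)
      also have "\<dots> = (\<Sum>b\<in>Basis. (v \<bullet> b) *\<^sub>R ?D z b)" by (simp add: linear_sum[OF lin] linear_scale[OF lin])
      finally have eq: "?D z v = (\<Sum>b\<in>Basis. (v \<bullet> b) *\<^sub>R ?D z b)" .
      have "norm (?D z v) \<le> (\<Sum>b\<in>Basis. norm ((v \<bullet> b) *\<^sub>R ?D z b))" unfolding eq by (rule norm_sum)
      also have "\<dots> \<le> (\<Sum>b\<in>Basis. norm v * B b)"
        using B z by (intro sum_mono) (auto intro!: mult_mono Basis_le_norm)
      finally show "norm (?D z v) \<le> (\<Sum>b\<in>Basis. B b) * norm v" by (simp add: sum_distrib_left sum_distrib_right mult.commute)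
    qed
  qed
  thus ?thesis using B by (intro exI[of _ "\<Sum>b\<in>Basis. B b"]) (auto intro: sum_nonneg)
qed

text \<open>By homogeneity only unit vectors matter, and on the compact product of the ball with the
  unit sphere the continuous function \<open>qnorm\<close> attains a positive minimum and a
  maximum.\<close>

lemma uniform_form_bounds:
  fixes H :: "'a::euclidean_space \<Rightarrow> real^'n^'n"
  assumes cont: "continuous_on (cball p r) H" and pos: "\<And>x v. x \<in> cball p r \<Longrightarrow> v \<noteq> 0 \<Longrightarrow> 0 < v \<bullet> (H x *v v)"
  shows "\<exists>L\<ge>1. \<forall>x\<in>cball p r. \<forall>v. norm v \<le> L * qnorm (H x) v \<and> qnorm (H x) v \<le> L * norm v"
proof (cases "0 \<le> r")
  case False
  thus ?thesis by (intro exI[of _ 1]) auto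
next
  case True
  let ?S = "cball p r \<times> sphere (0::real^'n) 1"
  let ?q = "\<lambda>z. qnorm (H (fst z)) (snd z)"
  have comp: "compact ?S" by (intro compact_Times) auto
  have cq: "continuous_on ?S ?q"
    by (intro continuous_on_qnorm continuous_on_compose2[OF cont] continuous_intros) auto
  have ne: "?S \<noteq> {}" using True by (auto simp: sphere_eq_empty)
  obtain z0 where z0: "z0 \<in> ?S" "\<And>z. z \<in> ?S \<Longrightarrow> ?q z0 \<le> ?q z" using continuous_attains_inf[OF comp ne cq] by blast
  obtain z1 where z1: "z1 \<in> ?S" "\<And>z. z \<in> ?S \<Longrightarrow> ?q z \<le> ?q z1" using continuous_attains_sup[OF comp ne cq] by blast
  define m where "m = ?q z0"
  have "snd z0 \<noteq> 0" "fst z0 \<in> cball p r" using z0(1) by (auto simp: mem_Times_iff)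
  hence m: "0 < m" using pos[of "fst z0" "snd z0"] by (simp add: m_def qnorm_def)
  define L where "L = max (max 1 (1 / m)) (?q z1)"
  have "norm v \<le> L * qnorm (H x) v \<and> qnorm (H x) v \<le> L * norm v" if x: "x \<in> cball p r" for x v
  proof (cases "v = 0")
    case True
    thus ?thesis by (simp add: qnorm_def)
  next
    case False
    define u where "u = (1 / norm v) *\<^sub>R v"
    have u: "(x, u) \<in> ?S" using x False by (simp add: u_def)
    have eq: "qnorm (H x) v = norm v * qnorm (H x) u"
      using False qnorm_scaleR[of "H x" "norm v" u] by (simp add: u_def)
    have "1 \<le> L * m"
      using mult_right_mono[of "1/m" L m] m by (simp add: L_def)
    also have "\<dots> \<le> L * qnorm (H x) u" using z0(2)[OF u] by (intro mult_left_mono) (auto simp: m_def L_def)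
    finally have 1: "norm v * 1 \<le> norm v * (L * qnorm (H x) u)" by (intro mult_left_mono) auto
    have "qnorm (H x) u \<le> L" using z1(2)[OF u] by (simp add: L_def)
    hence "norm v * qnorm (H x) u \<le> norm v * L" by (intro mult_left_mono) auto
    with 1 show ?thesis unfolding eq by (simp add: mult_ac)
  qed
  moreover have "1 \<le> L" by (simp add: L_def)
  ultimately show ?thesis by blast
qed

section \<open>Metric bounds in a coordinate ball and lower bounds for lengths\<close>

context riemannian
begin

lemma metric_bounds:
  assumes c: "c \<in> A" and sub: "cball p r \<subseteq> snd c ` fst c" and r: "0 < r"
  shows "\<exists>L\<ge>1. \<exists>H\<ge>0. \<forall>x\<in>cball p r.
    (\<forall>v. norm v \<le> L * qnorm (g c x) v \<and> qnorm (g c x) v \<le> L * norm v) \<and>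
    1 \<le> L * sqrt (det (g c x)) \<and> sqrt (det (g c x)) \<le> L \<and>
    (\<forall>y\<in>cball p r. \<forall>v. qnorm (g c y) v \<le> (1 + H * norm (y - x)) * qnorm (g c x) v)"
    (is "\<exists>L\<ge>1. ?P L")
proof -
  have cont: "continuous_on (cball p r) (g c)"
    by (rule continuous_on_subset[OF smooth_on_continuous[OF smooth_metric[OF c]] sub])
  have pos: "0 < v \<bullet> (g c x *v v)" if "x \<in> cball p r" "v \<noteq> 0" for x v
    using metric_pos[OF c _ that(2)] that(1) sub by blast
  obtain L0 where L0: "1 \<le> L0" "\<And>x v. x \<in> cball p r \<Longrightarrow> norm v \<le> L0 * qnorm (g c x) v"
    "\<And>x v. x \<in> cball p r \<Longrightarrow> qnorm (g c x) v \<le> L0 * norm v"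
    using uniform_form_bounds[OF cont pos] by blast
  let ?d = "\<lambda>x. sqrt (det (g c x))"
  have dpos: "0 < ?d x" if "x \<in> cball p r" for x using det_pos_of_positive_definite[of "g c x"] pos[OF that] by simp
  have cd: "continuous_on (cball p r) ?d" unfolding det_def
    by (intro continuous_intros continuous_on_component cont)
  have ne: "cball p r \<noteq> {}" using r by auto
  obtain z0 where z0: "z0 \<in> cball p r" "\<And>z. z \<in> cball p r \<Longrightarrow> ?d z0 \<le> ?d z"
    using continuous_attains_inf[OF compact_cball ne cd] by blast
  obtain z1 where z1: "z1 \<in> cball p r" "\<And>z. z \<in> cball p r \<Longrightarrow> ?d z \<le> ?d z1"
    using continuous_attains_sup[OF compact_cball ne cd] by blast
  define L where "L = max L0 (max (1 / ?d z0) (?d z1))"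
  have L: "L0 \<le> L" "1 / ?d z0 \<le> L" "?d z1 \<le> L" by (auto simp: L_def)
  obtain B where B: "0 \<le> B" "\<And>x y. x \<in> cball p r \<Longrightarrow> y \<in> cball p r \<Longrightarrow> norm (g c x - g c y) \<le> B * norm (x - y)"
    using smooth_on_lipschitz_cball[OF smooth_metric[OF c] open_chart_image[OF c] sub] by blast
  obtain K where K: "0 < K" "\<And>(H::real^'n^'n) v. norm (H *v v) \<le> norm H * norm v * K"
    using bounded_bilinear.pos_bounded[OF bounded_bilinear_matrix_vector_mult] by blast
  \<comment> \<open>\<open>B\<close> is the Lipschitz constant of \<open>g\<close> and
    \<open>K\<close> the bound for the product of matrix and vector. The factor
    \<open>L0\<^sup>2\<close> replaces the squared Euclidean norm of \<open>v\<close> by the form at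
    \<open>x\<close>, which turns the additive error into a multiplicative one.\<close>
  define H where "H = B * K * L0\<^sup>2"
  have H: "0 \<le> H" using B K by (simp add: H_def)
  have lip: "qnorm (g c y) v \<le> (1 + H * norm (y - x)) * qnorm (g c x) v"
    if xy: "x \<in> cball p r" "y \<in> cball p r" for x y v
  proof -
    let ?Q = "\<lambda>x. v \<bullet> (g c x *v v)"
    have Q2: "?Q x = (qnorm (g c x) v)\<^sup>2" using pos[OF xy(1), of v] by (cases "v = 0") (auto simp: qnorm_def)
    have q0: "0 \<le> qnorm (g c x) v" using Q2 pos[OF xy(1), of v] by (cases "v = 0") (auto simp: qnorm_def)
    have "?Q y - ?Q x = v \<bullet> ((g c y - g c x) *v v)" by (simp add: matrix_vector_mult_diff_rdistrib inner_diff_right)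
    also have "\<dots> \<le> norm v * norm ((g c y - g c x) *v v)" by (rule norm_cauchy_schwarz)
    also have "\<dots> \<le> norm v * (norm (g c y - g c x) * norm v * K)" by (intro mult_left_mono K(2)) auto
    also have "\<dots> = K * norm (g c y - g c x) * (norm v)\<^sup>2" by (simp add: power2_eq_square mult_ac)
    also have "\<dots> \<le> K * (B * norm (y - x)) * (L0 * qnorm (g c x) v)\<^sup>2"
      using K B(1) B(2)[OF xy(2,1)] L0(2)[OF xy(1), of v] by (intro mult_mono power_mono mult_left_mono) auto
    also have "\<dots> = H * norm (y - x) * ?Q x" by (simp add: H_def Q2 power_mult_distrib mult_ac)
    finally have "?Q y \<le> (1 + H * norm (y - x)) * ?Q x" by (simp add: algebra_simps)
    \<comment> \<open>The factor is weakened to its square so that the root can be taken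
      exactly.\<close>
    also have "\<dots> \<le> (1 + H * norm (y - x))\<^sup>2 * ?Q x"
    proof (intro mult_right_mono)
      have "1 \<le> 1 + H * norm (y - x)" using H by simp
      thus "1 + H * norm (y - x) \<le> (1 + H * norm (y - x))\<^sup>2" using self_le_power[of "1 + H * norm (y - x)" 2] by simp
    qed (simp add: Q2)
    also have "\<dots> = ((1 + H * norm (y - x)) * qnorm (g c x) v)\<^sup>2" by (simp add: Q2 power_mult_distrib)
    finally have "sqrt (?Q y) \<le> sqrt (((1 + H * norm (y - x)) * qnorm (g c x) v)\<^sup>2)" by (rule real_sqrt_le_mono)
    also have "\<dots> = (1 + H * norm (y - x)) * qnorm (g c x) v" using H q0 by (intro real_sqrt_abs[THEN trans] abs_of_nonneg) auto
    finally show ?thesis by (simp add: qnorm_def)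
  qed
  have qn: "0 \<le> qnorm (g c x) v" if "x \<in> cball p r" for x v using pos[OF that, of v] by (cases "v = 0") (auto simp: qnorm_def)
  show ?thesis
  proof (rule exI[of _ L], rule conjI)
    show "1 \<le> L" using L L0 by simp
    show "?P L"
    proof (rule exI[of _ H], intro conjI ballI allI)
    fix x v assume x: "x \<in> cball p r"
    show "norm v \<le> L * qnorm (g c x) v" using L0(2)[OF x, of v] mult_right_mono[OF L(1) qn[OF x, of v]] by linarith
    show "qnorm (g c x) v \<le> L * norm v" using L0(3)[OF x, of v] mult_right_mono[OF L(1) norm_ge_zero[of v]] by linarith
    show "sqrt (det (g c x)) \<le> L" using z1(2)[OF x] L by linarith
    have "1 = (1 / ?d z0) * ?d z0" using dpos[OF z0(1)] by simp
    also have "\<dots> \<le> L * ?d x" using L z0(2)[OF x] dpos[OF z0(1)] L0(1) by (intro mult_mono) auto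
    finally show "1 \<le> L * sqrt (det (g c x))" .
    qed (use H lip in auto)
  qed
qed

text \<open>\<open>s\<close> is the first time outside the open coordinate ball, if there is one.
  The closed ball has a compact image, which is closed because \<open>X\<close> is Hausdorff; so at
  time \<open>s\<close> the curve is still in the chart, on the sphere, and cannot have left the
  domain of the chart before.\<close>

lemma exit_time:
  assumes j: "joins \<gamma> (param c a) y" and c: "c \<in> A" and sub: "cball a \<rho> \<subseteq> snd c ` fst c" and \<rho>: "0 < \<rho>"
  shows "\<exists>s\<in>{0..1}. (\<forall>t\<in>{0..s}. \<gamma> t \<in> fst c \<and> snd c (\<gamma> t) \<in> cball a \<rho>) \<and>
    (s = 1 \<or> norm (snd c (\<gamma> s) - a) = \<rho>)"
proof -
  have cont: "continuous_map (top_of_set {0..1}) X \<gamma>" using j by (simp add: joins_def piecewise_C1_curve_def)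
  define K where "K = param c ` cball a \<rho>"
  have bsub: "ball a \<rho> \<subseteq> snd c ` fst c" using sub ball_subset_cball by blast
  have aU: "a \<in> snd c ` fst c" using bsub \<rho> by auto
  have K_eq: "K = {p\<in>fst c. snd c p \<in> cball a \<rho>}" unfolding K_def by (rule param_image_eq[OF c sub])
  have "compactin X K" unfolding K_def
    by (rule image_compactin[OF _ param_continuous[OF c]]) (simp add: compactin_subtopology sub)
  hence "closedin X K" by (rule compactin_imp_closedin[OF Hausdorff])
  hence "closedin (top_of_set {0..1}) {t \<in> topspace (top_of_set {0..1}). \<gamma> t \<in> K}"
    by (rule closedin_continuous_map_preimage[OF cont])
  hence T: "closed {t\<in>{0..1}. \<gamma> t \<in> K}" by (auto intro: closedin_closed_trans)
  define E where "E = {t\<in>{0..1}. \<gamma> t \<in> param c ` ball a \<rho>}"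
  have E_eq: "E = {t\<in>{0..1}. \<gamma> t \<in> fst c \<and> snd c (\<gamma> t) \<in> ball a \<rho>}"
    unfolding E_def param_image_eq[OF c bsub] by auto
  have "openin (top_of_set {0..1}) {t \<in> topspace (top_of_set {0..1}). \<gamma> t \<in> param c ` ball a \<rho>}"
    by (rule openin_continuous_map_preimage[OF cont openin_param_image[OF c bsub]]) simp
  hence E_open: "openin (top_of_set {0..1}) E" by (simp add: E_def)
  show ?thesis
  proof (cases "E = {0..1}")
    case True
    have "\<gamma> t \<in> fst c \<and> snd c (\<gamma> t) \<in> cball a \<rho>" if "t \<in> {0..1}" for t
    proof -
      have "t \<in> E" using True that by simp
      thus ?thesis by (auto simp: E_eq)
    qed
    thus ?thesis by (intro bexI[of _ 1]) auto
  next
    case False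
    define C where "C = {0..1} - E"
    have "closedin (top_of_set {0..1}) C" using closedin_diff[OF closedin_topspace E_open] by (simp add: C_def)
    hence "compact C" using closedin_compact compact_Icc by blast
    moreover have "C \<noteq> {}" using False by (auto simp: C_def E_def)
    ultimately obtain s where s: "s \<in> C" "\<And>t. t \<in> C \<Longrightarrow> s \<le> t" using compact_attains_inf by metis
    have s01: "s \<in> {0..1}" using s by (simp add: C_def)
    have "0 \<in> E" using j param_in[OF aU] chart_param[OF aU] \<rho> by (simp add: E_eq joins_def)
    hence "s \<noteq> 0" using s by (auto simp: C_def)
    hence s0: "0 < s" using s01 by simp
    have lt: "t \<in> E" if "0 \<le> t" "t < s" for t
      using s(2)[of t] that s01 by (auto simp: C_def)
    have sub': "{0..<s} \<subseteq> {t\<in>{0..1}. \<gamma> t \<in> K}"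
    proof
      fix t assume "t \<in> {0..<s}"
      hence "t \<in> E" using lt by simp
      thus "t \<in> {t\<in>{0..1}. \<gamma> t \<in> K}" by (auto simp: E_eq K_eq)
    qed
    have "closure {0..<s} \<subseteq> {t\<in>{0..1}. \<gamma> t \<in> K}" by (rule closure_minimal[OF sub' T])
    hence inK: "{0..s} \<subseteq> {t\<in>{0..1}. \<gamma> t \<in> K}" using s0 by simp
    have sK: "\<gamma> s \<in> fst c" "snd c (\<gamma> s) \<in> cball a \<rho>" using inK s0 by (auto simp: K_eq subset_iff)
    have "s \<notin> E" using s by (simp add: C_def)
    hence "norm (snd c (\<gamma> s) - a) = \<rho>" using sK s01 by (auto simp: E_eq dist_norm norm_minus_commute)
    moreover have "\<forall>t\<in>{0..s}. \<gamma> t \<in> fst c \<and> snd c (\<gamma> t) \<in> cball a \<rho>" using inK by (auto simp: K_eq)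
    ultimately show ?thesis using s01 by blast
  qed
qed

text \<open>The fundamental theorem of calculus for \<open>e \<bullet> snd c (\<gamma> t)\<close>,
  whose derivative is at most \<kappa> times the speed.\<close>

lemma functional_le_length:
  assumes pw: "pw_C1 \<gamma>" and c: "c \<in> A" and s: "0 \<le> s" "s \<le> 1"
    and inc: "\<And>t. t \<in> {0..s} \<Longrightarrow> \<gamma> t \<in> fst c"
    and le: "\<And>t v. t \<in> {0..s} \<Longrightarrow> e \<bullet> v \<le> \<kappa> * qnorm (g c (snd c (\<gamma> t))) v"
  shows "e \<bullet> (snd c (\<gamma> s) - snd c (\<gamma> 0)) \<le> \<kappa> * integral {0..s} (speed UNIV \<gamma>)"
proof -
  have cont: "continuous_map (top_of_set {0..1}) X \<gamma>" using pw by (simp add: piecewise_C1_curve_def)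
  have "continuous_map (top_of_set {0..s}) X \<gamma>"
    by (rule continuous_map_from_subtopology_mono[OF cont]) (use s in auto)
  hence "continuous_map (top_of_set {0..s}) (subtopology X (fst c)) \<gamma>"
    by (rule continuous_map_into_subtopology) (use inc in auto)
  from continuous_map_compose[OF this chart_continuous[OF c]]
  have contf: "continuous_on {0..s} (snd c \<circ> \<gamma>)" by simp
  obtain S where S: "finite S" "\<And>t. t \<in> {0..1} - S \<Longrightarrow> t \<in> {0<..<1} \<and> regular UNIV \<gamma> t"
    using piecewise_C1_regular(1)[OF pw] by blast
  \<comment> \<open>The fundamental theorem used here admits a finite exceptional set. On it
    \<open>f'\<close> gets the value that makes the comparison with the speed hold
    trivially.\<close>
  define f' where "f' t = (if t \<in> S then \<kappa> * speed UNIV \<gamma> t else e \<bullet> vector_derivative (snd c \<circ> \<gamma>) (at t))" for t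
  have D: "((snd c \<circ> \<gamma>) has_vector_derivative vector_derivative (snd c \<circ> \<gamma>) (at t)) (at t)"
    and sp: "speed UNIV \<gamma> t = qnorm (g c (snd c (\<gamma> t))) (vector_derivative (snd c \<circ> \<gamma>) (at t))"
    if t: "t \<in> {0..s} - S" for t
  proof -
    have reg: "regular UNIV \<gamma> t" using S(2)[of t] t s by auto
    thus D: "((snd c \<circ> \<gamma>) has_vector_derivative vector_derivative (snd c \<circ> \<gamma>) (at t)) (at t)"
      using inc[of t] t c by (auto simp: regular_def vector_derivative_works[symmetric])
    show "speed UNIV \<gamma> t = qnorm (g c (snd c (\<gamma> t))) (vector_derivative (snd c \<circ> \<gamma>) (at t))"
      by (rule speed_in_chart[OF reg c _ _ D]) (use inc[of t] t in auto)
  qed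
  have "(f' has_integral (e \<bullet> (snd c \<circ> \<gamma>) s - e \<bullet> (snd c \<circ> \<gamma>) 0)) {0..s}"
  proof (rule fundamental_theorem_of_calculus_interior_strong[OF S(1) s(1)])
    show "continuous_on {0..s} (\<lambda>t. e \<bullet> (snd c \<circ> \<gamma>) t)" by (intro continuous_intros contf)
    fix t assume t: "t \<in> {0<..<s} - S"
    hence "t \<in> {0..s} - S" by auto
    from bounded_linear.has_vector_derivative[OF bounded_linear_inner_right D[OF this], of e] t
    show "((\<lambda>t. e \<bullet> (snd c \<circ> \<gamma>) t) has_vector_derivative f' t) (at t)" by (simp add: f'_def)
  qed
  moreover have "((\<lambda>t. \<kappa> * speed UNIV \<gamma> t) has_integral \<kappa> * integral {0..s} (speed UNIV \<gamma>)) {0..s}"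
    by (intro has_integral_mult_right integrable_integral integrable_on_subinterval[OF piecewise_C1_regular(2)[OF pw]]) (use s in auto)
  moreover have "f' t \<le> \<kappa> * speed UNIV \<gamma> t" if t: "t \<in> {0..s}" for t
    using le[OF t] sp[of t] t by (cases "t \<in> S") (auto simp: f'_def)
  ultimately have "e \<bullet> (snd c \<circ> \<gamma>) s - e \<bullet> (snd c \<circ> \<gamma>) 0 \<le> \<kappa> * integral {0..s} (speed UNIV \<gamma>)"
    by (rule has_integral_le)
  thus ?thesis by (simp add: inner_diff_right)
qed

text \<open>Calibration by the linear functional \<open>v \<mapsto> (b - a) \<bullet> g(q) v\<close>.\<close>

lemma curve_length_ge:
  assumes j: "joins \<gamma> (param c a) y" and c: "c \<in> A" and sub: "cball a \<rho> \<subseteq> snd c ` fst c" and \<rho>: "0 < \<rho>"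
    and q: "q \<in> snd c ` fst c" and m: "0 < m"
    and le: "\<And>z v. z \<in> cball a \<rho> \<Longrightarrow> m * qnorm (g c q) v \<le> qnorm (g c z) v"
  shows "\<exists>b\<in>cball a \<rho>. m * qnorm (g c q) (b - a) \<le> length_of \<gamma> \<and> (y = param c b \<or> norm (b - a) = \<rho>)"
proof -
  have pw: "pw_C1 \<gamma>" using j by (simp add: joins_def)
  obtain s where s: "s \<in> {0..1}" "\<And>t. t \<in> {0..s} \<Longrightarrow> \<gamma> t \<in> fst c \<and> snd c (\<gamma> t) \<in> cball a \<rho>"
    "s = 1 \<or> norm (snd c (\<gamma> s) - a) = \<rho>"
    using exit_time[OF j c sub \<rho>] by blast
  define b where "b = snd c (\<gamma> s)"
  have b: "b \<in> cball a \<rho>" using s(2)[of s] s(1) by (simp add: b_def)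
  have aU: "a \<in> snd c ` fst c" using sub \<rho> by auto
  have \<gamma>0: "snd c (\<gamma> 0) = a" using j chart_param[OF aU] by (simp add: joins_def)
  define n where "n = qnorm (g c q) (b - a)"
  have sym: "transpose (g c q) = g c q" by (rule metric_symmetric[OF c q])
  have pos: "v \<noteq> 0 \<Longrightarrow> 0 < v \<bullet> (g c q *v v)" for v by (rule metric_pos[OF c q])
  have Q: "0 \<le> v \<bullet> (g c q *v v)" for v using pos[of v] by (cases "v = 0") auto
  have n0: "0 \<le> n" using Q by (simp add: n_def qnorm_def)
  have n2: "(g c q *v (b - a)) \<bullet> (b - a) = n\<^sup>2" using Q[of "b - a"] by (simp add: n_def qnorm_def inner_commute)
  \<comment> \<open>The functional has dual norm at most n for the form at \<open>q\<close>, and the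
    norm along the curve is at least m times the one at \<open>q\<close>. On \<open>b - a\<close>
    its value is n^2, so one factor n cancels in the end.\<close>
  have "(g c q *v (b - a)) \<bullet> v \<le> (n / m) * qnorm (g c (snd c (\<gamma> t))) v" if t: "t \<in> {0..s}" for t v
  proof -
    have "(g c q *v (b - a)) \<bullet> v \<le> qnorm (g c q) v * n"
      using cauchy_schwarz_form[OF sym pos, of v "b - a"] by (simp add: n_def inner_commute)
    also have "qnorm (g c q) v \<le> qnorm (g c (snd c (\<gamma> t))) v / m"
      using le[of "snd c (\<gamma> t)" v] s(2)[OF t] m by (simp add: field_simps)
    finally show ?thesis using n0 by (simp add: mult_right_mono mult.commute)
  qed
  from functional_le_length[OF pw c _ _ _ this] s
  have "(g c q *v (b - a)) \<bullet> (b - a) \<le> (n / m) * integral {0..s} (speed UNIV \<gamma>)" by (auto simp: b_def \<gamma>0)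
  also have "\<dots> \<le> (n / m) * length_of \<gamma>"
  proof (rule mult_left_mono)
    have "integral {0..s} (speed UNIV \<gamma>) + integral {s..1} (speed UNIV \<gamma>) = length_of \<gamma>"
      by (rule integral_speed_split[OF pw]) (use s in auto)
    moreover have "0 \<le> integral {s..1} (speed UNIV \<gamma>)" by (rule curve_length_nonneg(2)[OF pw]) (use s in auto)
    ultimately show "integral {0..s} (speed UNIV \<gamma>) \<le> length_of \<gamma>" by simp
  qed (use n0 m in simp)
  finally have *: "n\<^sup>2 \<le> (n / m) * length_of \<gamma>" unfolding n2 .
  have "m * n \<le> length_of \<gamma>"
  proof (cases "n = 0")
    case True
    thus ?thesis using curve_length_nonneg(1)[OF pw] by simp
  next
    case False
    hence "0 < n" using n0 by simp
    thus ?thesis using * m by (simp add: power2_eq_square field_simps)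
  qed
  moreover have "y = param c b \<or> norm (b - a) = \<rho>"
  proof (cases "s = 1")
    case True
    have "param c b = \<gamma> 1" using param_chart[OF c] s(2)[of s] s(1) True by (simp add: b_def)
    thus ?thesis using j by (simp add: joins_def)
  qed (use s(3) in \<open>simp add: b_def\<close>)
  ultimately show ?thesis using b by (auto simp: n_def)
qed

end

section \<open>Intermediate points, and charts as almost Euclidean spaces\<close>

context compact_riemannian
begin

lemma le_gdist:
  assumes "x \<in> M" "y \<in> M" "\<And>\<gamma>. joins \<gamma> x y \<Longrightarrow> B \<le> length_of \<gamma>"
  shows "B \<le> gdist x y"
  unfolding geodesic_dist_alt by (rule cInf_greatest) (use joined[OF assms(1,2)] assms(3) in auto)

lemma gdist_le_segment:
  assumes "c \<in> A" "closed_segment a b \<subseteq> snd c ` fst c"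
    "\<And>z. z \<in> closed_segment a b \<Longrightarrow> qnorm (g c z) (b - a) \<le> B"
  shows "gdist (param c a) (param c b) \<le> B"
  using chart_segment_length_le[OF assms] gdist_le unfolding joins_def by fastforce

text \<open>Coordinate segments show that distance balls are neighbourhoods in the manifold
  topology. This makes \<open>gdist y\<close> continuous, so that compactness and the intermediate
  value theorem can be applied to it.\<close>

lemma gdist_small_nbhd:
  assumes x: "x \<in> M" and e: "0 < e"
  shows "\<exists>U. openin X U \<and> x \<in> U \<and> (\<forall>w\<in>U. gdist x w < e)"
proof -
  obtain c r where c: "c \<in> A" "x \<in> fst c" "0 < r" "cball (snd c x) r \<subseteq> snd c ` fst c" using chart_ball[OF x] .
  obtain L where L: "1 \<le> L" "\<And>z v. z \<in> cball (snd c x) r \<Longrightarrow> qnorm (g c z) v \<le> L * norm v"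
    using metric_bounds[OF c(1,4,3)] by blast
  define s where "s = min r (e / L)"
  have s: "0 < s" "s \<le> r" "s \<le> e / L" using c e L by (auto simp: s_def)
  have sub: "ball (snd c x) s \<subseteq> snd c ` fst c" using c(4) s(2) by (meson ball_subset_cball order_trans subset_cball)
  show ?thesis
  proof (intro exI[of _ "param c ` ball (snd c x) s"] conjI ballI)
    show "openin X (param c ` ball (snd c x) s)" by (rule openin_param_image[OF c(1) sub]) simp
    show "x \<in> param c ` ball (snd c x) s"
      using param_chart[OF c(1,2)] s by (intro image_eqI[of _ _ "snd c x"]) auto
    fix w assume "w \<in> param c ` ball (snd c x) s"
    then obtain b where b: "b \<in> ball (snd c x) s" "w = param c b" by blast
    have seg: "closed_segment (snd c x) b \<subseteq> ball (snd c x) s" using b s by (intro closed_segment_subset) auto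
    have "gdist (param c (snd c x)) (param c b) \<le> L * norm (b - snd c x)"
      by (rule gdist_le_segment[OF c(1) order_trans[OF seg sub]], rule L(2)) (use seg s in auto)
    also have "\<dots> < L * (e / L)"
      using b s L by (intro mult_strict_left_mono) (auto simp: dist_norm norm_minus_commute)
    also have "\<dots> = e" using L by simp
    finally show "gdist x w < e" using param_chart[OF c(1,2)] b by simp
  qed
qed

lemma gdist_continuous:
  assumes y: "y \<in> M" shows "continuous_map X euclideanreal (gdist y)"
  unfolding continuous_map_def
proof (intro conjI allI impI)
  fix V :: "real set" assume "openin euclideanreal V"
  hence V: "open V" by simp
  show "openin X {x \<in> M. gdist y x \<in> V}"
  proof (subst openin_subopen, intro ballI)
    fix x assume x: "x \<in> {x \<in> M. gdist y x \<in> V}"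
    then obtain e where e: "0 < e" "ball (gdist y x) e \<subseteq> V" using V open_contains_ball by blast
    obtain U where U: "openin X U" "x \<in> U" "\<forall>w\<in>U. gdist x w < e" using gdist_small_nbhd[of x e] x e by blast
    have "U \<subseteq> {x \<in> M. gdist y x \<in> V}"
    proof
      fix w assume w: "w \<in> U"
      have wX: "w \<in> M" using openin_subset[OF U(1)] w by blast
      have "\<bar>gdist y x - gdist y w\<bar> \<le> gdist x w"
        using gdist_triangle[OF y _ wX, of x] gdist_triangle[OF y wX, of x] gdist_commute[of x w] x by auto
      hence "gdist y w \<in> ball (gdist y x) e" using U(3) w by (auto simp: dist_real_def)
      thus "w \<in> {x \<in> M. gdist y x \<in> V}" using e wX by blast
    qed
    thus "\<exists>T. openin X T \<and> x \<in> T \<and> T \<subseteq> {x \<in> M. gdist y x \<in> V}" using U by blast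
  qed
qed simp

text \<open>A curve that exceeds the distance by less than \<eta> meets the sphere of radius s
  around x, at a point where the remaining distance is off by at most \<eta>. The sphere is compact,
  so a point of it closest to \<open>y\<close> serves all \<eta> at once, without a shortest curve
  being produced.\<close>

lemma gdist_between:
  assumes x: "x \<in> M" and y: "y \<in> M" and s: "0 \<le> s" "s \<le> gdist x y"
  shows "\<exists>z\<in>M. gdist x z = s \<and> gdist z y = gdist x y - s"
proof -
  have approx: "\<exists>z\<in>M. gdist x z = s \<and> gdist z y \<le> gdist x y - s + \<eta>" if \<eta>: "0 < \<eta>" for \<eta>
  proof -
    obtain \<gamma> where \<gamma>: "joins \<gamma> x y" "length_of \<gamma> < gdist x y + \<eta>" using gdist_approx[OF x y, of "gdist x y + \<eta>"] \<eta> by auto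
    have pw: "pw_C1 \<gamma>" and ends: "\<gamma> 0 = x" "\<gamma> 1 = y" using \<gamma> by (auto simp: joins_def)
    have "continuous_map (top_of_set {0..1}) X \<gamma>" using pw by (simp add: piecewise_C1_curve_def)
    from continuous_map_compose[OF this gdist_continuous[OF x]]
    have "continuous_on {0..1} (\<lambda>t. gdist x (\<gamma> t))" by (simp add: o_def)
    then obtain t where t: "0 \<le> t" "t \<le> 1" "gdist x (\<gamma> t) = s"
      using IVT'[of "\<lambda>t. gdist x (\<gamma> t)" 0 s 1] s gdist_refl[OF x] ends by auto
    have "gdist x (\<gamma> t) \<le> integral {0..t} (speed UNIV \<gamma>)" using gdist_subcurve[OF \<gamma>(1), of 0 t] t ends by simp
    moreover have "gdist (\<gamma> t) y \<le> integral {t..1} (speed UNIV \<gamma>)" using gdist_subcurve[OF \<gamma>(1), of t 1] t ends by simp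
    moreover have "integral {0..t} (speed UNIV \<gamma>) + integral {t..1} (speed UNIV \<gamma>) = length_of \<gamma>"
      by (rule integral_speed_split[OF pw t(1,2)])
    ultimately have "gdist (\<gamma> t) y \<le> gdist x y - s + \<eta>" using \<gamma>(2) t(3) by simp
    moreover have "\<gamma> t \<in> M" using joins_in_space[OF \<gamma>(1)] t by simp
    ultimately show ?thesis using t by blast
  qed
  define Z where "Z = {z \<in> M. gdist x z \<in> {s}}"
  have "closedin X Z" unfolding Z_def by (rule closedin_continuous_map_preimage[OF gdist_continuous[OF x]]) simp
  hence "compactin X Z" using compact closedin_compact_space by blast
  hence "compactin euclideanreal (gdist y ` Z)" by (rule image_compactin[OF _ gdist_continuous[OF y]])
  hence "compact (gdist y ` Z)" by simp
  moreover have "gdist y ` Z \<noteq> {}" using approx[of 1] by (auto simp: Z_def)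
  ultimately obtain m where m: "m \<in> gdist y ` Z" "\<forall>t\<in>gdist y ` Z. m \<le> t" using compact_attains_inf by metis
  then obtain z where z: "z \<in> Z" "m = gdist y z" by blast
  have zX: "z \<in> M" "gdist x z = s" using z by (auto simp: Z_def)
  have "gdist y z \<le> gdist x y - s"
  proof (rule field_le_epsilon)
    fix \<eta> :: real assume "0 < \<eta>"
    from approx[OF this] obtain z' where z': "z' \<in> Z" "gdist z' y \<le> gdist x y - s + \<eta>" by (auto simp: Z_def)
    thus "gdist y z \<le> gdist x y - s + \<eta>" using m(2) z(2) gdist_commute[of y z'] by force
  qed
  moreover have "gdist x y \<le> gdist x z + gdist z y" by (rule gdist_triangle[OF x zX(1) y])
  ultimately have "gdist z y = gdist x y - s" using zX(2) gdist_commute[of z y] by simp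
  thus ?thesis using zX by blast
qed

sublocale geodesic_space "M" gdist
  by unfold_locales (auto intro: gdist_nonneg gdist_commute gdist_refl gdist_triangle gdist_between)

text \<open>The term \<open>L\<^sup>2 / R\<close> makes the lower bound for the distance trivial if the comparison ball
  would leave the chart.\<close>

lemma chart_is_almost_euclidean:
  assumes c: "c \<in> A" and sub: "cball p (4 * R) \<subseteq> snd c ` fst c" and R: "0 < R"
    and L: "1 \<le> L" "\<And>x v. x \<in> cball p (4 * R) \<Longrightarrow> norm v \<le> L * qnorm (g c x) v"
      "\<And>x v. x \<in> cball p (4 * R) \<Longrightarrow> qnorm (g c x) v \<le> L * norm v"
    and H: "0 \<le> H" "\<And>x y v. x \<in> cball p (4 * R) \<Longrightarrow> y \<in> cball p (4 * R) \<Longrightarrow>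
      qnorm (g c y) v \<le> (1 + H * norm (y - x)) * qnorm (g c x) v"
  shows "almost_euclidean_chart (M) gdist (param c) (g c) p R (L ^ 3) (3 * H * L\<^sup>2 + L\<^sup>2 / R)"
proof -
  let ?U = "snd c ` fst c" and ?B = "ball p R"
  have B_big: "?B \<subseteq> cball p (4 * R)" using R by auto
  have BU: "?B \<subseteq> ?U" using B_big sub by blast
  have in_M: "param c x \<in> M" if "x \<in> ?U" for x using param_in[OF that] chart_sub[OF c] by blast
  have pos: "0 \<le> v \<bullet> (g c x *v v)" if "x \<in> ?U" for x v
    using metric_pos[OF c that, of v] by (cases "v = 0") auto
  have q0: "0 \<le> qnorm (g c x) v" if "x \<in> ?U" for x v using pos[OF that] by (simp add: qnorm_def)
  have L3: "L \<le> L ^ 3" "1 \<le> L ^ 3" "L \<le> L\<^sup>2" using L(1) by (auto intro: self_le_power)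
  have L0: "0 < L" using L by simp
  \<comment> \<open>\<open>curve_length_ge\<close> is used with the form at the centre
    \<open>a\<close>. Comparing it with the form elsewhere costs a factor \<open>L\<^sup>2\<close>
    and passing to the Euclidean norm another \<open>L\<close>, which explains
    \<open>L ^ 3\<close>.\<close>
  have len: "\<exists>b\<in>cball a \<rho>. norm (b - a) \<le> L ^ 3 * length_of \<gamma> \<and> (y = param c b \<or> norm (b - a) = \<rho>)"
    if a: "a \<in> ?B" and \<rho>: "0 < \<rho>" "\<rho> \<le> 2 * R" and j: "joins \<gamma> (param c a) y" for a \<rho> \<gamma> y
  proof -
    have ca: "cball a \<rho> \<subseteq> cball p (4 * R)"
      using a \<rho> R by (intro subsetI) (smt (verit) dist_triangle mem_ball mem_cball)
    have m: "0 < 1 / L\<^sup>2" using L0 by simp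
    have aU: "a \<in> ?U" using BU a by blast
    have aB: "a \<in> cball p (4 * R)" using B_big a by blast
    have le: "1 / L\<^sup>2 * qnorm (g c a) v \<le> qnorm (g c z) v" if z: "z \<in> cball a \<rho>" for z v
    proof -
      have zB: "z \<in> cball p (4 * R)" using ca z by blast
      have "qnorm (g c a) v \<le> L * norm v" by (rule L(3)[OF aB])
      also have "\<dots> \<le> L * (L * qnorm (g c z) v)" using L(2)[OF zB] L0 by (intro mult_left_mono) auto
      finally show ?thesis using L0 by (simp add: field_simps power2_eq_square)
    qed
    from curve_length_ge[OF j c order_trans[OF ca sub] \<rho>(1) aU m le]
    obtain b where b: "b \<in> cball a \<rho>" "1 / L\<^sup>2 * qnorm (g c a) (b - a) \<le> length_of \<gamma>" "y = param c b \<or> norm (b - a) = \<rho>"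
      by blast
    have "norm (b - a) \<le> L * qnorm (g c a) (b - a)" by (rule L(2)[OF aB])
    also have "\<dots> = L ^ 3 * (1 / L\<^sup>2 * qnorm (g c a) (b - a))" using L0 by (simp add: power2_eq_square power3_eq_cube)
    also have "\<dots> \<le> L ^ 3 * length_of \<gamma>" using b(2) L0 by (intro mult_left_mono) auto
    finally show ?thesis using b by blast
  qed
  show ?thesis
  proof (unfold_locales)
    show "0 < R" "1 \<le> L ^ 3" "0 \<le> 3 * H * L\<^sup>2 + L\<^sup>2 / R" using R L3 H by auto
    show "param c x \<in> M" if "x \<in> ?B" for x using in_M BU that by blast
    show "0 \<le> v \<bullet> (g c x *v v)" if "x \<in> ?B" for x v using pos BU that by blast
    show "norm v \<le> L ^ 3 * qnorm (g c x) v" if "x \<in> ?B" for x v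
      using L(2)[of x v] B_big that mult_right_mono[OF L3(1) q0[of x v]] BU by (meson order_trans subsetD)
    show "gdist (param c a) (param c b) \<le> L ^ 3 * norm (a - b)" if ab: "a \<in> ?B" "b \<in> ?B" for a b
    proof -
      have seg: "closed_segment a b \<subseteq> ?B" using ab by (intro closed_segment_subset) auto
      have "gdist (param c a) (param c b) \<le> L * norm (b - a)"
        by (rule gdist_le_segment[OF c order_trans[OF seg BU]], rule L(3)) (use seg B_big in blast)
      also have "\<dots> \<le> L ^ 3 * norm (b - a)" using L3 by (intro mult_right_mono) auto
      finally show ?thesis by (simp add: norm_minus_commute)
    qed
    show "norm (a - b) \<le> L ^ 3 * gdist (param c a) (param c b)" if ab: "a \<in> ?B" "b \<in> ?B" for a b
    proof -
      have "norm (a - b) / L ^ 3 \<le> gdist (param c a) (param c b)"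
      proof (rule le_gdist)
        fix \<gamma> assume "joins \<gamma> (param c a) (param c b)"
        \<comment> \<open>The ball of radius 2R about \<open>a\<close> contains \<open>?B\<close>,
          so a curve that reaches its boundary has gone at least as far as \<open>b\<close>; this
          ball still lies in the ball of radius 4R.\<close>
        from len[OF ab(1) _ _ this, of "2 * R"] R
        obtain b' where b': "b' \<in> cball a (2 * R)" "norm (b' - a) \<le> L ^ 3 * length_of \<gamma>"
          "param c b = param c b' \<or> norm (b' - a) = 2 * R" by auto
        have "norm (a - b) \<le> norm (b' - a)"
        proof (cases "norm (b' - a) = 2 * R")
          case True
          have "dist a b \<le> dist p a + dist p b" by (metis dist_commute dist_triangle)
          thus ?thesis using True ab by (simp add: dist_norm)
        next
          case False
          hence eq: "param c b = param c b'" using b' by blast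
          have "cball a (2 * R) \<subseteq> cball p (4 * R)"
            using ab(1) R by (intro subsetI) (smt (verit) dist_triangle mem_ball mem_cball)
          hence "b' \<in> ?U" using b'(1) sub by blast
          moreover have "b \<in> ?U" using ab BU by blast
          ultimately have "b = b'" using eq chart_param by metis
          thus ?thesis by (simp add: norm_minus_commute)
        qed
        thus "norm (a - b) / L ^ 3 \<le> length_of \<gamma>" using b'(2) L0 by (simp add: pos_divide_le_eq mult.commute)
      qed (use in_M BU ab in blast)+
      thus ?thesis using L0 by (simp add: pos_divide_le_eq mult.commute)
    qed
    show "gdist (param c a) (param c b) \<le> (1 + (3 * H * L\<^sup>2 + L\<^sup>2 / R) * \<rho>) * qnorm (g c q) (a - b)"
      if q: "q \<in> ?B" and ab: "a \<in> ?B" "b \<in> ?B" and \<rho>: "norm (a - q) \<le> \<rho>" "norm (b - q) \<le> \<rho>" for q a b \<rho>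
    proof -
      have seg: "closed_segment a b \<subseteq> ?B" using ab by (intro closed_segment_subset) auto
      have segq: "closed_segment a b \<subseteq> cball q \<rho>"
        using \<rho> by (intro closed_segment_subset) (auto simp: dist_norm norm_minus_commute)
      have \<rho>0: "0 \<le> \<rho>" using \<rho>(1) norm_ge_zero order_trans by blast
      have K: "H \<le> 3 * H * L\<^sup>2 + L\<^sup>2 / R"
      proof -
        have "1 \<le> L\<^sup>2" using L(1) by simp
        hence "H * 1 \<le> H * (3 * L\<^sup>2)" using H(1) by (intro mult_left_mono) auto
        moreover have "0 \<le> L\<^sup>2 / R" using R by simp
        ultimately show ?thesis by (simp only: mult_ac)
      qed
      have qq: "0 \<le> qnorm (g c q) (b - a)" using q0 BU q by blast
      have "gdist (param c a) (param c b) \<le> (1 + (3 * H * L\<^sup>2 + L\<^sup>2 / R) * \<rho>) * qnorm (g c q) (b - a)"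
      proof (rule gdist_le_segment[OF c order_trans[OF seg BU]])
        fix z assume z: "z \<in> closed_segment a b"
        have "qnorm (g c z) (b - a) \<le> (1 + H * norm (z - q)) * qnorm (g c q) (b - a)"
          by (rule H(2)) (use z seg q B_big in blast)+
        also have "\<dots> \<le> (1 + (3 * H * L\<^sup>2 + L\<^sup>2 / R) * \<rho>) * qnorm (g c q) (b - a)"
        proof (intro mult_right_mono add_left_mono mult_mono K qq)
          show "norm (z - q) \<le> \<rho>" using subsetD[OF segq z] by (simp add: dist_norm norm_minus_commute)
          show "0 \<le> 3 * H * L\<^sup>2 + L\<^sup>2 / R" using H(1) K by linarith
        qed simp
        finally show "qnorm (g c z) (b - a) \<le> (1 + (3 * H * L\<^sup>2 + L\<^sup>2 / R) * \<rho>) * qnorm (g c q) (b - a)" .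
      qed
      thus ?thesis using qnorm_commute[of "g c q" a b] by simp
    qed
    show "z \<in> param c ` ?B" if a: "a \<in> ?B" and z: "z \<in> M" "L ^ 3 * gdist (param c a) z < R - dist p a" for a z
    proof (rule ccontr)
      assume nz: "z \<notin> param c ` ?B"
      \<comment> \<open>A curve from \<open>a\<close> to a point outside the image of
        \<open>?B\<close> has to cover at least the coordinate distance from \<open>a\<close> to the
        sphere of radius R.\<close>
      define \<rho> where "\<rho> = R - dist p a"
      have \<rho>: "0 < \<rho>" "\<rho> \<le> 2 * R" using a R by (auto simp: \<rho>_def) (smt (verit) zero_le_dist)
      have "\<rho> / L ^ 3 \<le> gdist (param c a) z"
      proof (rule le_gdist)
        fix \<gamma> assume "joins \<gamma> (param c a) z"
        from len[OF a \<rho> this]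
        obtain b where b: "b \<in> cball a \<rho>" "norm (b - a) \<le> L ^ 3 * length_of \<gamma>" "z = param c b \<or> norm (b - a) = \<rho>" by blast
        have "\<rho> \<le> norm (b - a)"
        proof (cases "norm (b - a) = \<rho>")
          case False
          hence "b \<notin> ?B" using b nz by blast
          hence "R \<le> dist p b" by simp
          also have "\<dots> \<le> dist p a + dist a b" by (rule dist_triangle)
          finally show ?thesis by (simp add: \<rho>_def dist_norm norm_minus_commute)
        qed simp
        thus "\<rho> / L ^ 3 \<le> length_of \<gamma>" using b(2) L0 by (simp add: pos_divide_le_eq mult.commute)
      qed (use in_M BU a z in blast)+
      thus False using z(2) L0 by (simp add: pos_divide_le_eq mult.commute \<rho>_def)
    qed
    show "(1 - (3 * H * L\<^sup>2 + L\<^sup>2 / R) * \<rho>) * qnorm (g c q) (a - b) \<le> gdist (param c a) (param c b)"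
      if q: "q \<in> ?B" and ab: "a \<in> ?B" "b \<in> ?B" and \<rho>: "norm (a - q) \<le> \<rho>" "norm (b - q) \<le> \<rho>" for q a b \<rho>
    proof -
      let ?K = "3 * H * L\<^sup>2 + L\<^sup>2 / R"
      have \<rho>0: "0 \<le> \<rho>" using \<rho>(1) norm_ge_zero order_trans by blast
      have M: "param c a \<in> M" "param c b \<in> M" using in_M BU ab by blast+
      have qU: "q \<in> ?U" and qB: "q \<in> cball p (4 * R)" using q BU B_big by blast+
      have L2: "1 \<le> L\<^sup>2" using L(1) by simp
      show ?thesis
      proof (cases "\<rho> = 0 \<or> 1 \<le> ?K * \<rho>")
        case True
        have "(1 - ?K * \<rho>) * qnorm (g c q) (a - b) \<le> 0"
        proof (cases "\<rho> = 0")
          case True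
          hence "a = b" using \<rho> by simp
          thus ?thesis by (simp add: qnorm_def)
        next
          case False
          hence "1 - ?K * \<rho> \<le> 0" using True by simp
          thus ?thesis using q0[OF qU] by (intro mult_nonpos_nonneg)
        qed
        also have "0 \<le> gdist (param c a) (param c b)" by (rule gdist_nonneg[OF M])
        finally show ?thesis .
      next
        case False
        hence \<rho>p: "0 < \<rho>" and K1: "?K * \<rho> < 1" using \<rho>0 by auto
        \<comment> \<open>Leaving the ball of radius \<open>\<rho>'\<close> is at least as costly as
          reaching \<open>b\<close>: in the norm of \<open>g c q\<close> the vector
          \<open>b - a\<close> has length at most 2L\<rho>, which equals \<rho>'/L, and a vector of
          Euclidean length \<rho>' has length at least \<rho>'/L. The points of that ball are within
          \<rho> + \<rho>' \<le> 3 L^2 \<rho> of \<open>q\<close>, whence the term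
          \<open>3 * H * L\<^sup>2\<close>.\<close>
        define \<rho>' where "\<rho>' = 2 * L\<^sup>2 * \<rho>"
        have HL: "0 \<le> 3 * H * L\<^sup>2" using H(1) by simp
        have "L\<^sup>2 / R * \<rho> \<le> ?K * \<rho>" using HL \<rho>p by (intro mult_right_mono) auto
        hence "L\<^sup>2 / R * \<rho> \<le> 1" using K1 by linarith
        hence \<rho>'R: "\<rho>' \<le> 2 * R" using R by (simp add: \<rho>'_def field_simps)
        have \<rho>'p: "0 < \<rho>'" using L0 \<rho>p by (simp add: \<rho>'_def)
        have ca: "cball a \<rho>' \<subseteq> cball p (4 * R)"
          using ab(1) \<rho>'R R by (intro subsetI) (smt (verit) dist_triangle mem_ball mem_cball)
        define t where "t = 1 + 3 * H * L\<^sup>2 * \<rho>"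
        have t1: "1 \<le> t" using HL \<rho>p by (simp add: t_def)
        have le: "1 / t * qnorm (g c q) v \<le> qnorm (g c z) v" if z: "z \<in> cball a \<rho>'" for z v
        proof -
          have zB: "z \<in> cball p (4 * R)" using ca z by blast
          have "norm (q - z) \<le> dist q a + dist a z" unfolding dist_norm[symmetric] by (rule dist_triangle)
          also have "\<dots> \<le> \<rho> + \<rho>'" using z \<rho>(1) by (intro add_mono) (auto simp: dist_norm norm_minus_commute)
          also have "\<dots> \<le> 3 * L\<^sup>2 * \<rho>" using mult_right_mono[OF L2 \<rho>0] by (simp add: \<rho>'_def mult.commute)
          finally have "H * norm (q - z) \<le> H * (3 * L\<^sup>2 * \<rho>)" using H(1) by (intro mult_left_mono)
          hence "1 + H * norm (q - z) \<le> t" by (simp add: t_def mult_ac)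
          moreover have "0 \<le> qnorm (g c z) v" using q0 sub zB by blast
          ultimately have "(1 + H * norm (q - z)) * qnorm (g c z) v \<le> t * qnorm (g c z) v" by (rule mult_right_mono)
          with H(2)[OF zB qB, of v] have "qnorm (g c q) v \<le> t * qnorm (g c z) v" by linarith
          thus ?thesis using t1 by (simp add: pos_divide_le_eq mult.commute)
        qed
        have "1 / t * qnorm (g c q) (b - a) \<le> gdist (param c a) (param c b)"
        proof (rule le_gdist[OF M])
          fix \<gamma> assume j: "joins \<gamma> (param c a) (param c b)"
          have "0 < 1 / t" using t1 by simp
          from curve_length_ge[OF j c order_trans[OF ca sub] \<rho>'p qU this le]
          obtain b' where b': "b' \<in> cball a \<rho>'" "1 / t * qnorm (g c q) (b' - a) \<le> length_of \<gamma>"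
            "param c b = param c b' \<or> norm (b' - a) = \<rho>'" by blast
          have "qnorm (g c q) (b - a) \<le> qnorm (g c q) (b' - a)"
          proof (cases "norm (b' - a) = \<rho>'")
            case True
            have "norm (b - a) \<le> norm (b - q) + norm (a - q)" by (metis diff_diff_eq2 diff_add_cancel norm_triangle_ineq4)
            also have "\<dots> \<le> 2 * \<rho>" using \<rho> by linarith
            finally have "L * norm (b - a) \<le> L * (2 * \<rho>)" using L0 by (intro mult_left_mono) auto
            with L(3)[OF qB, of "b - a"] have "qnorm (g c q) (b - a) \<le> L * (2 * \<rho>)" by (rule order_trans)
            hence "L * qnorm (g c q) (b - a) \<le> L * (L * (2 * \<rho>))"
              using L0 by (intro mult_left_mono) auto
            also have "\<dots> = norm (b' - a)" unfolding True \<rho>'_def by (simp add: power2_eq_square)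
            also have "\<dots> \<le> L * qnorm (g c q) (b' - a)" by (rule L(2)[OF qB])
            finally show ?thesis using L0 by simp
          next
            case False
            hence eq: "param c b = param c b'" using b' by blast
            have "b' \<in> ?U" using b'(1) ca sub by blast
            moreover have "b \<in> ?U" using ab BU by blast
            ultimately have "b = b'" using eq chart_param by metis
            thus ?thesis by simp
          qed
          hence "1 / t * qnorm (g c q) (b - a) \<le> 1 / t * qnorm (g c q) (b' - a)" using t1 by (intro mult_left_mono) auto
          thus "1 / t * qnorm (g c q) (b - a) \<le> length_of \<gamma>" using b'(2) by linarith
        qed
        moreover have "(1 - ?K * \<rho>) * qnorm (g c q) (b - a) \<le> 1 / t * qnorm (g c q) (b - a)"
        proof (rule mult_right_mono[OF _ q0[OF qU]])
          define h where "h = 3 * H * L\<^sup>2 * \<rho>"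
          have h: "0 \<le> h" using HL \<rho>p by (simp add: h_def)
          have "h \<le> ?K * \<rho>" unfolding h_def using R \<rho>p by (intro mult_right_mono) auto
          hence "1 - ?K * \<rho> \<le> 1 - h" by simp
          also have "1 - h \<le> 1 / (1 + h)"
          proof -
            have "(1 - h) * (1 + h) \<le> 1" by (simp add: algebra_simps)
            thus ?thesis using h by (simp add: pos_le_divide_eq)
          qed
          finally show "1 - ?K * \<rho> \<le> 1 / t" by (simp add: t_def h_def)
        qed
        ultimately show ?thesis using qnorm_commute[of "g c q" a b] by simp
      qed
    qed
  qed
qed

end

section \<open>Volumes of balls on a compact manifold\<close>

locale riemannian_volume = compact_riemannian X A g
  for X :: "'a topology" and A :: "('a, 'n::finite) chart set" and g :: "('a, 'n) metric_components" +
  fixes vol :: "'a measure"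
  assumes volume: "is_riemannian_measure X A g vol"
begin

lemma space_vol: "space vol = M"
  using volume by (simp add: is_riemannian_measure_def)

lemma openin_sets: "openin X U \<Longrightarrow> U \<in> sets vol"
  using volume unfolding is_riemannian_measure_def by (simp add: sigma_sets.Basic)

lemma emeasure_in_chart:
  "c \<in> A \<Longrightarrow> E \<in> sets vol \<Longrightarrow> E \<subseteq> fst c \<Longrightarrow>
    emeasure vol E = (\<integral>\<^sup>+x \<in> snd c ` E. ennreal (sqrt (det (g c x))) \<partial>lborel)"
  using volume unfolding is_riemannian_measure_def by blast

lemma gdist_measurable:
  assumes "y \<in> M" shows "gdist y \<in> borel_measurable vol"
proof (rule borel_measurableI)
  fix S :: "real set" assume "open S"
  hence "openin X {x \<in> M. gdist y x \<in> S}"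
    by (intro openin_continuous_map_preimage[OF gdist_continuous[OF assms]]) simp
  moreover have "gdist y -` S \<inter> space vol = {x \<in> M. gdist y x \<in> S}" by (auto simp: space_vol)
  ultimately show "gdist y -` S \<inter> space vol \<in> sets vol" by (simp add: openin_sets)
qed

lemma chart_volume_bounds:
  assumes c: "c \<in> A" and E: "E \<in> sets vol" "E \<subseteq> fst c" and P: "snd c ` E \<in> sets borel"
    and L: "0 \<le> L" "\<And>x. x \<in> snd c ` E \<Longrightarrow> 1 \<le> L * sqrt (det (g c x)) \<and> sqrt (det (g c x)) \<le> L"
  shows "emeasure vol E \<le> ennreal L * emeasure lborel (snd c ` E)"
    and "emeasure lborel (snd c ` E) \<le> ennreal L * emeasure vol E"
proof -
  let ?P = "snd c ` E" and ?f = "\<lambda>x. ennreal (sqrt (det (g c x)))"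
  have vol: "emeasure vol E = (\<integral>\<^sup>+x. ?f x * indicator ?P x \<partial>lborel)" by (rule emeasure_in_chart[OF c E])
  also have "\<dots> \<le> (\<integral>\<^sup>+x. ennreal L * indicator ?P x \<partial>lborel)"
    using L(2) by (intro nn_integral_mono) (auto simp: indicator_def intro!: ennreal_leI)
  also have "\<dots> = ennreal L * emeasure lborel ?P" using P by (subst nn_integral_cmult_indicator) auto
  finally show "emeasure vol E \<le> ennreal L * emeasure lborel ?P" .
  have PU: "?P \<subseteq> snd c ` fst c" using E by auto
  have "continuous_on ?P (g c)" by (rule continuous_on_subset[OF smooth_on_continuous[OF smooth_metric[OF c]] PU])
  hence "continuous_on ?P (\<lambda>x. sqrt (det (g c x)))"
    unfolding det_def by (intro continuous_intros continuous_on_component)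
  hence "(\<lambda>x. indicator ?P x *\<^sub>R sqrt (det (g c x))) \<in> borel_measurable borel"
    by (rule borel_measurable_continuous_on_indicator[OF P])
  hence "(\<lambda>x. ennreal (indicator ?P x *\<^sub>R sqrt (det (g c x)))) \<in> borel_measurable lborel" by simp
  moreover have "(\<lambda>x. ennreal (indicator ?P x *\<^sub>R sqrt (det (g c x)))) = (\<lambda>x. ?f x * indicator ?P x)"
    by (auto simp: indicator_def)
  ultimately have meas: "(\<lambda>x. ?f x * indicator ?P x) \<in> borel_measurable lborel" by simp
  have "emeasure lborel ?P = (\<integral>\<^sup>+x. indicator ?P x \<partial>lborel)" using P by simp
  also have "\<dots> \<le> (\<integral>\<^sup>+x. ennreal L * (?f x * indicator ?P x) \<partial>lborel)"
  proof (intro nn_integral_mono)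
    fix x
    show "indicator ?P x \<le> ennreal L * (?f x * indicator ?P x)"
    proof (cases "x \<in> ?P")
      case True
      have "ennreal 1 \<le> ennreal (L * sqrt (det (g c x)))" using L(2)[OF True] by (intro ennreal_leI) simp
      thus ?thesis using True L(1) by (simp add: ennreal_mult')
    qed simp
  qed
  also have "\<dots> = ennreal L * emeasure vol E" unfolding vol by (rule nn_integral_cmult[OF meas])
  finally show "emeasure lborel ?P \<le> ennreal L * emeasure vol E" .
qed

text \<open>All that a finite subcover has to carry. In the first two volume bounds \<open>V\<close>
  contains the centre \<open>y\<close>; in the last one the centre is arbitrary and \<open>V\<close>
  restricts the annulus. The point at positive distance is recorded to make the diameter
  positive.\<close>

definition regular_nbhd :: "'a \<Rightarrow> 'a set \<Rightarrow> real \<Rightarrow> real \<Rightarrow> bool" where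
  "regular_nbhd p V \<sigma> C \<longleftrightarrow> openin X V \<and> p \<in> V \<and> 0 < \<sigma> \<and> 0 < C \<and> emeasure vol V < \<infinity> \<and>
    (\<exists>q\<in>M. 0 < gdist p q) \<and>
    (\<forall>y\<in>V. \<forall>r. 0 < r \<and> r \<le> \<sigma> \<longrightarrow>
       ennreal (r ^ CARD('n) / C) \<le> emeasure vol (dball y r) \<and>
       emeasure vol (dball y r) \<le> ennreal (C * r ^ CARD('n))) \<and>
    (\<forall>y\<in>V. \<forall>a b. 0 < a \<and> a < b \<and> b \<le> 2 * a \<and> a \<le> \<sigma> \<longrightarrow>
       emeasure vol (annulus y a b) \<le> ennreal (C * (b - a))) \<and>
    (\<forall>s>0. \<exists>C>0. \<forall>y\<in>M. \<forall>a b. s \<le> a \<and> a < b \<longrightarrow>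
       emeasure vol (annulus y a b \<inter> V) \<le> ennreal (C * (b - a)))"

lemma local_regularity:
  assumes p: "p \<in> M"
  shows "\<exists>V \<sigma> C. regular_nbhd p V \<sigma> C"
proof -
  obtain c r where c: "c \<in> A" "p \<in> fst c" and r: "0 < r" and sub: "cball (snd c p) r \<subseteq> snd c ` fst c"
    using chart_ball[OF p] .
  let ?o = "snd c p"
  \<comment> \<open>\<open>chart_is_almost_euclidean\<close> works in the ball of radius R but asks
    for metric bounds on the ball of radius 4R.\<close>
  define R where "R = r / 4"
  have R: "0 < R" "cball ?o r = cball ?o (4 * R)" using r by (auto simp: R_def)
  note sub = sub[unfolded R(2)]
  from metric_bounds[OF c(1) sub] R(1) obtain L H where L: "1 \<le> L" and H: "0 \<le> H"
    and bounds: "\<forall>x\<in>cball ?o (4 * R).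
    (\<forall>v. norm v \<le> L * qnorm (g c x) v \<and> qnorm (g c x) v \<le> L * norm v) \<and>
    1 \<le> L * sqrt (det (g c x)) \<and> sqrt (det (g c x)) \<le> L \<and>
    (\<forall>y\<in>cball ?o (4 * R). \<forall>v. qnorm (g c y) v \<le> (1 + H * norm (y - x)) * qnorm (g c x) v)"
    by auto
  have ae: "almost_euclidean_chart (M) gdist (param c) (g c) ?o R (L ^ 3) (3 * H * L\<^sup>2 + L\<^sup>2 / R)"
    by (rule chart_is_almost_euclidean[OF c(1) sub R(1) L _ _ H])
      (use bounds[rule_format, THEN conjunct1, rule_format, THEN conjunct1]
        bounds[rule_format, THEN conjunct1, rule_format, THEN conjunct2]
        bounds[rule_format, THEN conjunct2, THEN conjunct2, THEN conjunct2, rule_format] in blast)+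
  have L3: "L \<le> L ^ 3" "1 \<le> L ^ 3" using L by (auto intro: self_le_power)
  have big: "ball ?o R \<subseteq> cball ?o (4 * R)" using R(1) by auto
  have BU: "ball ?o R \<subseteq> snd c ` fst c" using big sub by blast
  \<comment> \<open>The constant is enlarged from \<open>L\<close> to \<open>L ^ 3\<close> because
    the chart locales have one parameter for distances and volumes.\<close>
  have det: "1 \<le> L ^ 3 * sqrt (det (g c x)) \<and> sqrt (det (g c x)) \<le> L ^ 3" if x: "x \<in> ball ?o R" for x
  proof -
    from bspec[OF bounds subsetD[OF big x]]
    have b: "1 \<le> L * sqrt (det (g c x))" "sqrt (det (g c x)) \<le> L" by simp_all
    have "0 \<le> sqrt (det (g c x))"
    proof (rule ccontr)
      assume "\<not> 0 \<le> sqrt (det (g c x))"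
      hence "L * sqrt (det (g c x)) \<le> 0" using L by (intro mult_nonneg_nonpos) auto
      thus False using b by simp
    qed
    from mult_right_mono[OF L3(1) this] b L3 show ?thesis by linarith
  qed
  have opens: "openin X (param c ` ball ?o s)" if "s \<le> R" for s
    by (rule openin_param_image[OF c(1)]) (use that BU in \<open>auto intro: subset_trans[OF subset_ball]\<close>)
  have img: "snd c ` E = {x\<in>ball ?o R. param c x \<in> E}" "E \<subseteq> fst c" if E: "E \<subseteq> param c ` ball ?o R" for E
  proof -
    show sub: "E \<subseteq> fst c" using E param_image_eq[OF c(1) BU] by auto
    show "snd c ` E = {x\<in>ball ?o R. param c x \<in> E}"
    proof (intro equalityI subsetI)
      fix x assume "x \<in> snd c ` E"
      then obtain e where e: "e \<in> E" "x = snd c e" by blast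
      moreover have "param c x = e" using param_chart[OF c(1)] e sub by auto
      moreover have "x \<in> ball ?o R" using e E param_image_eq[OF c(1) BU] by auto
      ultimately show "x \<in> {x\<in>ball ?o R. param c x \<in> E}" by simp
    next
      fix x assume x: "x \<in> {x\<in>ball ?o R. param c x \<in> E}"
      hence "snd c (param c x) = x" using chart_param BU by blast
      thus "x \<in> snd c ` E" using x by (metis (mono_tags, lifting) imageI mem_Collect_eq)
    qed
  qed
  interpret almost_euclidean_chart "M" gdist "param c" "g c" ?o R "L ^ 3" "3 * H * L\<^sup>2 + L\<^sup>2 / R"
    by (rule ae)
  interpret measured_chart "M" gdist "param c" "g c" ?o R "L ^ 3" "3 * H * L\<^sup>2 + L\<^sup>2 / R" vol
  proof (unfold_locales)
    show "param c ` ball ?o s \<in> sets vol" if "s \<le> R" for s using opens[OF that] by (rule openin_sets)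
    show "emeasure vol E \<le> ennreal (L ^ 3) * emeasure lborel {x\<in>ball ?o R. param c x \<in> E}"
      "emeasure lborel {x\<in>ball ?o R. param c x \<in> E} \<le> ennreal (L ^ 3) * emeasure vol E"
      if E: "E \<in> sets vol" "E \<subseteq> param c ` ball ?o R" "{x\<in>ball ?o R. param c x \<in> E} \<in> sets borel" for E
      using chart_volume_bounds[OF c(1) E(1) img(2)[OF E(2)], of "L ^ 3"] det L L3 E(3)
      unfolding img(1)[OF E(2)] by auto
  qed (use space_vol gdist_measurable in auto)
  define V where "V = param c ` ball ?o (R/4)"
  have V_open: "openin X V" unfolding V_def by (rule opens) (use R(1) in auto)
  have pV: "p \<in> V" unfolding V_def
    by (rule image_eqI[of _ _ ?o]) (use param_chart[OF c] R(1) in auto)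
  have "V \<subseteq> param c ` ball ?o R" unfolding V_def using R(1) by (intro image_mono subset_ball) auto
  note V_img = img[OF this]
  have Vb: "emeasure vol V \<le> ennreal (L ^ 3) * emeasure lborel (ball ?o (R/4))"
  proof -
    have im: "snd c ` V = ball ?o (R/4)"
    proof -
      have "snd c (param c x) = x" if "x \<in> ball ?o (R/4)" for x
        using chart_param BU that R(1) by (auto simp: subset_iff)
      thus ?thesis unfolding V_def image_image by simp
    qed
    show ?thesis
      using chart_volume_bounds(1)[OF c(1) openin_sets[OF V_open] V_img(2), of "L ^ 3"] det L L3 R(1) unfolding im by auto
  qed
  have Vfin: "emeasure vol V < \<infinity>"
    by (rule le_less_trans[OF Vb])
      (use emeasure_lborel_ball_finite[of ?o "R/4"] in \<open>auto simp: ennreal_mult_less_top\<close>)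
  have far_point: "\<exists>q\<in>M. 0 < gdist p q"
  proof -
    \<comment> \<open>The dimension is at least 1, so a nonzero coordinate vector exists; it rules
      out a one-point manifold.\<close>
    obtain u :: "real^'n" where u: "norm u = R/2" using vector_choose_size[of "R/2"] R(1) by auto
    have x: "?o + u \<in> ball ?o R" "?o \<in> ball ?o R" using u R(1) by (auto simp: dist_norm)
    have "norm (?o - (?o + u)) \<le> L ^ 3 * gdist (param c ?o) (param c (?o + u))" by (rule norm_le[OF x(2,1)])
    hence "0 < L ^ 3 * gdist p (param c (?o + u))" using u R(1) param_chart[OF c] by simp
    moreover have "0 < L ^ 3" using L3 by linarith
    ultimately have "0 < gdist p (param c (?o + u))" by (simp only: zero_less_mult_pos)
    thus ?thesis using chart_in[OF x(1)] by blast
  qed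
  obtain \<sigma>1 C1 where 1: "0 < \<sigma>1" "0 < C1"
    "\<And>y r. y \<in> V \<Longrightarrow> 0 < r \<Longrightarrow> r \<le> \<sigma>1 \<Longrightarrow> ennreal (r ^ CARD('n) / C1) \<le> emeasure vol (dball y r) \<and>
       emeasure vol (dball y r) \<le> ennreal (C1 * r ^ CARD('n))"
    using local_ball_volume unfolding V_def[symmetric] by blast
  obtain \<sigma>2 C2 where 2: "0 < \<sigma>2" "0 < C2"
    "\<And>y a b. y \<in> V \<Longrightarrow> 0 < a \<Longrightarrow> a < b \<Longrightarrow> b \<le> 2 * a \<Longrightarrow> a \<le> \<sigma>2 \<Longrightarrow>
       emeasure vol (annulus y a b) \<le> ennreal (C2 * (b - a))"
    using local_annulus_volume unfolding V_def[symmetric] by blast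
  let ?\<sigma> = "min \<sigma>1 \<sigma>2" and ?C = "max C1 C2"
  have "ennreal (r ^ CARD('n) / ?C) \<le> emeasure vol (dball y r) \<and>
       emeasure vol (dball y r) \<le> ennreal (?C * r ^ CARD('n))"
    if y: "y \<in> V" and r: "0 < r \<and> r \<le> ?\<sigma>" for y r
  proof -
    have "ennreal (r ^ CARD('n) / ?C) \<le> ennreal (r ^ CARD('n) / C1)"
      using r 1(2) by (intro ennreal_leI divide_left_mono) auto
    moreover have "ennreal (C1 * r ^ CARD('n)) \<le> ennreal (?C * r ^ CARD('n))"
      using r by (intro ennreal_leI mult_right_mono) auto
    ultimately show ?thesis using 1(3)[of y r] y r by (meson min.boundedE order_trans)
  qed
  moreover have "emeasure vol (annulus y a b) \<le> ennreal (?C * (b - a))"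
    if y: "y \<in> V" and a: "0 < a \<and> a < b \<and> b \<le> 2 * a \<and> a \<le> ?\<sigma>" for y a b
  proof -
    have "emeasure vol (annulus y a b) \<le> ennreal (C2 * (b - a))"
      by (rule 2(3)) (use y a in auto)
    also have "\<dots> \<le> ennreal (?C * (b - a))" using a by (intro ennreal_leI mult_right_mono) auto
    finally show ?thesis .
  qed
  moreover have "\<forall>s>0. \<exists>C>0. \<forall>y\<in>M. \<forall>a b. s \<le> a \<and> a < b \<longrightarrow>
       emeasure vol (annulus y a b \<inter> V) \<le> ennreal (C * (b - a))"
    using far_annulus_volume unfolding V_def[symmetric] by blast
  ultimately show ?thesis
    unfolding regular_nbhd_def
    using V_open pV Vfin far_point 1 2 by (intro exI[of _ V] exI[of _ ?\<sigma>] exI[of _ ?C] conjI) auto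
qed

text \<open>For balls up to radius \<sigma> and annuli with a < \<sigma> the patch containing the
  centre decides. An annulus with a \<ge> \<sigma> may meet every patch, and the bounds for its
  pieces are added up, whatever its width.\<close>

lemma global_regularity:
  shows "emeasure vol (M) < \<infinity>"
    and "\<exists>\<sigma>>0. \<exists>C>0.
    (\<forall>y\<in>M. \<forall>r. 0 < r \<and> r \<le> \<sigma> \<longrightarrow>
       ennreal (r ^ CARD('n) / C) \<le> emeasure vol (dball y r) \<and>
       emeasure vol (dball y r) \<le> ennreal (C * r ^ CARD('n))) \<and>
    (\<forall>y\<in>M. \<forall>a b. a < b \<and> (0 < a \<and> b \<le> 2 * a \<or> \<sigma> \<le> a) \<longrightarrow>
       emeasure vol (annulus y a b) \<le> ennreal (C * (b - a)))" (is ?regular)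
proof -
  from local_regularity have "\<forall>p\<in>M. \<exists>V \<sigma> C. regular_nbhd p V \<sigma> C" by blast
  then obtain V \<sigma>\<^sub>0 C\<^sub>0 where reg: "\<And>p. p \<in> M \<Longrightarrow> regular_nbhd p (V p) (\<sigma>\<^sub>0 p) (C\<^sub>0 p)" by metis
  have V: "\<And>p. p \<in> M \<Longrightarrow> openin X (V p)" "\<And>p. p \<in> M \<Longrightarrow> p \<in> V p"
      "\<And>p. p \<in> M \<Longrightarrow> emeasure vol (V p) < \<infinity>"
    and pos: "\<And>p. p \<in> M \<Longrightarrow> 0 < \<sigma>\<^sub>0 p" "\<And>p. p \<in> M \<Longrightarrow> 0 < C\<^sub>0 p"
    and balls: "\<And>p y r. p \<in> M \<Longrightarrow> y \<in> V p \<Longrightarrow> 0 < r \<Longrightarrow> r \<le> \<sigma>\<^sub>0 p \<Longrightarrow>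
       ennreal (r ^ CARD('n) / C\<^sub>0 p) \<le> emeasure vol (dball y r) \<and>
       emeasure vol (dball y r) \<le> ennreal (C\<^sub>0 p * r ^ CARD('n))"
    and near: "\<And>p y a b. p \<in> M \<Longrightarrow> y \<in> V p \<Longrightarrow> 0 < a \<Longrightarrow> a < b \<Longrightarrow> b \<le> 2 * a \<Longrightarrow> a \<le> \<sigma>\<^sub>0 p \<Longrightarrow>
       emeasure vol (annulus y a b) \<le> ennreal (C\<^sub>0 p * (b - a))"
    and far: "\<And>p s. p \<in> M \<Longrightarrow> 0 < s \<Longrightarrow> \<exists>C>0. \<forall>y\<in>M. \<forall>a b. s \<le> a \<and> a < b \<longrightarrow>
       emeasure vol (annulus y a b \<inter> V p) \<le> ennreal (C * (b - a))"
    using reg unfolding regular_nbhd_def by simp_all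
  obtain \<U> where \<U>: "finite \<U>" "\<U> \<subseteq> V ` M" "M \<subseteq> \<Union>\<U>"
  proof -
    have "\<forall>U\<in>V ` M. openin X U" using V(1) by blast
    moreover have "M \<subseteq> \<Union>(V ` M)" using V(2) by blast
    ultimately show ?thesis using compact that unfolding compact_space_alt by meson
  qed
  then obtain P where P: "P \<subseteq> M" "finite P" "\<U> = V ` P" using finite_subset_image by metis
  have cover: "\<exists>p\<in>P. y \<in> V p" if "y \<in> M" for y using that \<U>(3) P(3) by blast
  have V_sets: "V p \<in> sets vol" if "p \<in> P" for p using V(1) P(1) that openin_sets by blast
  have sub: "M \<subseteq> (\<Union>p\<in>P. V p)" using cover by blast
  have "emeasure vol (M) \<le> emeasure vol (\<Union>p\<in>P. V p)"
    using V_sets P(2) sub by (intro emeasure_mono sets.finite_UN) auto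
  also have "\<dots> \<le> (\<Sum>p\<in>P. emeasure vol (V p))" using V_sets P(2) by (intro emeasure_subadditive_finite) auto
  also have "\<dots> < \<infinity>" using V(3) P by (auto simp: subset_iff)
  finally show "emeasure vol (M) < \<infinity>" .
  \<comment> \<open>The inserted 1 keeps \<open>Min\<close> meaningful when \<open>P\<close>, and
    with it the manifold, is empty; the summand 1 in \<open>C\<close> below has the same
    purpose.\<close>
  define \<sigma> where "\<sigma> = Min (insert 1 (\<sigma>\<^sub>0 ` P))"
  have \<sigma>: "0 < \<sigma>" "\<And>p. p \<in> P \<Longrightarrow> \<sigma> \<le> \<sigma>\<^sub>0 p" using P pos(1) by (auto simp: \<sigma>_def)
  have "\<forall>p\<in>P. \<exists>C>0. \<forall>y\<in>M. \<forall>a b. \<sigma> \<le> a \<and> a < b \<longrightarrow>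
       emeasure vol (annulus y a b \<inter> V p) \<le> ennreal (C * (b - a))"
    using far[OF _ \<sigma>(1)] P(1) by blast
  from bchoice[OF this] obtain C\<^sub>1 where C1: "\<And>p. p \<in> P \<Longrightarrow> 0 < C\<^sub>1 p"
    "\<And>p y a b. p \<in> P \<Longrightarrow> y \<in> M \<Longrightarrow> \<sigma> \<le> a \<Longrightarrow> a < b \<Longrightarrow>
       emeasure vol (annulus y a b \<inter> V p) \<le> ennreal (C\<^sub>1 p * (b - a))"
    by blast
  define C where "C = 1 + (\<Sum>p\<in>P. C\<^sub>0 p) + (\<Sum>p\<in>P. C\<^sub>1 p)"
  have S0: "0 \<le> (\<Sum>p\<in>P. C\<^sub>0 p)" using pos(2) P(1) by (intro sum_nonneg) (auto intro: less_imp_le)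
  have S1: "0 \<le> (\<Sum>p\<in>P. C\<^sub>1 p)" using C1(1) by (intro sum_nonneg) (auto intro: less_imp_le)
  have C: "0 < C" "(\<Sum>p\<in>P. C\<^sub>1 p) \<le> C" using S0 S1 by (auto simp: C_def)
  have C0: "C\<^sub>0 p \<le> C" if "p \<in> P" for p
  proof -
    have "C\<^sub>0 p \<le> (\<Sum>p\<in>P. C\<^sub>0 p)" using pos(2) P by (intro member_le_sum that) (auto intro: less_imp_le)
    thus ?thesis using S1 by (simp add: C_def)
  qed
  have "ennreal (r ^ CARD('n) / C) \<le> emeasure vol (dball y r) \<and>
       emeasure vol (dball y r) \<le> ennreal (C * r ^ CARD('n))"
    if y: "y \<in> M" and r: "0 < r \<and> r \<le> \<sigma>" for y r
  proof -
    obtain p where p: "p \<in> P" "y \<in> V p" using cover[OF y] by blast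
    have pX: "p \<in> M" using p P by blast
    have "ennreal (r ^ CARD('n) / C) \<le> ennreal (r ^ CARD('n) / C\<^sub>0 p)"
      using r C C0[OF p(1)] pos(2)[OF pX] by (intro ennreal_leI divide_left_mono) auto
    moreover have "ennreal (C\<^sub>0 p * r ^ CARD('n)) \<le> ennreal (C * r ^ CARD('n))"
      using r C0[OF p(1)] by (intro ennreal_leI mult_right_mono) auto
    moreover have "r \<le> \<sigma>\<^sub>0 p" using r \<sigma>(2)[OF p(1)] by linarith
    ultimately show ?thesis using balls[OF pX p(2), of r] r by (meson order_trans)
  qed
  moreover have "emeasure vol (annulus y a b) \<le> ennreal (C * (b - a))"
    if y: "y \<in> M" and ab: "a < b \<and> (0 < a \<and> b \<le> 2 * a \<or> \<sigma> \<le> a)" for y a b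
  proof (cases "\<sigma> \<le> a")
    case False
    obtain p where p: "p \<in> P" "y \<in> V p" using cover[OF y] by blast
    have pX: "p \<in> M" using p P by blast
    have "emeasure vol (annulus y a b) \<le> ennreal (C\<^sub>0 p * (b - a))"
      by (rule near[OF pX p(2)]) (use ab False \<sigma>(2)[OF p(1)] in auto)
    also have "\<dots> \<le> ennreal (C * (b - a))" using ab C0[OF p(1)] by (intro ennreal_leI mult_right_mono) auto
    finally show ?thesis .
  next
    case True
    define S where "S = annulus y a b"
    have S_sets: "S \<in> sets vol"
      using measurable_sets[OF gdist_measurable[OF y], of "{a..b}"] by (simp add: S_def space_vol vimage_def Int_def conj_commute)
    have "emeasure vol S \<le> emeasure vol (\<Union>p\<in>P. S \<inter> V p)"
      using sub S_sets V_sets P(2) by (intro emeasure_mono sets.finite_UN) (auto simp: S_def)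
    also have "\<dots> \<le> (\<Sum>p\<in>P. emeasure vol (S \<inter> V p))"
      using S_sets V_sets P(2) by (intro emeasure_subadditive_finite) auto
    also have "\<dots> \<le> (\<Sum>p\<in>P. ennreal (C\<^sub>1 p * (b - a)))"
      unfolding S_def by (intro sum_mono C1(2)) (use y True ab in auto)
    also have "\<dots> = ennreal ((\<Sum>p\<in>P. C\<^sub>1 p) * (b - a))"
      using C1(1) ab by (subst sum_ennreal) (auto simp: sum_distrib_right less_imp_le)
    also have "\<dots> \<le> ennreal (C * (b - a))" using C(2) ab by (intro ennreal_leI mult_right_mono) auto
    finally show ?thesis by (simp add: S_def)
  qed
  ultimately show ?regular
    using \<sigma>(1) C(1) by blast
qed

section \<open>Balls and annuli of all radii, and the rescaling\<close>

abbreviation ball_measure :: "'a \<Rightarrow> real \<Rightarrow> real" where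
  "ball_measure y r \<equiv> measure vol (dball y r)"

lemma dist_set_sets:
  assumes "y \<in> M" "T \<in> sets borel" shows "{x\<in>M. gdist y x \<in> T} \<in> sets vol"
  using measurable_sets[OF gdist_measurable[OF assms(1)] assms(2)] by (simp add: space_vol vimage_def Int_def conj_commute)

lemma finite_measure_vol: "finite_measure vol"
  using global_regularity(1) by (intro finite_measureI) (simp add: space_vol less_top)

text \<open>Beyond \<sigma> monotonicity suffices: the ball contains the one of radius \<sigma> and
  has at most the total volume. In \<open>C'\<close> the second summand serves the upper bound
  there, the third one the lower bound, where r^n is at most (D/\<sigma>)^n times
  \<sigma>^n.\<close>

lemma ball_measure_bounds:
  assumes D: "0 < D"
  shows "\<exists>C>0. \<forall>y\<in>M. \<forall>r. 0 < r \<and> r \<le> D \<longrightarrow> r ^ CARD('n) \<le> C * ball_measure y r \<and> ball_measure y r \<le> C * r ^ CARD('n)"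
proof -
  interpret finite_measure vol by (rule finite_measure_vol)
  let ?n = "CARD('n)"
  obtain \<sigma> C where \<sigma>: "0 < \<sigma>" and C: "0 < C" and b: "\<And>y r. y \<in> M \<Longrightarrow> 0 < r \<Longrightarrow> r \<le> \<sigma> \<Longrightarrow>
       ennreal (r ^ ?n / C) \<le> emeasure vol (dball y r) \<and>
       emeasure vol (dball y r) \<le> ennreal (C * r ^ ?n)"
    using global_regularity(2) by meson
  have small: "r ^ ?n \<le> C * ball_measure y r" "ball_measure y r \<le> C * r ^ ?n"
    if "y \<in> M" "0 < r" "r \<le> \<sigma>" for y r
    using b[OF that] C that by (simp_all add: emeasure_eq_measure pos_divide_le_eq mult.commute)
  define V where "V = measure vol (space vol)"
  have V0: "0 \<le> V" by (simp add: V_def)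
  define C' where "C' = C + V / \<sigma> ^ ?n + C * (D / \<sigma>) ^ ?n"
  have t: "0 \<le> V / \<sigma> ^ ?n" "0 \<le> C * (D / \<sigma>) ^ ?n" using V0 \<sigma> C D by auto
  have C': "C \<le> C'" "V / \<sigma> ^ ?n \<le> C'" "C * (D / \<sigma>) ^ ?n \<le> C'" using t C by (auto simp: C'_def)
  have "r ^ ?n \<le> C' * ball_measure y r \<and> ball_measure y r \<le> C' * r ^ ?n"
    if y: "y \<in> M" and r: "0 < r \<and> r \<le> D" for y r
  proof (cases "r \<le> \<sigma>")
    case True
    have "C * ball_measure y r \<le> C' * ball_measure y r" "C * r ^ ?n \<le> C' * r ^ ?n"
      using C' r by (auto intro!: mult_right_mono)
    thus ?thesis using small[OF y _ True] r by linarith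
  next
    case False
    have "r ^ ?n \<le> D ^ ?n" using r by (intro power_mono) auto
    also have "\<dots> = (D / \<sigma>) ^ ?n * \<sigma> ^ ?n" using \<sigma> by (simp add: power_divide)
    also have "\<dots> \<le> (D / \<sigma>) ^ ?n * (C * ball_measure y \<sigma>)" using small(1)[OF y \<sigma>] D \<sigma> by (intro mult_left_mono) auto
    also have "\<dots> = C * (D / \<sigma>) ^ ?n * ball_measure y \<sigma>" by simp
    also have "\<dots> \<le> C' * ball_measure y r"
    proof (intro mult_mono C' finite_measure_mono)
      show "dball y r \<in> sets vol" using dist_set_sets[OF y, of "{..<r}"] by simp
    qed (use False C C' in auto)
    finally have 1: "r ^ ?n \<le> C' * ball_measure y r" .
    have "ball_measure y r \<le> V" unfolding V_def by (rule bounded_measure)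
    also have "V = V / \<sigma> ^ ?n * \<sigma> ^ ?n" using \<sigma> by simp
    also have "\<dots> \<le> C' * r ^ ?n" using C' C False \<sigma> by (intro mult_mono power_mono) auto
    finally show ?thesis using 1 by simp
  qed
  moreover have "0 < C'" using C C'(1) by linarith
  ultimately show ?thesis by blast
qed

text \<open>What \<open>global_regularity\<close> leaves open are wide annuli, those with a = 0
  included. There b \<le> 2(b - a), and a ball of radius 2b around the annulus has volume O(b^n),
  hence O(b) for b \<le> D.\<close>

lemma annulus_measure_bound:
  assumes D: "0 < D"
  shows "\<exists>C>0. \<forall>y\<in>M. \<forall>a b. 0 \<le> a \<and> a < b \<and> b \<le> D \<longrightarrow>
    measure vol (annulus y a b) \<le> C * (b - a)"
proof -
  interpret finite_measure vol by (rule finite_measure_vol)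
  obtain \<sigma> C where \<sigma>: "0 < \<sigma>" and C: "0 < C" and ann: "\<And>y a b. y \<in> M \<Longrightarrow> a < b \<Longrightarrow> 0 < a \<and> b \<le> 2 * a \<or> \<sigma> \<le> a \<Longrightarrow>
       emeasure vol (annulus y a b) \<le> ennreal (C * (b - a))"
    using global_regularity(2) by meson
  \<comment> \<open>The open ball that contains the closed annulus is given radius 2b, which can be
    as large as 2D.\<close>
  have "0 < 2 * D" using D by simp
  from ball_measure_bounds[OF this] obtain C1 where C1: "0 < C1"
    "\<And>y r. y \<in> M \<Longrightarrow> 0 < r \<Longrightarrow> r \<le> 2 * D \<Longrightarrow> ball_measure y r \<le> C1 * r ^ CARD('n)" by blast
  obtain k where k: "CARD('n) = Suc k" using zero_less_card_finite[where 'a='n] by (cases "CARD('n)") auto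
  define C2 where "C2 = C1 * (2 * D) ^ k * 4"
  have C2: "0 \<le> C2" using C1 D by (simp add: C2_def)
  have "measure vol (annulus y a b) \<le> (C + C2) * (b - a)"
    if y: "y \<in> M" and ab: "0 \<le> a \<and> a < b \<and> b \<le> D" for y a b
  proof (cases "0 < a \<and> b \<le> 2 * a")
    case True
    have "measure vol (annulus y a b) \<le> C * (b - a)"
      using ann[OF y, of a b] True ab C by (simp add: emeasure_eq_measure)
    also have "\<dots> \<le> (C + C2) * (b - a)" using ab C2 by (intro mult_right_mono) auto
    finally show ?thesis .
  next
    case False
    hence b: "b \<le> 2 * (b - a)" using ab by auto
    have b0: "0 < b" using ab by simp
    have "measure vol (annulus y a b) \<le> ball_measure y (2 * b)"
    proof (rule finite_measure_mono)
      show "dball y (2 * b) \<in> sets vol" using dist_set_sets[OF y, of "{..<2 * b}"] by simp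
    qed (use b0 in auto)
    also have "\<dots> \<le> C1 * (2 * b) ^ CARD('n)" by (rule C1(2)[OF y]) (use ab in auto)
    also have "\<dots> = (C1 * (2 * b) ^ k) * (2 * b)" by (simp add: k)
    also have "\<dots> \<le> (C1 * (2 * D) ^ k) * (2 * (2 * (b - a)))"
      using C1 ab b D by (intro mult_mono mult_left_mono power_mono) auto
    also have "\<dots> = C2 * (b - a)" by (simp add: C2_def)
    also have "\<dots> \<le> (C + C2) * (b - a)" using ab C by (intro mult_right_mono) auto
    finally show ?thesis .
  qed
  moreover have "0 < C + C2" using C C2 by simp
  ultimately show ?thesis by blast
qed

text \<open>Continuity of \<open>gdist p\<close> on a compact space bounds all distances, so the
  supremum is a true upper bound. Positivity comes from the far point recorded in
  \<open>regular_nbhd\<close>.\<close>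

lemma diameter:
  assumes "M \<noteq> {}"
  shows "0 < geodesic_diam X A g"
    and "\<And>x y. x \<in> M \<Longrightarrow> y \<in> M \<Longrightarrow> gdist x y \<le> geodesic_diam X A g"
proof -
  obtain p where p: "p \<in> M" using assms by blast
  have "compactin euclideanreal (gdist p ` M)"
    using compact gdist_continuous[OF p] unfolding compact_space_def by (rule image_compactin)
  hence "bounded (gdist p ` M)" by (simp add: compact_imp_bounded)
  then obtain B where "\<forall>t\<in>gdist p ` M. norm t \<le> B" unfolding bounded_iff by blast
  hence B: "gdist p x \<le> B" if "x \<in> M" for x using that by fastforce
  have le: "gdist x y \<le> 2 * B" if "x \<in> M" "y \<in> M" for x y
    using gdist_triangle[OF that(1) p that(2)] gdist_commute[of x p] B[OF that(1)] B[OF that(2)] by simp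
  have bdd: "bdd_above {gdist x y |x y. x \<in> M \<and> y \<in> M}"
    using le by (intro bdd_aboveI[of _ "2 * B"]) blast
  show *: "gdist x y \<le> geodesic_diam X A g" if "x \<in> M" "y \<in> M" for x y
    unfolding geodesic_diam_def using that by (intro cSup_upper bdd) blast
  obtain q where q: "q \<in> M" "0 < gdist p q" using local_regularity[OF p] unfolding regular_nbhd_def by blast
  show "0 < geodesic_diam X A g" using *[OF p q(1)] q(2) by linarith
qed

theorem ball_volume_regularity:
  defines "v \<equiv> ball_volume (rescaled_dist X A g) (rescaled_measure vol)"
  shows "\<exists>c\<^sub>1 c\<^sub>2 :: real. c\<^sub>1 > 0 \<and> c\<^sub>2 > 0 \<and>
     (\<forall>y \<in> M. \<forall>r \<in> {0..1}.
        inverse c\<^sub>1 * r ^ CARD('n) \<le> v y r \<and> v y r \<le> c\<^sub>1 * r ^ CARD('n)) \<and>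
     (\<forall>y \<in> M. \<forall>r\<^sub>1 \<in> {0..1}. \<forall>r\<^sub>2 \<in> {0..1}.
        \<bar>v y r\<^sub>1 - v y r\<^sub>2\<bar> \<le> c\<^sub>2 * \<bar>r\<^sub>1 - r\<^sub>2\<bar>)"
proof (cases "M = {}")
  case True
  thus ?thesis by (intro exI[of _ 1]) auto
next
  case False
  interpret finite_measure vol by (rule finite_measure_vol)
  let ?n = "CARD('n)"
  define D where "D = geodesic_diam X A g"
  have D: "0 < D" and diam: "\<And>x y. x \<in> M \<Longrightarrow> y \<in> M \<Longrightarrow> gdist x y \<le> D"
    using diameter[OF False] by (auto simp: D_def)
  obtain C where C: "0 < C" and bb: "\<And>y r. y \<in> M \<Longrightarrow> 0 < r \<Longrightarrow> r \<le> D \<Longrightarrow>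
      r ^ ?n \<le> C * ball_measure y r \<and> ball_measure y r \<le> C * r ^ ?n"
    using ball_measure_bounds[OF D] by blast
  obtain C' where C': "0 < C'" and ann: "\<And>y a b. y \<in> M \<Longrightarrow> 0 \<le> a \<Longrightarrow> a < b \<Longrightarrow> b \<le> D \<Longrightarrow>
      measure vol (annulus y a b) \<le> C' * (b - a)"
    using annulus_measure_bound[OF D] by blast
  define V where "V = measure vol (space vol)"
  have V: "0 < V"
  proof -
    obtain p where p: "p \<in> M" using False by blast
    have "0 < D ^ ?n" using D by simp
    also have "\<dots> \<le> C * ball_measure p D" using bb[OF p D] by simp
    also have "\<dots> \<le> C * V" unfolding V_def using C by (intro mult_left_mono bounded_measure) auto
    finally show ?thesis using C by (simp add: zero_less_mult_iff)
  qed
  have scale: "measure (rescaled_measure vol) S = measure vol S / V" for S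
  proof -
    have "1 / emeasure vol (space vol) = ennreal (1 / V)"
      using V by (simp add: emeasure_eq_measure V_def divide_ennreal[symmetric] flip: ennreal_1)
    thus ?thesis using V by (simp add: rescaled_measure_def measure_def enn2real_mult)
  qed
  define S where "S y r = (if r \<le> 0 then {} else if 1 \<le> r then M else dball y (r * D))" for y r
  have v: "v y r = measure vol (S y r) / V" for y r
  proof -
    have "space (rescaled_measure vol) = M"
      unfolding rescaled_measure_def space_vol[symmetric] by (rule space_scale_measure)
    hence "metric_ball (space (rescaled_measure vol)) (rescaled_dist X A g) y r = S y r"
      using D by (auto simp: metric_ball_def S_def rescaled_dist_def D_def[symmetric]
          pos_divide_less_eq gdist_commute[of y])
    thus ?thesis by (simp add: v_def ball_volume_def scale)
  qed
  have S_sets: "S y r \<in> sets vol" if "y \<in> M" for y r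
    using dist_set_sets[OF that, of "{..<r * D}"] sets.top[of vol] by (simp add: S_def space_vol)
  \<comment> \<open>The summands serve, in this order, the case r = 1, where \<open>v y r\<close> is
    1, the upper bound and the lower bound. The factors \<open>D ^ ?n\<close> and \<open>V\<close>
    undo the rescaling.\<close>
  define c1 where "c1 = 1 + C * D ^ ?n / V + C * V / D ^ ?n"
  have p1: "0 < C * D ^ ?n / V" "0 < C * V / D ^ ?n" using C D V by auto
  have c1: "1 \<le> c1" "C * D ^ ?n / V \<le> c1" "C * V / D ^ ?n \<le> c1" using p1 by (auto simp: c1_def)
  have condA: "inverse c1 * r ^ ?n \<le> v y r \<and> v y r \<le> c1 * r ^ ?n" if y: "y \<in> M" and r: "r \<in> {0..1}" for y r
  proof -
    consider "r = 0" | "r = 1" | "0 < r" "r < 1" using r by fastforce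
    thus ?thesis
    proof cases
      \<comment> \<open>The ball is empty by convention, and \<open>0 ^ CARD('n)\<close> is 0
        because the dimension is positive.\<close>
      case 1
      thus ?thesis by (simp add: v S_def power_0_left)
    next
      case 2
      hence "v y r = 1" using V by (simp add: v S_def V_def space_vol)
      thus ?thesis using 2 c1(1) by (simp add: inverse_le_1_iff)
    next
      case 3
      have rD: "0 < r * D" "r * D \<le> D" using 3 D by (auto simp: mult_left_le_one_le)
      have v': "v y r = ball_measure y (r * D) / V" using 3 by (simp add: v S_def)
      have "v y r \<le> C * (r * D) ^ ?n / V" unfolding v' using bb[OF y rD] V by (intro divide_right_mono) auto
      also have "\<dots> = (C * D ^ ?n / V) * r ^ ?n" by (simp add: power_mult_distrib)
      also have "\<dots> \<le> c1 * r ^ ?n" using c1 3 by (intro mult_right_mono) auto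
      finally have up: "v y r \<le> c1 * r ^ ?n" .
      have "r ^ ?n = (r * D) ^ ?n / D ^ ?n" using D by (simp add: power_mult_distrib)
      also have "\<dots> \<le> C * ball_measure y (r * D) / D ^ ?n" using bb[OF y rD] D by (intro divide_right_mono) auto
      also have "\<dots> = (C * V / D ^ ?n) * v y r" using V by (simp add: v')
      also have "\<dots> \<le> c1 * v y r" using c1 V by (intro mult_right_mono) (auto simp: v')
      finally have "inverse c1 * r ^ ?n \<le> v y r" using c1(1) by (simp add: field_simps)
      thus ?thesis using up by simp
    qed
  qed
  have lip: "\<bar>v y r1 - v y r2\<bar> \<le> C' * D / V * \<bar>r1 - r2\<bar>"
    if y: "y \<in> M" and r: "0 \<le> r1" "r1 < r2" "r2 \<le> 1" for y r1 r2
  proof -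
    have sub: "S y r1 \<subseteq> S y r2"
    proof
      fix x assume x: "x \<in> S y r1"
      hence "0 < r1" "r1 < 1" "x \<in> M" "gdist y x < r1 * D" using r by (auto simp: S_def split: if_splits)
      moreover have "r1 * D \<le> r2 * D" using r D by (intro mult_right_mono) auto
      ultimately show "x \<in> S y r2" using r by (auto simp: S_def)
    qed
    \<comment> \<open>For \<open>r2 = 1\<close> the convention adds the points at distance exactly
      \<open>D\<close> from the centre. Annuli are closed so that they contain these points.\<close>
    have cov: "S y r2 \<subseteq> S y r1 \<union> annulus y (r1 * D) (r2 * D)"
    proof
      fix x assume x: "x \<in> S y r2"
      hence xX: "x \<in> M" by (auto simp: S_def split: if_splits)
      have up: "gdist y x \<le> r2 * D"
      proof (cases "r2 = 1")
        case True
        thus ?thesis using diam[OF y xX] by simp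
      qed (use x r in \<open>auto simp: S_def split: if_splits\<close>)
      show "x \<in> S y r1 \<union> annulus y (r1 * D) (r2 * D)"
      proof (cases "r1 * D \<le> gdist y x")
        case False
        have "r1 \<noteq> 0" using False gdist_nonneg[OF y xX] by auto
        thus ?thesis using False xX r by (auto simp: S_def)
      qed (use xX up in simp)
    qed
    have ann_sets: "annulus y (r1 * D) (r2 * D) \<in> sets vol" by (rule dist_set_sets[OF y]) simp
    have rD: "0 \<le> r1 * D" "r1 * D < r2 * D" "r2 * D \<le> D" using r D by (auto simp: mult_left_le_one_le)
    have "measure vol (S y r2) \<le> measure vol (S y r1 \<union> annulus y (r1 * D) (r2 * D))"
      using cov S_sets[OF y] ann_sets by (intro finite_measure_mono) auto
    also have "\<dots> \<le> measure vol (S y r1) + measure vol (annulus y (r1 * D) (r2 * D))"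
      by (rule measure_Un_le[OF S_sets[OF y] ann_sets])
    also have "measure vol (annulus y (r1 * D) (r2 * D)) \<le> C' * (r2 * D - r1 * D)" by (rule ann[OF y rD])
    finally have "measure vol (S y r2) - measure vol (S y r1) \<le> C' * D * (r2 - r1)" by (simp add: algebra_simps)
    moreover have "measure vol (S y r1) \<le> measure vol (S y r2)" using sub S_sets[OF y] by (intro finite_measure_mono)
    ultimately have "\<bar>measure vol (S y r1) - measure vol (S y r2)\<bar> / V \<le> C' * D * (r2 - r1) / V"
      using V by (intro divide_right_mono) auto
    moreover have "\<bar>v y r1 - v y r2\<bar> = \<bar>measure vol (S y r1) - measure vol (S y r2)\<bar> / V"
      using V by (simp add: v flip: diff_divide_distrib)
    ultimately show ?thesis using r by simp
  qed
  have condB: "\<bar>v y r1 - v y r2\<bar> \<le> C' * D / V * \<bar>r1 - r2\<bar>"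
    if y: "y \<in> M" and r: "r1 \<in> {0..1}" "r2 \<in> {0..1}" for y r1 r2
  proof -
    consider "r1 = r2" | "r1 < r2" | "r2 < r1" by linarith
    thus ?thesis using lip[OF y, of r1 r2] lip[OF y, of r2 r1] r by cases (auto simp: abs_minus_commute)
  qed
  have "0 < c1" "0 < C' * D / V" using c1(1) C' D V by auto
  with condA condB show ?thesis by blast
qed

end

theorem proposition1p1:
  fixes X :: "'a topology"
    and A :: "('a, 'n::finite) chart set"
    and g :: "('a, 'n) metric_components"
    and vol :: "'a measure"
  assumes "riemannian_manifold X A g"
    and "compact_space X"
    and "connected_space X"
    and "is_riemannian_measure X A g vol"
  defines "v \<equiv> ball_volume (rescaled_dist X A g) (rescaled_measure vol)"
    and "d \<equiv> CARD('n)"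
  shows "\<exists>c\<^sub>1 c\<^sub>2 :: real. c\<^sub>1 > 0 \<and> c\<^sub>2 > 0 \<and>
     (\<forall>y \<in> topspace X. \<forall>r \<in> {0..1}.
        inverse c\<^sub>1 * r ^ d \<le> v y r \<and> v y r \<le> c\<^sub>1 * r ^ d) \<and>
     (\<forall>y \<in> topspace X. \<forall>r\<^sub>1 \<in> {0..1}. \<forall>r\<^sub>2 \<in> {0..1}.
        \<bar>v y r\<^sub>1 - v y r\<^sub>2\<bar> \<le> c\<^sub>2 * \<bar>r\<^sub>1 - r\<^sub>2\<bar>)"
proof -
  interpret riemannian_volume X A g vol
    by unfold_locales (use assms(1-4) in auto)
  show ?thesis unfolding v_def d_def by (rule ball_volume_regularity)
qed

end
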